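(* Let $\mathcal{M}_f$ be the $3$-dimensional Lorentzian Walker manifold defined by a smooth function $f=f(x,y)$. Suppose that $f_{yy}$ is never zero and non-constant. (1) If $f_{yyy}$ never vanishes, then $\mathcal{M}_f$ is homothety $1$-curvature homogeneous. (2) If $f_{yy}=\alpha(x)$ with $\alpha_x$ never zero, then $\mathcal{M}_f$ is homothety $1$-curvature homogeneous if and only if $f=a(x-x_0)^{-2}y^2+\beta(x)y+\gamma(x)$ where $0\ne a\in\mathbb{R}$ (and $x_0\in\mathbb{R}$). This manifold is locally homogeneous. (3) Assume that $\mathcal{M}_f$ is homothety $2$-curvature homogeneous, and that $f_{yy}$ and $f_{yyy}$ never vanish. Then $\mathcal{M}_f$ is locally isometric to one of the following examples: (a) $\mathcal{M}_{\pm e^{ay}}$ for some $a\ne0$ and $M=\mathbb{R}^3$. This manifold is homogeneous. (b) $\mathcal{M}_{\pm\ln(y)}$ and $M=\mathbb{R}\times(0,\infty)\times\mathbb{R}$. This manifold is a homothety homogeneous manifold which is not locally homogeneous but which is cohomogeneity one. (c) $\mathcal{M}_{\pm y^\varepsilon}$ for $\varepsilon\ne0,1,2$ and $M=\mathbb{R}\times(0,\infty)\times\mathbb{R}$. This manifold is a homothety homogeneous manifold which is not locally homogeneous but which is cohomogeneity one.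
   Context: Let $(x,y,\tilde x)$ be (local) coordinates on a connected open subset $M\subset\mathbb{R}^3$. $\mathcal{M}_f=(M,g_f)$ is the Lorentzian manifold whose only (possibly) non-zero metric components are $$g_f(\partial_x,\partial_x)=-2f(x,y),\quad g_f(\partial_x,\partial_{\tilde x})=g_f(\partial_y,\partial_y)=1,$$ where $f$ is smooth and depends only on $(x,y)$. Subscripts on $f$ and $\alpha$ denote partial derivatives. A pseudo-Riemannian manifold $(M,g)$ is homothety $k$-curvature homogeneous if for all $P,Q\in M$ there are a linear isometry $\phi:T_PM\to T_QM$ and a real $\lambda\ne0$ with $\phi^*(\nabla^\ell R_Q)=\lambda^{-\ell-2}\nabla^\ell R_P$ for $0\le\ell\le k$, where $\nabla^\ell R$ is the $\ell$-th covariant derivative of the curvature tensor. It is homogeneous (resp. homothety homogeneous) if its group of isometries (resp. of homotheties, i.e. diffeomorphisms $T$ with $T^*g=\lambda^2g$ for a constant $\lambda>0$) acts transitively on $M$; it is locally homogeneous if any point can be mapped to any other by an isometry between neighborhoods. It is cohomogeneity one if the orbits of the isometry group have codimension one.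
   Formalization: In (2) the form with global β(x), γ(x) is claimed only when the y-slices of M are connected (it fails on C-shaped domains); for general connected M, a and x_0 are global but β, γ exist only near each point. *)

theory Defs
  imports "HOL-Analysis.Analysis"
begin

section \<open>Smooth maps on open sets\<close>

text \<open>These notions are only meant for open \<open>S\<close>: all derivatives are taken at points,
  not within the set.\<close>

primrec C_diff_on :: "nat \<Rightarrow> 'a::real_normed_vector set \<Rightarrow> ('a \<Rightarrow> 'b::real_normed_vector) \<Rightarrow> bool"
  where
    "C_diff_on 0 S F \<longleftrightarrow> continuous_on S F"
  | "C_diff_on (Suc k) S F \<longleftrightarrow>
       (\<forall>p\<in>S. F differentiable (at p)) \<and>
       (\<forall>v. C_diff_on k S (\<lambda>p. frechet_derivative F (at p) v))"

definition smooth_on :: "'a::real_normed_vector set \<Rightarrow> ('a \<Rightarrow> 'b::real_normed_vector) \<Rightarrow> bool"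
  where "smooth_on S F \<longleftrightarrow> (\<forall>k. C_diff_on k S F)"

definition diffeomorphism_between ::
    "'a::real_normed_vector set \<Rightarrow> 'b::real_normed_vector set \<Rightarrow> ('a \<Rightarrow> 'b) \<Rightarrow> bool"
  where "diffeomorphism_between U V T \<longleftrightarrow>
    smooth_on U T \<and> (\<exists>S. smooth_on V S \<and> homeomorphism U V T S)"

text \<open>A subset is an (embedded) hypersurface, i.e. a submanifold of codimension one, if it is
  locally the zero set of a smooth function without critical points.\<close>

definition smooth_hypersurface :: "'a::real_normed_vector set \<Rightarrow> bool"
  where "smooth_hypersurface S \<longleftrightarrow>
    (\<forall>p\<in>S. \<exists>U (F :: 'a \<Rightarrow> real). open U \<and> p \<in> U \<and> smooth_on U F \<and>
       (\<forall>q\<in>U. frechet_derivative F (at q) \<noteq> (\<lambda>v. 0)) \<and> S \<inter> U = {q\<in>U. F q = 0})"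


section \<open>Pseudo-Riemannian geometry on an open subset of coordinate space\<close>

text \<open>A metric is given by its matrix of components \<open>g p $ i $ j = g(\<partial>\<^sub>i, \<partial>\<^sub>j)\<close> at each point
  \<open>p\<close>; its values outside the open set under consideration are irrelevant.  A covariant tensor
  field of rank \<open>r\<close> is given by its components, indexed by lists of length \<open>r\<close>.\<close>

type_synonym 'n metric = "real^'n \<Rightarrow> real^'n^'n"
type_synonym 'n tensor_field = "real^'n \<Rightarrow> 'n list \<Rightarrow> real"

definition metric_form :: "'n::finite metric \<Rightarrow> real^'n \<Rightarrow> real^'n \<Rightarrow> real^'n \<Rightarrow> real"
  where "metric_form g p u v = (\<Sum>i\<in>UNIV. \<Sum>j\<in>UNIV. g p $ i $ j * u $ i * v $ j)"

definition partial_deriv :: "'n::finite \<Rightarrow> (real^'n \<Rightarrow> real) \<Rightarrow> real^'n \<Rightarrow> real"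
  where "partial_deriv i F p = frechet_derivative F (at p) (axis i 1)"

text \<open>\<open>christoffel g k i j p\<close> is the Christoffel symbol with upper index \<open>k\<close> of the Levi-Civita
  connection, \<open>\<nabla>\<^bsub>\<partial>i\<^esub> \<partial>j = (\<Sum>k. \<Gamma>\<^bsup>k\<^esup>\<^bsub>ij\<^esub> \<partial>k)\<close>.\<close>

definition christoffel :: "'n::finite metric \<Rightarrow> 'n \<Rightarrow> 'n \<Rightarrow> 'n \<Rightarrow> real^'n \<Rightarrow> real"
  where "christoffel g k i j p =
    (\<Sum>l\<in>UNIV. matrix_inv (g p) $ k $ l *
       (partial_deriv i (\<lambda>q. g q $ j $ l) p + partial_deriv j (\<lambda>q. g q $ i $ l) p
        - partial_deriv l (\<lambda>q. g q $ i $ j) p)) / 2"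

text \<open>\<open>curvature_op g m i j k\<close> is the \<open>m\<close>-th component of \<open>R(\<partial>\<^sub>i, \<partial>\<^sub>j) \<partial>\<^sub>k\<close>, where
  \<open>R(X, Y) = \<nabla>\<^sub>X \<nabla>\<^sub>Y - \<nabla>\<^sub>Y \<nabla>\<^sub>X - \<nabla>\<^bsub>[X,Y]\<^esub>\<close>.\<close>

definition curvature_op ::
    "'n::finite metric \<Rightarrow> 'n \<Rightarrow> 'n \<Rightarrow> 'n \<Rightarrow> 'n \<Rightarrow> real^'n \<Rightarrow> real"
  where "curvature_op g m i j k p =
    partial_deriv i (christoffel g m j k) p - partial_deriv j (christoffel g m i k) p
    + (\<Sum>s\<in>UNIV. christoffel g m i s p * christoffel g s j k p
                - christoffel g m j s p * christoffel g s i k p)"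

text \<open>The curvature tensor of type \<open>(0,4)\<close>: \<open>R(X, Y, Z, W) = g(R(X, Y) Z, W)\<close>.\<close>

definition curvature_tensor :: "'n::finite metric \<Rightarrow> 'n tensor_field"
  where "curvature_tensor g p is =
    (case is of [i, j, k, l] \<Rightarrow> \<Sum>m\<in>UNIV. g p $ m $ l * curvature_op g m i j k p | _ \<Rightarrow> 0)"

text \<open>The covariant derivative of a covariant tensor field; the differentiation index is the
  first one.\<close>

fun cov_deriv :: "'n::finite metric \<Rightarrow> 'n tensor_field \<Rightarrow> 'n tensor_field"
  where
    "cov_deriv g A p [] = 0"
  | "cov_deriv g A p (i # is) =
       partial_deriv i (\<lambda>q. A q is) p
       - (\<Sum>m<length is. \<Sum>s\<in>UNIV. christoffel g s i (is ! m) p * A p (is[m := s]))"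

definition cov_deriv_curvature :: "'n::finite metric \<Rightarrow> nat \<Rightarrow> 'n tensor_field"
  where "cov_deriv_curvature g l = (cov_deriv g ^^ l) (curvature_tensor g)"

text \<open>The value of a tensor field at \<open>p\<close> on a list of tangent vectors.\<close>

definition tensor_apply :: "'n::finite tensor_field \<Rightarrow> real^'n \<Rightarrow> (real^'n) list \<Rightarrow> real"
  where "tensor_apply A p vs =
    (\<Sum>is\<in>{is. length is = length vs}. A p is * (\<Prod>m<length vs. vs ! m $ (is ! m)))"

text \<open>Since \<open>g p\<close> is nondegenerate, a linear map preserving the metric forms is automatically
  bijective.\<close>

definition linear_isometry ::
    "'n::finite metric \<Rightarrow> real^'n \<Rightarrow> real^'n \<Rightarrow> (real^'n \<Rightarrow> real^'n) \<Rightarrow> bool"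
  where "linear_isometry g P Q \<phi> \<longleftrightarrow>
    linear \<phi> \<and> (\<forall>u v. metric_form g Q (\<phi> u) (\<phi> v) = metric_form g P u v)"

definition homothety_curvature_homogeneous ::
    "nat \<Rightarrow> (real^'n::finite) set \<Rightarrow> 'n metric \<Rightarrow> bool"
  where "homothety_curvature_homogeneous k M g \<longleftrightarrow>
    (\<forall>P\<in>M. \<forall>Q\<in>M. \<exists>\<phi> c. linear_isometry g P Q \<phi> \<and> c \<noteq> 0 \<and>
       (\<forall>l\<le>k. \<forall>vs. length vs = l + 4 \<longrightarrow>
          tensor_apply (cov_deriv_curvature g l) Q (map \<phi> vs) =
          c powi (- int l - 2) * tensor_apply (cov_deriv_curvature g l) P vs))"

text \<open>\<open>T\<close> is a diffeomorphism from \<open>U\<close> onto \<open>V\<close> with \<open>T\<^sup>* h = c\<^sup>2 g\<close>.\<close>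

definition homothety_between ::
    "real \<Rightarrow> (real^'n::finite) set \<Rightarrow> 'n metric \<Rightarrow> (real^'n) set \<Rightarrow> 'n metric \<Rightarrow>
     (real^'n \<Rightarrow> real^'n) \<Rightarrow> bool"
  where "homothety_between c U g V h T \<longleftrightarrow>
    diffeomorphism_between U V T \<and>
    (\<forall>p\<in>U. \<forall>u v.
       metric_form h (T p) (frechet_derivative T (at p) u) (frechet_derivative T (at p) v)
       = c\<^sup>2 * metric_form g p u v)"

abbreviation isometry_between ::
    "(real^'n::finite) set \<Rightarrow> 'n metric \<Rightarrow> (real^'n) set \<Rightarrow> 'n metric \<Rightarrow>
     (real^'n \<Rightarrow> real^'n) \<Rightarrow> bool"
  where "isometry_between \<equiv> homothety_between 1"

definition homogeneous :: "(real^'n::finite) set \<Rightarrow> 'n metric \<Rightarrow> bool"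
  where "homogeneous M g \<longleftrightarrow>
    (\<forall>P\<in>M. \<forall>Q\<in>M. \<exists>T. isometry_between M g M g T \<and> T P = Q)"

definition homothety_homogeneous :: "(real^'n::finite) set \<Rightarrow> 'n metric \<Rightarrow> bool"
  where "homothety_homogeneous M g \<longleftrightarrow>
    (\<forall>P\<in>M. \<forall>Q\<in>M. \<exists>c>0. \<exists>T. homothety_between c M g M g T \<and> T P = Q)"

definition locally_isometric_at ::
    "(real^'n::finite) set \<Rightarrow> 'n metric \<Rightarrow> real^'n \<Rightarrow> (real^'n) set \<Rightarrow> 'n metric \<Rightarrow> real^'n \<Rightarrow> bool"
  where "locally_isometric_at M g P N h Q \<longleftrightarrow>
    (\<exists>U V T. open U \<and> P \<in> U \<and> U \<subseteq> M \<and> open V \<and> Q \<in> V \<and> V \<subseteq> N \<and>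
       isometry_between U g V h T \<and> T P = Q)"

definition locally_homogeneous :: "(real^'n::finite) set \<Rightarrow> 'n metric \<Rightarrow> bool"
  where "locally_homogeneous M g \<longleftrightarrow> (\<forall>P\<in>M. \<forall>Q\<in>M. locally_isometric_at M g P M g Q)"

text \<open>Every point of \<open>M\<close> has a neighbourhood isometric to an open subset of the model \<open>N\<close>.\<close>

definition locally_isometric ::
    "(real^'n::finite) set \<Rightarrow> 'n metric \<Rightarrow> (real^'n) set \<Rightarrow> 'n metric \<Rightarrow> bool"
  where "locally_isometric M g N h \<longleftrightarrow> (\<forall>P\<in>M. \<exists>Q\<in>N. locally_isometric_at M g P N h Q)"

definition isometry_orbit :: "(real^'n::finite) set \<Rightarrow> 'n metric \<Rightarrow> real^'n \<Rightarrow> (real^'n) set"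
  where "isometry_orbit M g P = {T P | T. isometry_between M g M g T}"

definition cohomogeneity_one :: "(real^'n::finite) set \<Rightarrow> 'n metric \<Rightarrow> bool"
  where "cohomogeneity_one M g \<longleftrightarrow> (\<forall>P\<in>M. smooth_hypersurface (isometry_orbit M g P))"


section \<open>The Walker metrics\<close>

text \<open>The coordinates \<open>(x, y, x\<tilde>)\<close> of a point \<open>p\<close> are \<open>(p $ 1, p $ 2, p $ 3)\<close>.\<close>

definition walker_metric :: "(real \<Rightarrow> real \<Rightarrow> real) \<Rightarrow> 3 metric"
  where "walker_metric f p = (\<chi> i j.
    if i = 1 \<and> j = 1 then - 2 * f (p $ 1) (p $ 2)
    else if (i = 1 \<and> j = 3) \<or> (i = 3 \<and> j = 1) \<or> (i = 2 \<and> j = 2) then 1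
    else 0)"

definition xy_image :: "(real^3) set \<Rightarrow> (real \<times> real) set"
  where "xy_image M = (\<lambda>p. (p $ 1, p $ 2)) ` M"

definition x_image :: "(real^3) set \<Rightarrow> real set"
  where "x_image M = (\<lambda>p. p $ 1) ` M"

text \<open>Smoothness of a function \<open>f(x,y)\<close> on \<open>M\<close>; for open \<open>M\<close>, the set \<open>xy_image M\<close> is open.\<close>

definition smooth_xy_on :: "(real^3) set \<Rightarrow> (real \<Rightarrow> real \<Rightarrow> real) \<Rightarrow> bool"
  where "smooth_xy_on M f \<longleftrightarrow> smooth_on (xy_image M) (\<lambda>(x, y). f x y)"

definition quadratic_form_on ::
    "(real^3) set \<Rightarrow> (real \<Rightarrow> real \<Rightarrow> real) \<Rightarrow> real \<Rightarrow> real \<Rightarrow> bool"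
  where "quadratic_form_on M f a x0 \<longleftrightarrow>
    x0 \<notin> x_image M \<and>
    (\<exists>\<beta> \<gamma>. smooth_on (x_image M) \<beta> \<and> smooth_on (x_image M) \<gamma> \<and>
       (\<forall>(x, y)\<in>xy_image M. f x y = a * (x - x0) powi (-2) * y\<^sup>2 + \<beta> x * y + \<gamma> x))"

text \<open>If the slices of \<open>xy_image M\<close> in the \<open>y\<close>-direction are disconnected, the condition
  \<open>f\<^bsub>yy\<^esub> = \<alpha>(x)\<close> only determines \<open>f - \<alpha>(x) y\<^sup>2/2\<close> to be affine in \<open>y\<close> on each component of a slice,
  with coefficients that may differ between components.  Hence on a general domain the functions
  \<open>\<beta>\<close> and \<open>\<gamma>\<close> exist only locally, while \<open>a\<close> and \<open>x0\<close> are global.\<close>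

definition locally_quadratic_form_on ::
    "(real^3) set \<Rightarrow> (real \<Rightarrow> real \<Rightarrow> real) \<Rightarrow> real \<Rightarrow> real \<Rightarrow> bool"
  where "locally_quadratic_form_on M f a x0 \<longleftrightarrow>
    (\<forall>P\<in>M. \<exists>U. open U \<and> P \<in> U \<and> U \<subseteq> M \<and> quadratic_form_on U f a x0)"

definition connected_y_slices :: "(real^3) set \<Rightarrow> bool"
  where "connected_y_slices M \<longleftrightarrow> (\<forall>x. connected {y. (x, y) \<in> xy_image M})"

definition upper_half :: "(real^3) set"
  where "upper_half = {p. p $ 2 > 0}"

end

theory Submission
  imports Defs
begin

text \<open>With \<open>u = f\<^sub>y\<^sub>y\<close> and the parallel form \<open>\<omega> = dx \<and> dy\<close>, the curvature is \<open>R = u \<cdot> \<omega> \<otimes> \<omega>\<close>, so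
  \<open>\<nabla>R = du \<otimes> \<omega> \<otimes> \<omega>\<close> and \<open>\<nabla>\<^sup>2R = Hess u \<otimes> \<omega> \<otimes> \<omega>\<close>, where \<open>Hess u (\<partial>\<^sub>x, \<partial>\<^sub>x) = u\<^sub>x\<^sub>x - f\<^sub>y u\<^sub>y\<close>.  A curvature
  homothety is triangular, with a scale \<open>a\<close>, a sign and a shear \<open>s\<close>, hence curvature homogeneity amounts
  to a few polynomial equations in the derivatives of \<open>u\<close>.  To first order the shear can be used up
  when \<open>u\<^sub>y \<noteq> 0\<close>; when \<open>u = \<alpha>(x)\<close> what remains is that \<open>\<alpha>'\<^sup>2 / \<alpha>\<^sup>3\<close> is constant.  To second order, the constancy of
  \<open>u u\<^sub>y\<^sub>y / u\<^sub>y\<^sup>2\<close>, of \<open>(\<partial>\<^sub>y (u\<^sub>x / u\<^sub>y))\<^sup>2 / u\<close> and of one invariant involving \<open>f\<^sub>y\<close> forces \<open>u\<close> to be an exponential or a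
  power of \<open>y + h(x)\<close> and \<open>f\<^sub>y - h''\<close> to be its \<open>y\<close>-antiderivative.  Shearing maps over
  \<open>(x, y) \<mapsto> (\<lambda>x + x\<^sub>1, \<plusminus>y + h(x))\<close> change \<open>f\<close> by \<open>h'' y\<close> and functions of \<open>x\<close>, which gives the local isometries.
  Conversely, an isometry of a half-space model is shown to preserve \<open>y\<close> by differentiating the
  isometry equations.\<close>


section \<open>Smooth maps\<close>

text \<open>To first order three equations face the unknowns a, d and s: the ratio of u at the two
  points fixes a^2 / d^2, that of u_y then fixes d, and u_x fixes s. Solvability requires u to keep
  one sign, which connectedness supplies. To second order the three invariants are values of Hess u
  on \<partial>y and on the tangent to the level curves of u. Cross-differentiating v = u / u_y and
  w = u_x / u_y shows that the second invariant must be zero, so that w depends on x only and can be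
  integrated to h, and that the third has the value -1 / (2 - k), where k = u u_yy / u_y^2. This
  excludes k = 2, that is u = C / (y + h), the case in which f would look like y ln y. The obstacle
  is that M is an arbitrary connected open set: its shadow in the (x, y) plane need not be a product
  and its slices need not be connected, so integration in x and y happens in boxes. What must be
  global (the sign of u, the number k, the constants a and x0) is taken from connectedness or from
  pointwise identities; factors that depend on the box are absorbed by the x-scale
  \<lambda>.\<close>

lemma C_diff_on_cong:
  assumes "open S" "\<And>p. p \<in> S \<Longrightarrow> F p = G p" "C_diff_on k S F"
  shows "C_diff_on k S G"
  using assms(2,3)
proof (induction k arbitrary: F G)
  case 0
  then show ?case by (simp cong: continuous_on_cong)
next
  case (Suc k)
  have d: "(G has_derivative frechet_derivative F (at p)) (at p)" if "p \<in> S" for p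
    by (rule has_derivative_transform_within_open[of F _ p UNIV S])
       (use Suc.prems that assms(1) in \<open>auto simp: frechet_derivative_works\<close>)
  then have e: "frechet_derivative F (at p) = frechet_derivative G (at p)" if "p \<in> S" for p
    using that frechet_derivative_at by blast
  have "C_diff_on k S (\<lambda>p. frechet_derivative G (at p) v)" for v
    by (rule Suc.IH[of "\<lambda>p. frechet_derivative F (at p) v"]) (use Suc.prems(2) e in auto)
  then show ?case using d by (auto intro: differentiableI)
qed

lemma C_diff_on_subset: "C_diff_on k S F \<Longrightarrow> T \<subseteq> S \<Longrightarrow> C_diff_on k T F"
  by (induction k arbitrary: F) (auto intro: continuous_on_subset)

lemma C_diff_on_SucD: "C_diff_on (Suc k) S F \<Longrightarrow> C_diff_on k S F"
proof (induction k arbitrary: F)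
  case 0
  then show ?case
    by (simp add: continuous_on_eq_continuous_within differentiable_imp_continuous_within
        continuous_at_imp_continuous_at_within)
qed auto

lemma C_diff_on_SucI:
  assumes "open S" "\<And>p. p \<in> S \<Longrightarrow> (F has_derivative F' p) (at p)"
    "\<And>v. C_diff_on k S (\<lambda>p. F' p v)"
  shows "C_diff_on (Suc k) S F"
proof -
  have "F' p = frechet_derivative F (at p)" if "p \<in> S" for p
    using assms(2)[OF that] frechet_derivative_at by blast
  then have "C_diff_on k S (\<lambda>p. frechet_derivative F (at p) v)" for v
    by (intro C_diff_on_cong[OF assms(1) _ assms(3)[of v]]) simp
  then show ?thesis using assms(2) by (auto intro: differentiableI)
qed

lemma C_diff_on_has_derivative:
  "C_diff_on (Suc k) S F \<Longrightarrow> p \<in> S \<Longrightarrow> (F has_derivative frechet_derivative F (at p)) (at p)"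
  by (auto simp: frechet_derivative_works)

lemma C_diff_on_const: "C_diff_on k S (\<lambda>p. c)"
  by (induction k arbitrary: c) auto

lemma C_diff_on_bounded_linear:
  assumes "bounded_linear L" shows "C_diff_on k S L"
proof (cases k)
  case 0
  then show ?thesis using assms by (simp add: linear_continuous_on)
next
  case (Suc m)
  have "frechet_derivative L (at p) = L" for p
    using assms bounded_linear_imp_has_derivative frechet_derivative_at by metis
  then show ?thesis
    using Suc assms by (auto simp: C_diff_on_const bounded_linear_imp_differentiable)
qed

lemma C_diff_on_compose_bounded_linear:
  assumes "bounded_linear L" "open S" "C_diff_on k S F"
  shows "C_diff_on k S (\<lambda>p. L (F p))"
  using assms(3)
proof (induction k arbitrary: F)
  case 0
  then show ?case using assms(1)
    by (simp add: bounded_linear.continuous_on)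
next
  case (Suc k)
  show ?case
    using Suc.prems Suc.IH
    by (intro C_diff_on_SucI[OF assms(2) bounded_linear.has_derivative[OF assms(1)
            C_diff_on_has_derivative[OF Suc.prems]]]) auto
qed

lemma C_diff_on_add:
  assumes "open S" "C_diff_on k S F" "C_diff_on k S G"
  shows "C_diff_on k S (\<lambda>p. F p + G p)"
  using assms(2,3)
proof (induction k arbitrary: F G)
  case 0
  then show ?case by (simp add: continuous_on_add)
next
  case (Suc k)
  show ?case
    using Suc.prems Suc.IH
    by (intro C_diff_on_SucI[OF assms(1) has_derivative_add[OF
            C_diff_on_has_derivative[OF Suc.prems(1)] C_diff_on_has_derivative[OF Suc.prems(2)]]]) auto
qed

lemma C_diff_on_bilinear:
  assumes "bounded_bilinear B" "open S" "C_diff_on k S F" "C_diff_on k S G"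
  shows "C_diff_on k S (\<lambda>p. B (F p) (G p))"
  using assms(3,4)
proof (induction k arbitrary: F G)
  case 0
  then show ?case using assms(1) by (simp add: bounded_bilinear.continuous_on)
next
  case (Suc k)
  have "C_diff_on k S F" "C_diff_on k S G"
    using Suc.prems C_diff_on_SucD by blast+
  then have "C_diff_on k S (\<lambda>p. B (F p) (frechet_derivative G (at p) v)
      + B (frechet_derivative F (at p) v) (G p))" for v
    using Suc.prems Suc.IH by (intro C_diff_on_add assms(2)) auto
  then show ?case
    by (intro C_diff_on_SucI[OF assms(2), where F' = "\<lambda>p v. B (F p) (frechet_derivative G (at p) v)
      + B (frechet_derivative F (at p) v) (G p)"]
        bounded_bilinear.FDERIV[OF assms(1)] C_diff_on_has_derivative[OF Suc.prems(1)]
        C_diff_on_has_derivative[OF Suc.prems(2)])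
qed

lemma C_diff_on_sum:
  assumes "open S" "\<And>i. i \<in> I \<Longrightarrow> C_diff_on k S (F i)"
  shows "C_diff_on k S (\<lambda>p. \<Sum>i\<in>I. F i p)"
  using assms(2)
  by (induction I rule: infinite_finite_induct)
    (auto intro!: C_diff_on_add assms(1) simp: C_diff_on_const)

text \<open>Regularity is asked only of derivatives in fixed directions, whereas the chain rule
  differentiates F in the moving direction G'(p) v. Expanding this direction in \<open>Basis\<close>
  gives a finite sum of products to which the induction applies; hence the Euclidean middle
  space.\<close>

lemma C_diff_on_compose:
  fixes F :: "'b::euclidean_space \<Rightarrow> 'c::real_normed_vector"
  assumes "open S" "open V" "G ` S \<subseteq> V" "C_diff_on k V F" "C_diff_on k S G"
  shows "C_diff_on k S (\<lambda>p. F (G p))"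
  using assms(4,5)
proof (induction k arbitrary: F)
  case 0
  then show ?case
    using continuous_on_compose2[of V F S G] assms(3) by simp
next
  case (Suc k)
  have G: "C_diff_on k S G" using Suc.prems C_diff_on_SucD by blast
  define F' where "F' = (\<lambda>p v. \<Sum>b\<in>Basis. (frechet_derivative G (at p) v \<bullet> b) *\<^sub>R
      frechet_derivative F (at (G p)) b)"
  have "(F \<circ> G has_derivative F' p) (at p)" if "p \<in> S" for p
  proof -
    have dF: "(F has_derivative frechet_derivative F (at (G p))) (at (G p))"
      using Suc.prems(1) assms(3) that C_diff_on_has_derivative by blast
    have eq: "frechet_derivative F (at (G p)) w =
        (\<Sum>b\<in>Basis. (w \<bullet> b) *\<^sub>R frechet_derivative F (at (G p)) b)" for w
    proof -
      interpret linear "frechet_derivative F (at (G p))"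
        using dF has_derivative_linear by blast
      show ?thesis
        by (subst (1) euclidean_representation[of w, symmetric]) (simp add: sum scale)
    qed
    have "(F \<circ> G has_derivative frechet_derivative F (at (G p)) \<circ> frechet_derivative G (at p)) (at p)"
      using dF C_diff_on_has_derivative[OF Suc.prems(2) that] diff_chain_at by blast
    moreover have "frechet_derivative F (at (G p)) \<circ> frechet_derivative G (at p) = F' p"
      unfolding F'_def o_def using eq by (intro ext)
    ultimately show ?thesis by simp
  qed
  moreover have "C_diff_on k S (\<lambda>p. F' p v)" for v
    unfolding F'_def
    using Suc.prems Suc.IH[of "\<lambda>q. frechet_derivative F (at q) b" for b] G
    by (intro C_diff_on_sum C_diff_on_bilinear[OF bounded_bilinear_scaleR] assms(1)
        C_diff_on_compose_bounded_linear[OF bounded_linear_inner_left]) auto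
  ultimately show ?case
    by (intro C_diff_on_SucI[OF assms(1), where F' = F']) (auto simp: o_def)
qed

lemma smooth_on_cong:
  "open S \<Longrightarrow> (\<And>p. p \<in> S \<Longrightarrow> F p = G p) \<Longrightarrow> smooth_on S F \<Longrightarrow> smooth_on S G"
  unfolding smooth_on_def using C_diff_on_cong by metis

lemma smooth_on_subset: "smooth_on S F \<Longrightarrow> T \<subseteq> S \<Longrightarrow> smooth_on T F"
  unfolding smooth_on_def using C_diff_on_subset by blast

lemma smooth_on_has_derivative:
  "smooth_on S F \<Longrightarrow> p \<in> S \<Longrightarrow> (F has_derivative frechet_derivative F (at p)) (at p)"
  unfolding smooth_on_def using C_diff_on_has_derivative by blast

lemma smooth_on_frechet_derivative:
  "smooth_on S F \<Longrightarrow> smooth_on S (\<lambda>p. frechet_derivative F (at p) v)"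
  unfolding smooth_on_def by (metis C_diff_on.simps(2))

lemma smooth_on_continuous_on: "smooth_on S F \<Longrightarrow> continuous_on S F"
  unfolding smooth_on_def by (metis C_diff_on.simps(1))

lemma smooth_on_const: "smooth_on S (\<lambda>p. c)"
  by (simp add: smooth_on_def C_diff_on_const)

lemma smooth_on_bounded_linear: "bounded_linear L \<Longrightarrow> smooth_on S L"
  by (simp add: smooth_on_def C_diff_on_bounded_linear)

lemma smooth_on_compose_bounded_linear:
  "bounded_linear L \<Longrightarrow> open S \<Longrightarrow> smooth_on S F \<Longrightarrow> smooth_on S (\<lambda>p. L (F p))"
  by (simp add: smooth_on_def C_diff_on_compose_bounded_linear)

lemma smooth_on_add:
  "open S \<Longrightarrow> smooth_on S F \<Longrightarrow> smooth_on S G \<Longrightarrow> smooth_on S (\<lambda>p. F p + G p)"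
  by (simp add: smooth_on_def C_diff_on_add)

lemma smooth_on_mult:
  fixes F G :: "_ \<Rightarrow> 'b::real_normed_algebra"
  shows "open S \<Longrightarrow> smooth_on S F \<Longrightarrow> smooth_on S G \<Longrightarrow> smooth_on S (\<lambda>p. F p * G p)"
  by (simp add: smooth_on_def C_diff_on_bilinear bounded_bilinear_mult)

lemma smooth_on_scaleR:
  "open S \<Longrightarrow> smooth_on S F \<Longrightarrow> smooth_on S G \<Longrightarrow> smooth_on S (\<lambda>p. F p *\<^sub>R G p)"
  by (simp add: smooth_on_def C_diff_on_bilinear bounded_bilinear_scaleR)

lemma smooth_on_sum:
  "open S \<Longrightarrow> (\<And>i. i \<in> I \<Longrightarrow> smooth_on S (F i)) \<Longrightarrow> smooth_on S (\<lambda>p. \<Sum>i\<in>I. F i p)"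
  by (simp add: smooth_on_def C_diff_on_sum)

lemma smooth_on_uminus: "open S \<Longrightarrow> smooth_on S F \<Longrightarrow> smooth_on S (\<lambda>p. - F p)"
  by (rule smooth_on_compose_bounded_linear[where L = uminus])
    (auto intro: bounded_linear_minus bounded_linear_ident)

lemma smooth_on_diff:
  "open S \<Longrightarrow> smooth_on S F \<Longrightarrow> smooth_on S G \<Longrightarrow> smooth_on S (\<lambda>p. F p - G p)"
  using smooth_on_add[of S F "\<lambda>p. - G p"] smooth_on_uminus[of S G] by simp

lemma smooth_on_power:
  fixes F :: "_ \<Rightarrow> 'b::real_normed_algebra_1"
  shows "open S \<Longrightarrow> smooth_on S F \<Longrightarrow> smooth_on S (\<lambda>p. F p ^ n)"
  by (induction n) (auto intro: smooth_on_const smooth_on_mult)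

lemma smooth_on_compose:
  fixes F :: "'b::euclidean_space \<Rightarrow> 'c::real_normed_vector"
  shows "open S \<Longrightarrow> open V \<Longrightarrow> smooth_on V F \<Longrightarrow> smooth_on S G \<Longrightarrow> (\<And>p. p \<in> S \<Longrightarrow> G p \<in> V) \<Longrightarrow>
    smooth_on S (\<lambda>p. F (G p))"
  unfolding smooth_on_def using C_diff_on_compose[of S V G _ F] by blast

lemma smooth_on_vec:
  fixes F :: "'a::real_normed_vector \<Rightarrow> real^'n::finite"
  assumes "open S" "\<And>i. smooth_on S (\<lambda>p. F p $ i)"
  shows "smooth_on S F"
proof (rule smooth_on_cong[OF assms(1)])
  show "smooth_on S (\<lambda>p. \<Sum>i\<in>UNIV. F p $ i *\<^sub>R axis i 1)"
    using assms by (intro smooth_on_sum smooth_on_scaleR smooth_on_const)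
  show "(\<Sum>i\<in>UNIV. F p $ i *\<^sub>R axis i 1) = F p" for p
    using basis_expansion[of "F p"] by (simp add: scalar_mult_eq_scaleR)
qed

lemma smooth_on_vec_nth:
  "open S \<Longrightarrow> smooth_on S F \<Longrightarrow> smooth_on S (\<lambda>p. F p $ i)"
  by (rule smooth_on_compose_bounded_linear[OF bounded_linear_vec_nth])

lemma smooth_on_Pair:
  assumes "open S" "smooth_on S F" "smooth_on S G"
  shows "smooth_on S (\<lambda>p. (F p, G p))"
proof (rule smooth_on_cong[OF assms(1)])
  show "smooth_on S (\<lambda>p. (F p, 0) + (0, G p))"
    using assms
    by (intro smooth_on_add smooth_on_compose_bounded_linear[where L = "\<lambda>a. (a, 0)"]
        smooth_on_compose_bounded_linear[where L = "\<lambda>b. (0, b)"])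
      (auto intro!: bounded_linear_Pair bounded_linear_ident bounded_linear_zero)
qed auto

section \<open>Smooth functions of one real variable\<close>

lemma C_diff_on_Suc_real:
  fixes F :: "real \<Rightarrow> 'b::real_normed_vector"
  assumes "open S" "\<And>x. x \<in> S \<Longrightarrow> (F has_vector_derivative F' x) (at x)" "C_diff_on k S F'"
  shows "C_diff_on (Suc k) S F"
  by (rule C_diff_on_SucI[OF assms(1), where F' = "\<lambda>x v. v *\<^sub>R F' x"])
    (use assms in \<open>auto simp: has_vector_derivative_def
        intro!: C_diff_on_compose_bounded_linear[OF bounded_linear_scaleR_right]\<close>)

lemma smooth_onI_real:
  fixes F :: "real \<Rightarrow> 'b::real_normed_vector"
  assumes "open S" "\<And>x. x \<in> S \<Longrightarrow> (F has_vector_derivative F' x) (at x)" "smooth_on S F'"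
  shows "smooth_on S F"
  using C_diff_on_Suc_real[of S F F'] C_diff_on_SucD assms unfolding smooth_on_def by blast

lemma smooth_on_exp: "smooth_on S (exp :: real \<Rightarrow> real)"
proof -
  have "C_diff_on k UNIV (exp :: real \<Rightarrow> real)" for k
  proof (induction k)
    case (Suc k)
    then show ?case
      by (intro C_diff_on_Suc_real[where F' = exp])
        (auto simp: has_real_derivative_iff_has_vector_derivative[symmetric]
          intro!: derivative_eq_intros)
  qed (auto intro: continuous_intros)
  then show ?thesis using smooth_on_subset[of UNIV exp S] by (simp add: smooth_on_def)
qed

lemma smooth_on_inverse_real: "smooth_on (- {0}) (inverse :: real \<Rightarrow> real)"
  unfolding smooth_on_def
proof
  fix k show "C_diff_on k (- {0}) (inverse :: real \<Rightarrow> real)"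
  proof (induction k)
    case 0
    show ?case by (auto intro!: continuous_intros)
  next
    case (Suc k)
    have "C_diff_on k (- {0}) (\<lambda>x::real. - (inverse x * inverse x))"
      using Suc by (intro C_diff_on_compose_bounded_linear[where L = uminus]
          C_diff_on_bilinear[OF bounded_bilinear_mult]) (auto intro: bounded_linear_minus bounded_linear_ident)
    then show ?case
      by (intro C_diff_on_Suc_real[where F' = "\<lambda>x. - (inverse x * inverse x)"])
        (auto simp: has_real_derivative_iff_has_vector_derivative[symmetric]
          intro!: derivative_eq_intros)
  qed
qed

lemma smooth_on_ln: "smooth_on {0<..} (ln :: real \<Rightarrow> real)"
  by (rule smooth_onI_real[where F' = inverse])
    (auto simp: has_real_derivative_iff_has_vector_derivative[symmetric] divide_inverse
      intro!: derivative_eq_intros smooth_on_subset[OF smooth_on_inverse_real])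

lemma smooth_on_powr: "smooth_on {0<..} (\<lambda>x::real. x powr a)"
  unfolding smooth_on_def
proof
  fix k show "C_diff_on k {0<..} (\<lambda>x::real. x powr a)"
  proof (induction k arbitrary: a)
    case 0
    show ?case by (auto intro!: continuous_intros)
  next
    case (Suc k)
    have "C_diff_on k {0<..} (\<lambda>x::real. a * x powr (a - 1))"
      using Suc[of "a - 1"]
      by (intro C_diff_on_compose_bounded_linear[OF bounded_linear_mult_right]) auto
    then show ?case
      by (intro C_diff_on_Suc_real[where F' = "\<lambda>x. a * x powr (a - 1)"])
        (auto simp: has_real_derivative_iff_has_vector_derivative[symmetric]
          intro!: derivative_eq_intros)
  qed
qed

lemma smooth_on_inverse:
  fixes F :: "_ \<Rightarrow> real"
  assumes "open S" "smooth_on S F" "\<And>p. p \<in> S \<Longrightarrow> F p \<noteq> 0"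
  shows "smooth_on S (\<lambda>p. inverse (F p))"
  using assms by (intro smooth_on_compose[OF _ _ smooth_on_inverse_real]) auto

lemma smooth_on_divide:
  fixes F G :: "_ \<Rightarrow> real"
  assumes "open S" "smooth_on S F" "smooth_on S G" "\<And>p. p \<in> S \<Longrightarrow> G p \<noteq> 0"
  shows "smooth_on S (\<lambda>p. F p / G p)"
  unfolding divide_inverse using assms by (intro smooth_on_mult smooth_on_inverse)

lemma smooth_on_real_deriv:
  fixes F :: "real \<Rightarrow> real"
  assumes "open S" "smooth_on S F"
  shows "smooth_on S (deriv F)" and "x \<in> S \<Longrightarrow> (F has_real_derivative deriv F x) (at x)"
proof -
  have *: "(F has_real_derivative frechet_derivative F (at x) 1) (at x)" if "x \<in> S" for x
  proof -
    have "(F has_derivative frechet_derivative F (at x)) (at x)"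
      using assms that smooth_on_has_derivative by blast
    moreover have "frechet_derivative F (at x) h = frechet_derivative F (at x) 1 * h" for h
      using linear_scale[OF has_derivative_linear[OF calculation], of h 1] by simp
    then have "frechet_derivative F (at x) = (*) (frechet_derivative F (at x) 1)" by (rule ext)
    ultimately show ?thesis by (simp add: has_field_derivative_def)
  qed
  then show "x \<in> S \<Longrightarrow> (F has_real_derivative deriv F x) (at x)"
    using DERIV_imp_deriv by metis
  show "smooth_on S (deriv F)"
    by (rule smooth_on_cong[OF assms(1) _ smooth_on_frechet_derivative[OF assms(2), of 1]])
      (metis * DERIV_imp_deriv)
qed

text \<open>Bootstrapping: the equation expresses h'' through h, so C^k regularity of h and h'
  improves to C^(k+1) for both. Variation of constants below yields its solution with two
  derivatives only; this lemma makes it smooth.\<close>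

lemma smooth_on_linear_ode2:
  fixes h :: "real \<Rightarrow> real"
  assumes "open S" "smooth_on S q" "smooth_on S r"
    "\<And>x. x \<in> S \<Longrightarrow> (h has_real_derivative h' x) (at x)"
    "\<And>x. x \<in> S \<Longrightarrow> (h' has_real_derivative q x * h x + r x) (at x)"
  shows "smooth_on S h"
proof -
  have "C_diff_on k S h \<and> C_diff_on k S h'" for k
  proof (induction k)
    case 0
    have "isCont h x" "isCont h' x" if "x \<in> S" for x
      using DERIV_isCont[OF assms(4)[OF that]] DERIV_isCont[OF assms(5)[OF that]] .
    then show ?case by (simp add: continuous_at_imp_continuous_on)
  next
    case (Suc k)
    have "C_diff_on k S (\<lambda>x. q x * h x + r x)"
      using Suc assms(1-3) by (intro C_diff_on_add C_diff_on_bilinear[OF bounded_bilinear_mult])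
        (auto simp: smooth_on_def)
    then have "C_diff_on (Suc k) S h'"
      using assms(1,5) C_diff_on_Suc_real[of S h' "\<lambda>x. q x * h x + r x" k]
      unfolding has_real_derivative_iff_has_vector_derivative by blast
    moreover have "C_diff_on (Suc k) S h"
      using assms(1,4) Suc C_diff_on_Suc_real[of S h h' k]
      unfolding has_real_derivative_iff_has_vector_derivative by blast
    ultimately show ?case by blast
  qed
  then show ?thesis by (simp add: smooth_on_def)
qed

lemma continuous_antiderivative:
  fixes k :: "real \<Rightarrow> 'a::banach"
  assumes "open S" "is_interval S" "continuous_on S k" "x0 \<in> S"
  obtains K where "K x0 = c" "\<And>x. x \<in> S \<Longrightarrow> (K has_vector_derivative k x) (at x)"
proof -
  define K where "K x = c + (if x0 \<le> x then integral {x0..x} k else - integral {x..x0} k)" for x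
  have "(K has_vector_derivative k x) (at x)" if x: "x \<in> S" for x
  proof -
    obtain e where e: "e > 0" "cball x e \<subseteq> S" using assms(1) x open_contains_cball by blast
    \<comment> \<open>The interval from a to b contains x0 and a neighbourhood of x, and lies in S
      because S is an interval; on it K is the integral from a plus a constant.\<close>
    define a where "a = min (x - e) x0"
    define b where "b = max (x + e) x0"
    have xe: "x - e \<in> S" "x + e \<in> S" using e by (auto simp: subset_eq dist_real_def)
    have sub: "{a..b} \<subseteq> S"
    proof
      fix t assume t: "t \<in> {a..b}"
      have "a \<in> S" "b \<in> S" using xe assms(4) by (auto simp: a_def b_def min_def max_def)
      then show "t \<in> S" using mem_is_interval_1_I[OF assms(2), of a b t] t by simp
    qed
    have ax: "x \<in> {a<..<b}" using e(1) by (auto simp: a_def b_def)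
    have cont: "continuous_on {a..b} k" using assms(3) sub continuous_on_subset by blast
    have "((\<lambda>t. integral {a..t} k) has_vector_derivative k x) (at x within {a..b})"
      using integral_has_vector_derivative[OF cont, of x] ax by auto
    then have d: "((\<lambda>t. integral {a..t} k) has_vector_derivative k x) (at x)"
      using ax at_within_interior[of x "{a..b}"] by (simp add: interior_atLeastAtMost_real)
    have eq: "K t = (c - integral {a..x0} k) + integral {a..t} k" if "t \<in> {a<..<b}" for t
    proof -
      have x0: "x0 \<in> {a..b}" using e(1) by (auto simp: a_def b_def)
      have int: "k integrable_on {a..s}" if "s \<le> b" for s
        using that by (intro integrable_continuous_real continuous_on_subset[OF cont]) auto
      show ?thesis
      proof (cases "x0 \<le> t")
        case True
        then have "integral {a..x0} k + integral {x0..t} k = integral {a..t} k"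
          using x0 int[of t] that by (intro Henstock_Kurzweil_Integration.integral_combine) auto
        then show ?thesis using True by (simp add: K_def algebra_simps)
      next
        case False
        then have "integral {a..t} k + integral {t..x0} k = integral {a..x0} k"
          using x0 int[of x0] that by (intro Henstock_Kurzweil_Integration.integral_combine) auto
        then show ?thesis using False by (simp add: K_def algebra_simps)
      qed
    qed
    have "((\<lambda>t. (c - integral {a..x0} k) + integral {a..t} k) has_vector_derivative k x) (at x)"
      using d by (auto intro!: derivative_eq_intros)
    then show ?thesis
      by (rule has_vector_derivative_transform_within_open[of _ _ _ "{a<..<b}"])
        (use ax eq in auto)
  qed
  moreover have "K x0 = c" by (simp add: K_def)
  ultimately show ?thesis using that by blast
qed

lemma smooth_antiderivative:
  fixes k :: "real \<Rightarrow> real"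
  assumes "open S" "is_interval S" "smooth_on S k" "x0 \<in> S"
  obtains K where "smooth_on S K" "K x0 = c" "\<And>x. x \<in> S \<Longrightarrow> (K has_real_derivative k x) (at x)"
proof -
  obtain K where K: "K x0 = c" "\<And>x. x \<in> S \<Longrightarrow> (K has_vector_derivative k x) (at x)"
    using continuous_antiderivative[OF assms(1,2) smooth_on_continuous_on[OF assms(3)] assms(4)] by blast
  with smooth_onI_real[OF assms(1) K(2) assms(3)] show ?thesis
    by (intro that[of K]) (auto simp: has_real_derivative_iff_has_vector_derivative)
qed

lemma same_sign_on_connected:
  fixes G :: "'a::topological_space \<Rightarrow> real"
  assumes "connected S" "continuous_on S G" "\<And>q. q \<in> S \<Longrightarrow> G q \<noteq> 0" "p \<in> S" "q \<in> S"
  shows "G p / G q > 0"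
proof -
  have "is_interval (G ` S)"
    using connected_continuous_image[OF assms(2,1)] by (simp add: is_interval_connected_1)
  moreover have "0 \<notin> G ` S" using assms(3) by force
  moreover have "G p \<in> G ` S" "G q \<in> G ` S" using assms(4,5) by blast+
  ultimately have "\<not> (G p < 0 \<and> 0 < G q)" "\<not> (G q < 0 \<and> 0 < G p)"
    using mem_is_interval_1_I[of "G ` S" "G p" "G q" 0] mem_is_interval_1_I[of "G ` S" "G q" "G p" 0]
    by (auto simp: less_imp_le)
  then show ?thesis using assms(3)[OF assms(4)] assms(3)[OF assms(5)]
    by (auto simp: zero_less_divide_iff not_less linorder_neq_iff)
qed

lemma interval_constant:
  fixes k :: "real \<Rightarrow> real"
  assumes "is_interval J" "\<And>y. y \<in> J \<Longrightarrow> (k has_real_derivative 0) (at y)" "y \<in> J" "z \<in> J"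
  shows "k y = k z"
proof -
  have "\<exists>c. \<forall>y\<in>J. k y = c"
    by (rule has_field_derivative_zero_constant[OF is_interval_convex[OF assms(1)]])
      (use assms(2) has_field_derivative_at_within in blast)
  then show ?thesis using assms(3,4) by metis
qed


section \<open>Mixed partial derivatives\<close>

lemma has_real_derivative_along_line:
  fixes F :: "'a::real_normed_vector \<Rightarrow> real"
  assumes "smooth_on S F" "p + s *\<^sub>R v \<in> S"
  shows "((\<lambda>s. F (p + s *\<^sub>R v)) has_real_derivative frechet_derivative F (at (p + s *\<^sub>R v)) v) (at s)"
proof -
  let ?D = "frechet_derivative F (at (p + s *\<^sub>R v))"
  have D: "(F has_derivative ?D) (at (p + s *\<^sub>R v))"
    by (rule smooth_on_has_derivative[OF assms])
  have "((\<lambda>s. p + s *\<^sub>R v) has_derivative (\<lambda>h. h *\<^sub>R v)) (at s)"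
    by (auto intro!: derivative_eq_intros)
  from has_derivative_compose[OF this D]
  have "((\<lambda>s. F (p + s *\<^sub>R v)) has_derivative (\<lambda>h. ?D (h *\<^sub>R v))) (at s)" .
  moreover have "?D (h *\<^sub>R v) = ?D v * h" for h
    using linear_scale[OF has_derivative_linear[OF D], of h v] by simp
  ultimately show ?thesis by (simp add: has_field_derivative_def)
qed

text \<open>The second difference quotient is symmetric in the two directions, and the mean value theorem
  expresses it through either of the two mixed derivatives.\<close>

lemma second_difference_mean_value:
  fixes F :: "'a::real_normed_vector \<Rightarrow> real"
  assumes "smooth_on S F" "t > 0"
    "\<And>a b. 0 \<le> a \<Longrightarrow> a \<le> t \<Longrightarrow> 0 \<le> b \<Longrightarrow> b \<le> t \<Longrightarrow> p + a *\<^sub>R v + b *\<^sub>R w \<in> S"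
  obtains a b where "0 < a" "a < t" "0 < b" "b < t"
    "F (p + t *\<^sub>R v + t *\<^sub>R w) - F (p + t *\<^sub>R v) - F (p + t *\<^sub>R w) + F p =
      t\<^sup>2 * frechet_derivative (\<lambda>q. frechet_derivative F (at q) v) (at (p + a *\<^sub>R v + b *\<^sub>R w)) w"
proof -
  let ?D = "\<lambda>q. frechet_derivative F (at q) v"
  have S: "p + t *\<^sub>R w + a *\<^sub>R v \<in> S" "p + a *\<^sub>R v \<in> S" if "0 \<le> a" "a \<le> t" for a
    using assms(3)[of a t] assms(3)[of a 0] that assms(2) by (simp_all add: algebra_simps)
  have "((\<lambda>a. F (p + t *\<^sub>R w + a *\<^sub>R v) - F (p + a *\<^sub>R v)) has_real_derivative
      ?D (p + t *\<^sub>R w + a *\<^sub>R v) - ?D (p + a *\<^sub>R v)) (at a)" if "0 \<le> a" "a \<le> t" for a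
    using has_real_derivative_along_line[OF assms(1) S(1)[OF that]]
      has_real_derivative_along_line[OF assms(1) S(2)[OF that]] by (rule DERIV_diff)
  from MVT2[OF assms(2) this] obtain a where a: "a > 0" "a < t" and ae:
    "F (p + t *\<^sub>R w + t *\<^sub>R v) - F (p + t *\<^sub>R v) - (F (p + t *\<^sub>R w + 0 *\<^sub>R v) - F (p + 0 *\<^sub>R v)) =
      (t - 0) * (?D (p + t *\<^sub>R w + a *\<^sub>R v) - ?D (p + a *\<^sub>R v))" by auto
  have "((\<lambda>b. ?D (p + a *\<^sub>R v + b *\<^sub>R w)) has_real_derivative
      frechet_derivative ?D (at (p + a *\<^sub>R v + b *\<^sub>R w)) w) (at b)" if "0 \<le> b" "b \<le> t" for b
    by (rule has_real_derivative_along_line[OF smooth_on_frechet_derivative[OF assms(1)]])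
      (use assms(3)[of a b] that a in simp)
  from MVT2[OF assms(2) this] obtain b where b: "b > 0" "b < t" and be:
    "?D (p + a *\<^sub>R v + t *\<^sub>R w) - ?D (p + a *\<^sub>R v + 0 *\<^sub>R w) =
      (t - 0) * frechet_derivative ?D (at (p + a *\<^sub>R v + b *\<^sub>R w)) w" by auto
  show ?thesis
    using ae be by (intro that[OF a b]) (simp add: algebra_simps power2_eq_square)
qed

text \<open>If the mixed derivatives differed at p, continuity would keep each of them within half
  the gap near p. But one and the same second difference is t^2 times either of them, so they agree
  at a pair of points close to p.\<close>

lemma frechet_derivative_symmetric:
  fixes F :: "'a::real_normed_vector \<Rightarrow> real"
  assumes "open S" "smooth_on S F" "p \<in> S"
  shows "frechet_derivative (\<lambda>q. frechet_derivative F (at q) v) (at p) w =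
    frechet_derivative (\<lambda>q. frechet_derivative F (at q) w) (at p) v"
proof (rule ccontr)
  define A where "A q = frechet_derivative (\<lambda>q. frechet_derivative F (at q) v) (at q) w" for q
  define B where "B q = frechet_derivative (\<lambda>q. frechet_derivative F (at q) w) (at q) v" for q
  assume "\<not> ?thesis"
  then have ne: "\<bar>A p - B p\<bar> > 0" by (simp add: A_def B_def)
  have "continuous_on S A" "continuous_on S B"
    unfolding A_def B_def
    by (intro smooth_on_continuous_on smooth_on_frechet_derivative assms)+
  then have "isCont A p" "isCont B p" using assms continuous_on_eq_continuous_at by blast+
  then obtain d1 d2 where d: "d1 > 0" "d2 > 0"
    "\<And>q. dist q p < d1 \<Longrightarrow> dist (A q) (A p) < \<bar>A p - B p\<bar> / 2"
    "\<And>q. dist q p < d2 \<Longrightarrow> dist (B q) (B p) < \<bar>A p - B p\<bar> / 2"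
    using ne unfolding continuous_at_eps_delta by (metis half_gt_zero)
  obtain d3 where d3: "d3 > 0" "ball p d3 \<subseteq> S" using assms open_contains_ball by blast
  define d where "d = min d3 (min d1 d2)"
  \<comment> \<open>Small enough for the parallelogram with sides t v and t w to stay within
    distance d of p; the summand 1 covers v = w = 0.\<close>
  define t where "t = d / (norm v + norm w + 1)"
  have dt: "d > 0" "t > 0"
    using d(1,2) d3(1) by (auto simp: d_def t_def intro!: divide_pos_pos add_nonneg_pos)
  have near: "dist (p + a *\<^sub>R v + b *\<^sub>R w) p < d" if "0 \<le> a" "a \<le> t" "0 \<le> b" "b \<le> t" for a b
  proof -
    have "norm (a *\<^sub>R v + b *\<^sub>R w) \<le> a * norm v + b * norm w"
      using norm_triangle_ineq[of "a *\<^sub>R v" "b *\<^sub>R w"] that by simp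
    also have "\<dots> \<le> t * norm v + t * norm w"
      using that by (intro add_mono mult_right_mono) auto
    also have "\<dots> < t * (norm v + norm w + 1)" using dt by (simp add: algebra_simps)
    also have "\<dots> = d"
      unfolding t_def using norm_ge_zero[of v] norm_ge_zero[of w]
      by (metis add_nonneg_nonneg add_nonneg_pos less_irrefl nonzero_mult_div_cancel_right times_divide_eq_left zero_less_one)
    finally show ?thesis by (simp add: dist_norm algebra_simps)
  qed
  then have inS: "p + a *\<^sub>R v + b *\<^sub>R w \<in> S" if "0 \<le> a" "a \<le> t" "0 \<le> b" "b \<le> t" for a b
    using d3(2) that by (force simp: d_def dist_commute)
  have inS': "p + a *\<^sub>R w + b *\<^sub>R v \<in> S" if "0 \<le> a" "a \<le> t" "0 \<le> b" "b \<le> t" for a b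
    using inS[of b a] that by (simp add: algebra_simps)
  obtain a b where ab: "0 < a" "a < t" "0 < b" "b < t"
    "F (p + t *\<^sub>R v + t *\<^sub>R w) - F (p + t *\<^sub>R v) - F (p + t *\<^sub>R w) + F p = t\<^sup>2 * A (p + a *\<^sub>R v + b *\<^sub>R w)"
    unfolding A_def by (rule second_difference_mean_value[OF assms(2) dt(2) inS])
  obtain a' b' where ab': "0 < a'" "a' < t" "0 < b'" "b' < t"
    "F (p + t *\<^sub>R w + t *\<^sub>R v) - F (p + t *\<^sub>R w) - F (p + t *\<^sub>R v) + F p = t\<^sup>2 * B (p + a' *\<^sub>R w + b' *\<^sub>R v)"
    unfolding B_def by (rule second_difference_mean_value[OF assms(2) dt(2) inS'])
  have "t\<^sup>2 * A (p + a *\<^sub>R v + b *\<^sub>R w) = t\<^sup>2 * B (p + a' *\<^sub>R w + b' *\<^sub>R v)"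
    using ab(5) ab'(5) by (simp add: algebra_simps)
  then have "A (p + a *\<^sub>R v + b *\<^sub>R w) = B (p + b' *\<^sub>R v + a' *\<^sub>R w)"
    using dt by (simp add: algebra_simps)
  then have "dist (A p) (B p) \<le> dist (A (p + a *\<^sub>R v + b *\<^sub>R w)) (A p) + dist (B (p + b' *\<^sub>R v + a' *\<^sub>R w)) (B p)"
    by (metis dist_triangle dist_commute)
  moreover have "dist (A (p + a *\<^sub>R v + b *\<^sub>R w)) (A p) < \<bar>A p - B p\<bar> / 2"
    using near[of a b] ab by (intro d(3)) (auto simp: d_def)
  moreover have "dist (B (p + b' *\<^sub>R v + a' *\<^sub>R w)) (B p) < \<bar>A p - B p\<bar> / 2"
    using near[of b' a'] ab' by (intro d(4)) (auto simp: d_def)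
  ultimately have "dist (A p) (B p) < \<bar>A p - B p\<bar> / 2 + \<bar>A p - B p\<bar> / 2" by linarith
  then show False by (simp add: dist_real_def)
qed

section \<open>Partial derivatives of functions on the (x, y) plane\<close>

definition dx :: "(real \<times> real \<Rightarrow> real) \<Rightarrow> real \<times> real \<Rightarrow> real"
  where "dx G q = frechet_derivative G (at q) (1, 0)"

definition dy :: "(real \<times> real \<Rightarrow> real) \<Rightarrow> real \<times> real \<Rightarrow> real"
  where "dy G q = frechet_derivative G (at q) (0, 1)"

lemma smooth_on_dx: "smooth_on S G \<Longrightarrow> smooth_on S (dx G)"
  unfolding dx_def by (rule smooth_on_frechet_derivative)

lemma smooth_on_dy: "smooth_on S G \<Longrightarrow> smooth_on S (dy G)"
  unfolding dy_def by (rule smooth_on_frechet_derivative)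

lemma dx_dy_commute: "open S \<Longrightarrow> smooth_on S G \<Longrightarrow> q \<in> S \<Longrightarrow> dx (dy G) q = dy (dx G) q"
  unfolding dx_def dy_def by (rule frechet_derivative_symmetric)

lemma has_derivative_dx_dy:
  assumes "smooth_on S G" "q \<in> S"
  shows "(G has_derivative (\<lambda>v. fst v * dx G q + snd v * dy G q)) (at q)"
proof -
  let ?D = "frechet_derivative G (at q)"
  have D: "(G has_derivative ?D) (at q)" by (rule smooth_on_has_derivative[OF assms])
  have "?D v = fst v * dx G q + snd v * dy G q" for v
  proof -
    interpret linear ?D using D by (rule has_derivative_linear)
    have "v = fst v *\<^sub>R (1, 0) + snd v *\<^sub>R (0, 1)" by (simp add: prod_eq_iff)
    then have "?D v = ?D (fst v *\<^sub>R (1, 0) + snd v *\<^sub>R (0, 1))" by simp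
    also have "\<dots> = fst v * ?D (1, 0) + snd v * ?D (0, 1)" unfolding add scale by simp
    finally show ?thesis by (simp add: dx_def dy_def)
  qed
  then have "?D = (\<lambda>v. fst v * dx G q + snd v * dy G q)" by (rule ext)
  with D show ?thesis by simp
qed

lemma has_derivative_compose_plane:
  assumes "smooth_on S G" "(X p, Y p) \<in> S"
    "(X has_derivative X') (at p)" "(Y has_derivative Y') (at p)"
  shows "((\<lambda>p. G (X p, Y p)) has_derivative
    (\<lambda>v. X' v * dx G (X p, Y p) + Y' v * dy G (X p, Y p))) (at p)"
  using has_derivative_compose[OF has_derivative_Pair[OF assms(3,4)] has_derivative_dx_dy[OF assms(1,2)]]
  by simp

lemma has_real_derivative_compose_plane:
  assumes "smooth_on S G" "(X t, Y t) \<in> S"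
    "(X has_real_derivative X') (at t)" "(Y has_real_derivative Y') (at t)"
  shows "((\<lambda>t. G (X t, Y t)) has_real_derivative
    X' * dx G (X t, Y t) + Y' * dy G (X t, Y t)) (at t)"
  unfolding has_field_derivative_def
  by (rule has_derivative_eq_rhs[OF has_derivative_compose_plane[OF assms(1,2)
          assms(3,4)[unfolded has_field_derivative_def]]]) (auto simp: algebra_simps)

lemma has_real_derivative_dx:
  "smooth_on S G \<Longrightarrow> (x, y) \<in> S \<Longrightarrow> ((\<lambda>x. G (x, y)) has_real_derivative dx G (x, y)) (at x)"
  using has_real_derivative_compose_plane[of S G "\<lambda>x. x" x "\<lambda>_. y" 1 0] by simp

lemma has_real_derivative_dy:
  "smooth_on S G \<Longrightarrow> (x, y) \<in> S \<Longrightarrow> ((\<lambda>y. G (x, y)) has_real_derivative dy G (x, y)) (at y)"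
  using has_real_derivative_compose_plane[of S G "\<lambda>_. x" y "\<lambda>y. y" 0 1] by simp

lemma dx_cong: "open S \<Longrightarrow> smooth_on S G \<Longrightarrow> (\<And>q. q \<in> S \<Longrightarrow> G q = H q) \<Longrightarrow> q \<in> S \<Longrightarrow> dx G q = dx H q"
  unfolding dx_def
  using frechet_derivative_transform_within_open[of G q S H] smooth_on_has_derivative[of S G q]
  by (metis differentiableI)

lemma dy_cong: "open S \<Longrightarrow> smooth_on S G \<Longrightarrow> (\<And>q. q \<in> S \<Longrightarrow> G q = H q) \<Longrightarrow> q \<in> S \<Longrightarrow> dy G q = dy H q"
  unfolding dy_def
  using frechet_derivative_transform_within_open[of G q S H] smooth_on_has_derivative[of S G q]
  by (metis differentiableI)

lemma smooth_on_dy_funpow: "smooth_on S G \<Longrightarrow> smooth_on S ((dy ^^ k) G)"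
  by (induction k) (auto intro: smooth_on_dy)

lemma open_slice:
  fixes S :: "('a::topological_space \<times> 'b::topological_space) set"
  shows "open S \<Longrightarrow> open {y. (x, y) \<in> S}"
  using open_vimage[of S "\<lambda>y. (x, y)"] by (simp add: vimage_def continuous_on_Pair)

text \<open>The bridge from the one-variable derivatives in the theorem to the operator
  \<open>dy\<close> used everywhere else. The induction step needs equality near y, which openness
  of the slice provides.\<close>

lemma deriv_funpow_eq_dy:
  assumes "open S" "smooth_on S (\<lambda>(x, y). f x y)" "(x, y) \<in> S"
  shows "(deriv ^^ k) (f x) y = (dy ^^ k) (\<lambda>(x, y). f x y) (x, y)"
  using assms(3)
proof (induction k arbitrary: y)
  case (Suc k)
  have "((\<lambda>y. (dy ^^ k) (\<lambda>(x, y). f x y) (x, y)) has_real_derivative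
      (dy ^^ Suc k) (\<lambda>(x, y). f x y) (x, y)) (at y)"
    using has_real_derivative_dy[OF smooth_on_dy_funpow[OF assms(2)] Suc.prems] by simp
  then have "((deriv ^^ k) (f x) has_real_derivative
      (dy ^^ Suc k) (\<lambda>(x, y). f x y) (x, y)) (at y)"
    by (rule has_field_derivative_transform_within_open[OF _ open_slice[OF assms(1)]])
      (use Suc in auto)
  then show ?case using DERIV_imp_deriv by simp
qed simp


section \<open>Curvature of Walker metrics\<close>

lemma open_xy_image: "open M \<Longrightarrow> open (xy_image M)"
  unfolding xy_image_def
proof (rule open_surjective_linear_image)
  show "linear (\<lambda>p::real^3. (p $ 1, p $ 2))" by (intro linearI) auto
  show "surj (\<lambda>p::real^3. (p $ 1, p $ 2))"
    by (rule surjI[where f = "\<lambda>q. vector [fst q, snd q, 0]"]) simp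
qed

lemma connected_xy_image: "connected M \<Longrightarrow> connected (xy_image M)"
  unfolding xy_image_def
  by (intro connected_continuous_image continuous_intros)

lemma open_x_image: "open M \<Longrightarrow> open (x_image M)"
  unfolding x_image_def
proof (rule open_surjective_linear_image)
  show "linear (\<lambda>p::real^3. p $ 1)" by (intro linearI) auto
  show "surj (\<lambda>p::real^3. p $ 1)"
    by (rule surjI[where f = "\<lambda>q. vector [q, 0, 0]"]) simp
qed

lemma connected_x_image: "connected M \<Longrightarrow> connected (x_image M)"
  unfolding x_image_def
  by (intro connected_continuous_image continuous_intros)

lemma xy_imageI: "p \<in> M \<Longrightarrow> (p $ 1, p $ 2) \<in> xy_image M"
  by (auto simp: xy_image_def)

lemma partial_deriv_cong:
  assumes "open M" "p \<in> M" "\<And>q. q \<in> M \<Longrightarrow> A q = B q"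
  shows "partial_deriv i A p = partial_deriv i B p"
proof -
  have "(A has_derivative D) (at p) \<longleftrightarrow> (B has_derivative D) (at p)" for D
    using has_derivative_transform_within_open[of A D p UNIV M B]
      has_derivative_transform_within_open[of B D p UNIV M A] assms by auto
  then show ?thesis by (simp add: partial_deriv_def frechet_derivative_def)
qed

lemma partial_deriv_const: "partial_deriv i (\<lambda>q. c) p = 0"
  by (simp add: partial_deriv_def)

lemma partial_deriv_xy:
  assumes "smooth_on S G" "(p $ 1, p $ 2) \<in> S"
  shows "partial_deriv i (\<lambda>q :: real^3. G (q $ 1, q $ 2)) p =
    (if i = 1 then dx G (p $ 1, p $ 2) else if i = 2 then dy G (p $ 1, p $ 2) else 0)"
proof -
  have "((\<lambda>q::real^3. G (q $ 1, q $ 2)) has_derivative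
      (\<lambda>v. v $ 1 * dx G (p $ 1, p $ 2) + v $ 2 * dy G (p $ 1, p $ 2))) (at p)"
    by (rule has_derivative_compose_plane[where X = "\<lambda>q. q $ 1" and Y = "\<lambda>q. q $ 2", OF assms])
      (auto intro!: bounded_linear_imp_has_derivative bounded_linear_vec_nth)
  from frechet_derivative_at[OF this, symmetric] show ?thesis
    using exhaust_3[of i] by (auto simp: partial_deriv_def axis_def)
qed

lemma dx_uminus: "smooth_on S G \<Longrightarrow> q \<in> S \<Longrightarrow> dx (\<lambda>q. - G q) q = - dx G q"
  unfolding dx_def
  using frechet_derivative_at[OF has_derivative_minus[OF smooth_on_has_derivative[of S G q]]] by metis

lemma dy_uminus: "smooth_on S G \<Longrightarrow> q \<in> S \<Longrightarrow> dy (\<lambda>q. - G q) q = - dy G q"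
  unfolding dy_def
  using frechet_derivative_at[OF has_derivative_minus[OF smooth_on_has_derivative[of S G q]]] by metis

lemma dx_mult_right: "smooth_on S G \<Longrightarrow> q \<in> S \<Longrightarrow> dx (\<lambda>q. G q * c) q = dx G q * c"
  unfolding dx_def
  using frechet_derivative_at[OF has_derivative_mult_left[OF smooth_on_has_derivative[of S G q], of c]] by metis

lemma dy_mult_right: "smooth_on S G \<Longrightarrow> q \<in> S \<Longrightarrow> dy (\<lambda>q. G q * c) q = dy G q * c"
  unfolding dy_def
  using frechet_derivative_at[OF has_derivative_mult_left[OF smooth_on_has_derivative[of S G q], of c]] by metis

lemma matrix_inv_walker_metric:
  "matrix_inv (walker_metric f p) = (\<chi> i j. if i = 3 \<and> j = 3 then 2 * f (p $ 1) (p $ 2)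
     else if (i = 1 \<and> j = 3) \<or> (i = 3 \<and> j = 1) \<or> (i = 2 \<and> j = 2) then 1 else 0)" (is "_ = ?B")
proof -
  let ?A = "walker_metric f p"
  have 1: "?A ** ?B = mat 1" "?B ** ?A = mat 1"
    by (simp_all add: vec_eq_iff forall_3 matrix_matrix_mult_def sum_3 walker_metric_def mat_def)
  have "?A ** matrix_inv ?A = mat 1"
    unfolding matrix_inv_def by (rule someI2[where a = ?B]) (use 1 in simp_all)
  then have "(?B ** ?A) ** matrix_inv ?A = ?B"
    by (simp only: matrix_mul_assoc[symmetric] matrix_mul_rid)
  then show ?thesis by (simp only: 1 matrix_mul_lid)
qed

definition area :: "3 \<Rightarrow> 3 \<Rightarrow> real"
  where "area i j = (if i = 1 \<and> j = 2 then 1 else if i = 2 \<and> j = 1 then -1 else 0)"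

lemma area_simps [simp]:
  "area 1 1 = 0" "area 1 2 = 1" "area 1 3 = 0" "area 2 1 = -1" "area 2 2 = 0" "area 2 3 = 0"
  "area 3 i = 0"
  by (simp_all add: area_def)

text \<open>Components of the tensor square of \<omega>, with the second pair reversed so that the
  curvature is +u times it in the convention R(X, Y, Z, W) = g(R(X, Y) Z, W).\<close>

fun area_tensor :: "3 list \<Rightarrow> real" where
  "area_tensor [i, j, k, l] = area i j * area l k"
| "area_tensor _ = 0"

definition area_form :: "real^3 \<Rightarrow> real^3 \<Rightarrow> real"
  where "area_form v w = v $ 1 * w $ 2 - v $ 2 * w $ 1"

locale walker =
  fixes M :: "(real^3) set" and f :: "real \<Rightarrow> real \<Rightarrow> real"
  assumes open_M: "open M" and smooth_f: "smooth_xy_on M f"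
begin

abbreviation F :: "real \<times> real \<Rightarrow> real" where "F \<equiv> \<lambda>(x, y). f x y"
abbreviation u :: "real \<times> real \<Rightarrow> real" where "u \<equiv> dy (dy F)"
abbreviation S :: "(real \<times> real) set" where "S \<equiv> xy_image M"

lemma open_S: "open S" using open_M by (rule open_xy_image)

lemma smooth_F: "smooth_on S F" using smooth_f by (simp add: smooth_xy_on_def)

lemma smooth_u: "smooth_on S u" by (intro smooth_on_dy smooth_F)

text \<open>Nothing depends on the third coordinate, so the symbols are kept as functions on the
  plane, ready for \<open>dx\<close> and \<open>dy\<close>.\<close>

definition christoffel_xy :: "3 \<Rightarrow> 3 \<Rightarrow> 3 \<Rightarrow> real \<times> real \<Rightarrow> real"
  where "christoffel_xy k i j =
    (if k = 2 \<and> i = 1 \<and> j = 1 then dy F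
     else if k = 3 \<and> i = 1 \<and> j = 1 then (\<lambda>q. - dx F q)
     else if k = 3 \<and> (i = 1 \<and> j = 2 \<or> i = 2 \<and> j = 1) then (\<lambda>q. - dy F q)
     else (\<lambda>q. 0))"

lemma smooth_christoffel_xy: "smooth_on S (christoffel_xy k i j)"
  unfolding christoffel_xy_def
  by (auto intro: smooth_on_uminus smooth_on_const smooth_on_dx smooth_on_dy smooth_F open_S)

lemma christoffel_eq:
  assumes "p \<in> M"
  shows "christoffel (walker_metric f) k i j p = christoffel_xy k i j (p $ 1, p $ 2)"
proof -
  have s: "smooth_on S (\<lambda>q. - 2 * F q)"
    by (intro smooth_on_mult smooth_on_const smooth_F open_S)
  have d: "partial_deriv m (\<lambda>q::real^3. - 2 * f (q $ 1) (q $ 2)) p =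
      (if m = 1 then -2 * dx F (p $ 1, p $ 2) else if m = 2 then -2 * dy F (p $ 1, p $ 2) else 0)" for m
  proof -
    have e: "frechet_derivative (\<lambda>q. - 2 * F q) (at q) v = -2 * frechet_derivative F (at q) v"
      if "q \<in> S" for q v
      using frechet_derivative_at[OF has_derivative_mult_right[OF smooth_on_has_derivative[OF smooth_F that],
          of "-2"]] by metis
    show ?thesis
      using partial_deriv_xy[OF s, of p m] xy_imageI[OF assms] e[of "(p $ 1, p $ 2)"]
      by (simp add: dx_def dy_def)
  qed
  have g: "partial_deriv m (\<lambda>q. walker_metric f q $ a $ b) p =
      (if a = 1 \<and> b = 1 then partial_deriv m (\<lambda>q::real^3. - 2 * f (q $ 1) (q $ 2)) p else 0)" for m a b
    by (auto simp: walker_metric_def partial_deriv_const)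
  show ?thesis
    using exhaust_3[of k] exhaust_3[of i] exhaust_3[of j]
    unfolding christoffel_def matrix_inv_walker_metric g d sum_3
    by (elim disjE) (simp_all add: christoffel_xy_def)
qed

lemma partial_deriv_christoffel:
  assumes "p \<in> M"
  shows "partial_deriv m (christoffel (walker_metric f) k i j) p =
    (if m = 1 then dx (christoffel_xy k i j) (p $ 1, p $ 2)
     else if m = 2 then dy (christoffel_xy k i j) (p $ 1, p $ 2) else 0)"
proof -
  have "partial_deriv m (christoffel (walker_metric f) k i j) p =
      partial_deriv m (\<lambda>q. christoffel_xy k i j (q $ 1, q $ 2)) p"
    by (rule partial_deriv_cong[OF open_M assms christoffel_eq])
  then show ?thesis
    using partial_deriv_xy[OF smooth_christoffel_xy xy_imageI[OF assms]] by simp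
qed

text \<open>Products of Christoffel symbols cancel: the only one that can be non-zero, \<Gamma>^3_12
  \<Gamma>^2_11, needs i = j = 1. Among the derivative terms f_xy drops out by symmetry of mixed
  derivatives, which leaves f_yy.\<close>

lemma curvature_op_eq:
  assumes "p \<in> M"
  shows "curvature_op (walker_metric f) m i j k p =
    (if m = 3 \<and> k = 2 then area i j * u (p $ 1, p $ 2)
     else if m = 2 \<and> k = 1 then - area i j * u (p $ 1, p $ 2) else 0)"
proof -
  let ?q = "(p $ 1, p $ 2)"
  have q: "?q \<in> S" using assms by (rule xy_imageI)
  have z: "dx (\<lambda>q. 0) r = 0" "dy (\<lambda>q. 0) r = 0" for r by (simp_all add: dx_def dy_def)
  note neg = dx_uminus[OF smooth_on_dx[OF smooth_F] q] dx_uminus[OF smooth_on_dy[OF smooth_F] q]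
    dy_uminus[OF smooth_on_dx[OF smooth_F] q] dy_uminus[OF smooth_on_dy[OF smooth_F] q]
    dx_dy_commute[OF open_S smooth_F q]
  show ?thesis
    unfolding curvature_op_def partial_deriv_christoffel[OF assms] christoffel_eq[OF assms] sum_3
    using exhaust_3[of m] exhaust_3[of i] exhaust_3[of j] exhaust_3[of k]
    by (elim disjE) (simp_all add: christoffel_xy_def z neg)
qed

lemma curvature_tensor_eq:
  assumes "p \<in> M" "length is = 4"
  shows "curvature_tensor (walker_metric f) p is = u (p $ 1, p $ 2) * area_tensor is"
proof -
  obtain i j k l where "is": "is = [i, j, k, l]"
    using assms(2) by (auto simp: length_Suc_conv numeral_eq_Suc)
  show ?thesis
    unfolding "is" curvature_tensor_def curvature_op_eq[OF assms(1)] sum_3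
    using exhaust_3[of k] exhaust_3[of l] by (elim disjE) (simp_all add: walker_metric_def)
qed

text \<open>The form \<open>dx \<and> dy\<close> is parallel, since the Christoffel symbols with upper index \<open>1\<close> and the
  \<open>\<Gamma>\<^bsup>2\<^esup>\<^bsub>i2\<^esub>\<close> vanish.\<close>

lemma area_parallel:
  "(\<Sum>s\<in>UNIV. christoffel_xy s a i q * area s j) + (\<Sum>s\<in>UNIV. christoffel_xy s a j q * area i s) = 0"
  using exhaust_3[of i] exhaust_3[of j] exhaust_3[of a]
  unfolding sum_3 by (elim disjE) (simp_all add: christoffel_xy_def)

lemma area_tensor_parallel:
  assumes "length is = 4"
  shows "(\<Sum>m<4. \<Sum>s\<in>UNIV. christoffel_xy s a (is ! m) q * area_tensor (is[m := s])) = 0"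
proof -
  obtain i j k l where "is": "is = [i, j, k, l]"
    using assms by (auto simp: length_Suc_conv numeral_eq_Suc)
  have "(\<Sum>m<4. \<Sum>s\<in>UNIV. christoffel_xy s a (is ! m) q * area_tensor (is[m := s])) =
     ((\<Sum>s\<in>UNIV. christoffel_xy s a i q * area s j) + (\<Sum>s\<in>UNIV. christoffel_xy s a j q * area i s)) * area l k
     + ((\<Sum>s\<in>UNIV. christoffel_xy s a l q * area s k) + (\<Sum>s\<in>UNIV. christoffel_xy s a k q * area l s)) * area i j"
    unfolding "is" by (simp add: numeral_eq_Suc sum_3 algebra_simps)
  then show ?thesis by (simp add: area_parallel)
qed

definition grad_u :: "3 \<Rightarrow> real \<times> real \<Rightarrow> real"
  where "grad_u i = (if i = 1 then dx u else if i = 2 then dy u else (\<lambda>q. 0))"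

text \<open>The coordinate Hessian is corrected only by \<Gamma>^2_11 = f_y: the other symbols have
  upper index 3, and u does not vary in that direction.\<close>

definition hess_u :: "3 \<Rightarrow> 3 \<Rightarrow> real \<times> real \<Rightarrow> real"
  where "hess_u i j q = (if i = 1 \<and> j = 1 then dx (dx u) q - dy F q * dy u q
    else if (i = 1 \<and> j = 2) \<or> (i = 2 \<and> j = 1) then dx (dy u) q
    else if i = 2 \<and> j = 2 then dy (dy u) q else 0)"

lemma smooth_grad_u: "smooth_on S (grad_u i)"
  by (auto simp: grad_u_def intro: smooth_on_dx smooth_on_dy smooth_u smooth_on_const)

lemma cov_deriv_curvature_1:
  assumes "p \<in> M" "length is = 4"
  shows "cov_deriv_curvature (walker_metric f) 1 p (a # is) = grad_u a (p $ 1, p $ 2) * area_tensor is"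
proof -
  let ?R = "curvature_tensor (walker_metric f)"
  have "partial_deriv a (\<lambda>q. ?R q is) p = partial_deriv a (\<lambda>q. (\<lambda>r. u r * area_tensor is) (q $ 1, q $ 2)) p"
    using assms(2) by (intro partial_deriv_cong[OF open_M assms(1)]) (simp add: curvature_tensor_eq)
  also have "\<dots> = grad_u a (p $ 1, p $ 2) * area_tensor is"
  proof -
    have q: "(p $ 1, p $ 2) \<in> S" using assms(1) by (rule xy_imageI)
    show ?thesis
      unfolding partial_deriv_xy[OF smooth_on_mult[OF open_S smooth_u smooth_on_const] q]
      by (simp add: grad_u_def dx_mult_right[OF smooth_u q] dy_mult_right[OF smooth_u q])
  qed
  finally have 1: "partial_deriv a (\<lambda>q. ?R q is) p = grad_u a (p $ 1, p $ 2) * area_tensor is" .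
  have "(\<Sum>m<length is. \<Sum>s\<in>UNIV. christoffel (walker_metric f) s a (is ! m) p * ?R p (is[m := s])) =
      u (p $ 1, p $ 2) * (\<Sum>m<4. \<Sum>s\<in>UNIV. christoffel_xy s a (is ! m) (p $ 1, p $ 2) * area_tensor (is[m := s]))"
    using assms by (simp add: curvature_tensor_eq christoffel_eq sum_distrib_left algebra_simps)
  also have "\<dots> = 0" using area_tensor_parallel[OF assms(2)] by simp
  finally show ?thesis using 1 by (simp add: cov_deriv_curvature_def)
qed

lemma cov_deriv_curvature_2:
  assumes "p \<in> M" "length is = 4"
  shows "cov_deriv_curvature (walker_metric f) 2 p (b # a # is) =
    hess_u b a (p $ 1, p $ 2) * area_tensor is"
proof -
  let ?R = "cov_deriv_curvature (walker_metric f) 1"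
  have q: "(p $ 1, p $ 2) \<in> S" using assms(1) by (rule xy_imageI)
  have "partial_deriv b (\<lambda>q. ?R q (a # is)) p =
      partial_deriv b (\<lambda>q. (\<lambda>r. grad_u a r * area_tensor is) (q $ 1, q $ 2)) p"
    using assms(2) by (intro partial_deriv_cong[OF open_M assms(1)]) (simp add: cov_deriv_curvature_1[simplified])
  also have "\<dots> = (if b = 1 then dx (grad_u a) (p $ 1, p $ 2) else if b = 2 then dy (grad_u a) (p $ 1, p $ 2) else 0)
      * area_tensor is"
    unfolding partial_deriv_xy[OF smooth_on_mult[OF open_S smooth_grad_u smooth_on_const] q]
    by (simp add: dx_mult_right[OF smooth_grad_u q] dy_mult_right[OF smooth_grad_u q])
  finally have 1: "partial_deriv b (\<lambda>q. ?R q (a # is)) p =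
    (if b = 1 then dx (grad_u a) (p $ 1, p $ 2) else if b = 2 then dy (grad_u a) (p $ 1, p $ 2) else 0)
      * area_tensor is" .
  have "(\<Sum>m<length (a # is). \<Sum>s\<in>UNIV.
        christoffel (walker_metric f) s b ((a # is) ! m) p * ?R p ((a # is)[m := s])) =
      (\<Sum>s\<in>UNIV. christoffel_xy s b a (p $ 1, p $ 2) * grad_u s (p $ 1, p $ 2)) * area_tensor is
      + grad_u a (p $ 1, p $ 2) *
        (\<Sum>m<4. \<Sum>s\<in>UNIV. christoffel_xy s b (is ! m) (p $ 1, p $ 2) * area_tensor (is[m := s]))"
    \<comment> \<open>Slot 0 holds the gradient index and produces the correction in the Hessian;
      the other four slots form the sum that vanishes by parallelism.\<close>
    unfolding list.size(4) add_0_right add_Suc_right sum.lessThan_Suc_shift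
    using assms
    by (simp add: cov_deriv_curvature_1[simplified] christoffel_eq sum_distrib_left sum_distrib_right algebra_simps)
  also have "\<dots> = (\<Sum>s\<in>UNIV. christoffel_xy s b a (p $ 1, p $ 2) * grad_u s (p $ 1, p $ 2)) * area_tensor is"
    using area_tensor_parallel[OF assms(2)] by simp
  finally have "cov_deriv (walker_metric f) ?R p (b # a # is) =
     ((if b = 1 then dx (grad_u a) (p $ 1, p $ 2) else if b = 2 then dy (grad_u a) (p $ 1, p $ 2) else 0)
      - (\<Sum>s\<in>UNIV. christoffel_xy s b a (p $ 1, p $ 2) * grad_u s (p $ 1, p $ 2))) * area_tensor is"
    unfolding cov_deriv.simps 1 left_diff_distrib by simp
  also have "(if b = 1 then dx (grad_u a) (p $ 1, p $ 2) else if b = 2 then dy (grad_u a) (p $ 1, p $ 2) else 0)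
      - (\<Sum>s\<in>UNIV. christoffel_xy s b a (p $ 1, p $ 2) * grad_u s (p $ 1, p $ 2))
      = hess_u b a (p $ 1, p $ 2)"
  proof -
    have z: "dx (\<lambda>q. 0) r = 0" "dy (\<lambda>q. 0) r = 0" for r by (simp_all add: dx_def dy_def)
    show ?thesis
      using exhaust_3[of a] exhaust_3[of b] dx_dy_commute[OF open_S smooth_u q] unfolding sum_3
      by (elim disjE) (simp_all add: christoffel_xy_def hess_u_def grad_u_def z)
  qed
  finally show ?thesis by (simp add: cov_deriv_curvature_def numeral_2_eq_2)
qed

end

section \<open>Curvature tensors evaluated on tangent vectors\<close>

lemma tensor_apply_Nil: "tensor_apply A p [] = A p []"
proof -
  have "{is :: 'a list. length is = 0} = {[]}" by auto
  then show ?thesis by (simp add: tensor_apply_def)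
qed

lemma tensor_apply_Cons:
  "tensor_apply A p (v # vs) = (\<Sum>i\<in>UNIV. v $ i * tensor_apply (\<lambda>p is. A p (i # is)) p vs)"
proof -
  let ?h = "\<lambda>is. A p is * (\<Prod>m<Suc (length vs). (v # vs) ! m $ (is ! m))"
  let ?L = "{is :: 'a list. length is = length vs}"
  have "{is :: 'a list. length is = Suc (length vs)} = (\<lambda>(i, is). i # is) ` (UNIV \<times> ?L)"
    by (auto simp: length_Suc_conv image_iff)
  then have "tensor_apply A p (v # vs) = (\<Sum>is\<in>(\<lambda>(i, is). i # is) ` (UNIV \<times> ?L). ?h is)"
    by (simp add: tensor_apply_def)
  also have "\<dots> = (\<Sum>x\<in>UNIV \<times> ?L. ?h (fst x # snd x))"
    by (subst sum.reindex) (auto simp: inj_on_def case_prod_unfold)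
  also have "\<dots> = (\<Sum>i\<in>UNIV. \<Sum>is\<in>?L. ?h (i # is))"
    by (simp add: sum.cartesian_product case_prod_unfold)
  also have "\<dots> = (\<Sum>i\<in>UNIV. v $ i * tensor_apply (\<lambda>p is. A p (i # is)) p vs)"
    unfolding tensor_apply_def prod.lessThan_Suc_shift
    by (simp add: sum_distrib_left algebra_simps)
  finally show ?thesis .
qed

lemma tensor_apply_area:
  assumes "\<And>is. length is = 4 \<Longrightarrow> A p is = c * area_tensor is"
  shows "tensor_apply A p [v1, v2, v3, v4] = c * (area_form v1 v2 * area_form v4 v3)"
  unfolding tensor_apply_Cons tensor_apply_Nil sum_3
  by (simp add: assms area_form_def) (simp add: algebra_simps)

context walker
begin

lemma curvature_apply_0:
  "p \<in> M \<Longrightarrow> tensor_apply (cov_deriv_curvature (walker_metric f) 0) p [v1, v2, v3, v4] =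
    u (p $ 1, p $ 2) * (area_form v1 v2 * area_form v4 v3)"
  by (rule tensor_apply_area) (simp add: cov_deriv_curvature_def curvature_tensor_eq)

lemma curvature_apply_1:
  assumes "p \<in> M"
  shows "tensor_apply (cov_deriv_curvature (walker_metric f) 1) p [w, v1, v2, v3, v4] =
    (w $ 1 * dx u (p $ 1, p $ 2) + w $ 2 * dy u (p $ 1, p $ 2)) * (area_form v1 v2 * area_form v4 v3)"
proof -
  have "tensor_apply (\<lambda>p is. cov_deriv_curvature (walker_metric f) 1 p (a # is)) p [v1, v2, v3, v4] =
      grad_u a (p $ 1, p $ 2) * (area_form v1 v2 * area_form v4 v3)" for a
    by (rule tensor_apply_area) (rule cov_deriv_curvature_1[OF assms])
  then show ?thesis
    by (subst tensor_apply_Cons) (simp add: sum_3 grad_u_def algebra_simps)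
qed

lemma curvature_apply_2:
  assumes "p \<in> M"
  shows "tensor_apply (cov_deriv_curvature (walker_metric f) 2) p [w, w', v1, v2, v3, v4] =
    (\<Sum>b\<in>UNIV. \<Sum>a\<in>UNIV. w $ b * w' $ a * hess_u b a (p $ 1, p $ 2)) * (area_form v1 v2 * area_form v4 v3)"
proof -
  have "tensor_apply (\<lambda>p is. cov_deriv_curvature (walker_metric f) 2 p (b # a # is)) p [v1, v2, v3, v4] =
      hess_u b a (p $ 1, p $ 2) * (area_form v1 v2 * area_form v4 v3)" for a b
    by (rule tensor_apply_area) (rule cov_deriv_curvature_2[OF assms])
  then show ?thesis
    by (subst tensor_apply_Cons, subst tensor_apply_Cons) (simp add: sum_distrib_left sum_distrib_right algebra_simps)
qed

end


section \<open>Curvature homotheties\<close>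

lemma metric_form_walker:
  "metric_form (walker_metric f) p v w =
    - 2 * f (p $ 1) (p $ 2) * v $ 1 * w $ 1 + v $ 1 * w $ 3 + v $ 3 * w $ 1 + v $ 2 * w $ 2"
  by (simp add: metric_form_def sum_3 walker_metric_def)

lemma powi_neg_diff: "c powi (- int l - 2) = inverse c ^ (l + 2)" for c :: real
proof -
  have "- int l - 2 = - int (l + 2)" by simp
  then show ?thesis by (simp only: power_int_minus power_int_of_nat power_inverse)
qed

context walker
begin

text \<open>The kernel \<open>\<partial>\<^sub>3\<close> of the curvature is preserved by a curvature homothety \<open>\<phi>\<close>, hence so is its orthogonal
  complement; this leaves \<open>\<phi>\<close> triangular with \<open>\<plusminus>1\<close> in the middle.\<close>

lemma curvature_homothety_triangular:
  assumes P: "P \<in> M" and Q: "Q \<in> M" and uP: "u (P $ 1, P $ 2) \<noteq> 0" and d: "d \<noteq> 0"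
    and iso: "linear_isometry (walker_metric f) P Q \<phi>"
    and R: "\<And>vs. length vs = 4 \<Longrightarrow> tensor_apply (cov_deriv_curvature (walker_metric f) 0) Q (map \<phi> vs) =
          d\<^sup>2 * tensor_apply (cov_deriv_curvature (walker_metric f) 0) P vs"
  shows "\<phi> (axis 1 1) $ 1 \<noteq> 0" "\<phi> (axis 2 1) $ 1 = 0" "(\<phi> (axis 2 1) $ 2)\<^sup>2 = 1"
proof -
  define e where "e i = \<phi> (axis i 1)" for i
  \<comment> \<open>On a list of the form v, w, w, v both area factors agree, so the curvature
    returns the square of the area.\<close>
  have ar: "u (Q $ 1, Q $ 2) * (area_form (e i) (e j))\<^sup>2 =
     d\<^sup>2 * (u (P $ 1, P $ 2) * (area_form (axis i 1) (axis j 1))\<^sup>2)" for i j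
    using R[of "[axis i 1, axis j 1, axis j 1, axis i 1]"] P Q
    by (simp add: curvature_apply_0 e_def power2_eq_square)
  have m: "metric_form (walker_metric f) Q (e i) (e j) = metric_form (walker_metric f) P (axis i 1) (axis j 1)" for i j
    using iso by (simp add: linear_isometry_def e_def)
  have a: "area_form (e 1) (e 2) \<noteq> 0" "u (Q $ 1, Q $ 2) \<noteq> 0"
    using ar[of 1 2] uP d by (auto simp: area_form_def axis_def)
  have z: "area_form (e 1) (e 3) = 0" "area_form (e 2) (e 3) = 0"
    using ar[of 1 3] ar[of 2 3] a(2) by (auto simp: area_form_def axis_def)
  \<comment> \<open>Cramer's rule: the plane parts of \<open>e 1\<close> and \<open>e 2\<close> are
    independent and that of \<open>e 3\<close> has zero area with both, so it is zero.\<close>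
  have "area_form (e 1) (e 2) * e 3 $ 1 = 0" "area_form (e 1) (e 2) * e 3 $ 2 = 0"
    using z by (simp_all add: area_form_def algebra_simps) algebra+
  then have e3: "e 3 $ 1 = 0" "e 3 $ 2 = 0" using a(1) by simp_all
  have e13: "e 1 $ 1 * e 3 $ 3 = 1"
    using m[of 1 3] e3 by (simp add: metric_form_walker axis_def)
  then show 1: "\<phi> (axis 1 1) $ 1 \<noteq> 0" by (auto simp: e_def)
  have "e 2 $ 1 * e 3 $ 3 = 0"
    using m[of 2 3] e3 by (simp add: metric_form_walker axis_def)
  then show 2: "\<phi> (axis 2 1) $ 1 = 0" using e13 by (auto simp: e_def)
  show "(\<phi> (axis 2 1) $ 2)\<^sup>2 = 1"
    using m[of 2 2] 2 by (simp add: metric_form_walker axis_def e_def power2_eq_square)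
qed

text \<open>The numbers are the entries of the triangular map: \<phi> sends \<partial>x to (a, s,
  ...) and \<partial>y to (0, \<epsilon>, ...). The common factor a^2 is the squared area factor,
  and d = 1 / c turns the weight c^(-l-2) into d^(l+2).\<close>

lemma homothety_curvature_homogeneousD:
  assumes hom: "homothety_curvature_homogeneous k M (walker_metric f)" and k: "k \<ge> 1"
    and P: "P \<in> M" and Q: "Q \<in> M" and uP: "u (P $ 1, P $ 2) \<noteq> 0"
  obtains a d s \<epsilon> where "a \<noteq> 0" "d \<noteq> 0" "\<epsilon>\<^sup>2 = 1"
    "a\<^sup>2 * u (Q $ 1, Q $ 2) = d\<^sup>2 * u (P $ 1, P $ 2)"
    "a\<^sup>2 * (\<epsilon> * dy u (Q $ 1, Q $ 2)) = d ^ 3 * dy u (P $ 1, P $ 2)"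
    "a\<^sup>2 * (a * dx u (Q $ 1, Q $ 2) + s * dy u (Q $ 1, Q $ 2)) = d ^ 3 * dx u (P $ 1, P $ 2)"
    "k \<ge> 2 \<Longrightarrow> a\<^sup>2 * hess_u 2 2 (Q $ 1, Q $ 2) = d ^ 4 * hess_u 2 2 (P $ 1, P $ 2)"
    "k \<ge> 2 \<Longrightarrow> a\<^sup>2 * (\<epsilon> * (a * hess_u 1 2 (Q $ 1, Q $ 2) + s * hess_u 2 2 (Q $ 1, Q $ 2)))
       = d ^ 4 * hess_u 1 2 (P $ 1, P $ 2)"
    "k \<ge> 2 \<Longrightarrow> a\<^sup>2 * (a\<^sup>2 * hess_u 1 1 (Q $ 1, Q $ 2) + 2 * a * s * hess_u 1 2 (Q $ 1, Q $ 2)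
       + s\<^sup>2 * hess_u 2 2 (Q $ 1, Q $ 2)) = d ^ 4 * hess_u 1 1 (P $ 1, P $ 2)"
proof -
  obtain \<phi> c where iso: "linear_isometry (walker_metric f) P Q \<phi>" and c: "c \<noteq> 0" and
    R: "\<And>l vs. l \<le> k \<Longrightarrow> length vs = l + 4 \<Longrightarrow>
      tensor_apply (cov_deriv_curvature (walker_metric f) l) Q (map \<phi> vs) =
      c powi (- int l - 2) * tensor_apply (cov_deriv_curvature (walker_metric f) l) P vs"
    using hom P Q unfolding homothety_curvature_homogeneous_def by blast
  define d where "d = inverse c"
  have d: "d \<noteq> 0" using c by (simp add: d_def)
  have R': "tensor_apply (cov_deriv_curvature (walker_metric f) l) Q (map \<phi> vs) =
      d ^ (l + 2) * tensor_apply (cov_deriv_curvature (walker_metric f) l) P vs"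
    if "l \<le> k" "length vs = l + 4" for l vs
    using R[OF that] by (simp only: powi_neg_diff d_def)
  let ?e = "\<lambda>i::3. axis i (1::real) :: real^3"
  define a where "a = \<phi> (?e 1) $ 1"
  define s where "s = \<phi> (?e 1) $ 2"
  define \<epsilon> where "\<epsilon> = \<phi> (?e 2) $ 2"
  have tri: "\<phi> (?e 1) $ 1 \<noteq> 0" "\<phi> (?e 2) $ 1 = 0" "(\<phi> (?e 2) $ 2)\<^sup>2 = 1"
    using curvature_homothety_triangular[OF P Q uP d iso] R'[of 0] by (simp_all add: numeral_2_eq_2)
  let ?vs = "[?e 1, ?e 2, ?e 2, ?e 1]"
  have A: "area_form (?e 1) (?e 2) = 1" by (simp add: area_form_def axis_def)
  have B: "area_form (\<phi> (?e 1)) (\<phi> (?e 2)) * area_form (\<phi> (?e 1)) (\<phi> (?e 2)) = a\<^sup>2"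
    using tri by (simp add: area_form_def a_def power_mult_distrib power2_eq_square[symmetric])
  note [simp] = A B tri(2)
  have 0: "u (Q $ 1, Q $ 2) * a\<^sup>2 = d\<^sup>2 * u (P $ 1, P $ 2)"
    using R'[of 0 ?vs] P Q by (simp add: curvature_apply_0 numeral_2_eq_2)
  have 1: "(\<phi> (?e i) $ 1 * dx u (Q $ 1, Q $ 2) + \<phi> (?e i) $ 2 * dy u (Q $ 1, Q $ 2)) * a\<^sup>2 =
      d ^ 3 * (?e i $ 1 * dx u (P $ 1, P $ 2) + ?e i $ 2 * dy u (P $ 1, P $ 2))" for i
    using R'[of 1 "?e i # ?vs"] P Q k
    by (simp add: curvature_apply_1[simplified] numeral_3_eq_3)
  have 2: "(\<Sum>b\<in>UNIV. \<Sum>a\<in>UNIV. \<phi> (?e i) $ b * \<phi> (?e j) $ a * hess_u b a (Q $ 1, Q $ 2)) * a\<^sup>2 =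
      d ^ 4 * (\<Sum>b\<in>UNIV. \<Sum>a\<in>UNIV. ?e i $ b * ?e j $ a * hess_u b a (P $ 1, P $ 2))" if "k \<ge> 2" for i j
  proof -
    have "tensor_apply (cov_deriv_curvature (walker_metric f) 2) Q (map \<phi> (?e i # ?e j # ?vs)) =
      d ^ 4 * tensor_apply (cov_deriv_curvature (walker_metric f) 2) P (?e i # ?e j # ?vs)"
      using R'[of 2 "?e i # ?e j # ?vs"] that by simp
    then show ?thesis by (simp only: list.map curvature_apply_2[OF P] curvature_apply_2[OF Q] A B mult_1_right)
  qed
  have h3: "hess_u 1 3 q = 0" "hess_u 2 3 q = 0" "hess_u 3 i q = 0" "hess_u 2 1 q = hess_u 1 2 q" for q i
    by (simp_all add: hess_u_def)
  have ev: "?e i $ j = (if j = i then 1 else 0)" for i j by (simp add: axis_def)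
  note sums = sum_3 h3 ev a_def[symmetric] s_def[symmetric] \<epsilon>_def[symmetric]
  show ?thesis
  proof (rule that[of a d \<epsilon> s])
    show "a \<noteq> 0" "d \<noteq> 0" "\<epsilon>\<^sup>2 = 1" using tri d by (simp_all add: a_def \<epsilon>_def)
    show "a\<^sup>2 * u (Q $ 1, Q $ 2) = d\<^sup>2 * u (P $ 1, P $ 2)" using 0 by (simp add: algebra_simps)
    show "a\<^sup>2 * (\<epsilon> * dy u (Q $ 1, Q $ 2)) = d ^ 3 * dy u (P $ 1, P $ 2)"
      using 1[of 2] by (simp add: sums algebra_simps)
    show "a\<^sup>2 * (a * dx u (Q $ 1, Q $ 2) + s * dy u (Q $ 1, Q $ 2)) = d ^ 3 * dx u (P $ 1, P $ 2)"
      using 1[of 1] by (simp add: sums algebra_simps)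
    assume k2: "k \<ge> 2"
    have "\<epsilon> * \<epsilon> = 1" using tri by (simp add: \<epsilon>_def power2_eq_square)
    then show "a\<^sup>2 * hess_u 2 2 (Q $ 1, Q $ 2) = d ^ 4 * hess_u 2 2 (P $ 1, P $ 2)"
      using 2[OF k2, of 2 2] by (simp add: sums mult.commute)
    show "a\<^sup>2 * (\<epsilon> * (a * hess_u 1 2 (Q $ 1, Q $ 2) + s * hess_u 2 2 (Q $ 1, Q $ 2)))
       = d ^ 4 * hess_u 1 2 (P $ 1, P $ 2)"
      using 2[OF k2, of 1 2] by (simp add: sums algebra_simps)
    show "a\<^sup>2 * (a\<^sup>2 * hess_u 1 1 (Q $ 1, Q $ 2) + 2 * a * s * hess_u 1 2 (Q $ 1, Q $ 2)
       + s\<^sup>2 * hess_u 2 2 (Q $ 1, Q $ 2)) = d ^ 4 * hess_u 1 1 (P $ 1, P $ 2)"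
      using 2[OF k2, of 1 1] by (simp add: sums algebra_simps power2_eq_square)
  qed
qed

lemma homothety_curvature_homogeneousI:
  assumes "\<And>P Q. P \<in> M \<Longrightarrow> Q \<in> M \<Longrightarrow> \<exists>a d s. a \<noteq> 0 \<and> d \<noteq> 0 \<and>
    a\<^sup>2 * u (Q $ 1, Q $ 2) = d\<^sup>2 * u (P $ 1, P $ 2) \<and>
    a\<^sup>2 * dy u (Q $ 1, Q $ 2) = d ^ 3 * dy u (P $ 1, P $ 2) \<and>
    a\<^sup>2 * (a * dx u (Q $ 1, Q $ 2) + s * dy u (Q $ 1, Q $ 2)) = d ^ 3 * dx u (P $ 1, P $ 2)"
  shows "homothety_curvature_homogeneous 1 M (walker_metric f)"
  unfolding homothety_curvature_homogeneous_def
proof (intro ballI)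
  fix P Q assume P: "P \<in> M" and Q: "Q \<in> M"
  then obtain a d s where a: "a \<noteq> 0" "d \<noteq> 0" and
    eq: "a\<^sup>2 * u (Q $ 1, Q $ 2) = d\<^sup>2 * u (P $ 1, P $ 2)"
    "a\<^sup>2 * dy u (Q $ 1, Q $ 2) = d ^ 3 * dy u (P $ 1, P $ 2)"
    "a\<^sup>2 * (a * dx u (Q $ 1, Q $ 2) + s * dy u (Q $ 1, Q $ 2)) = d ^ 3 * dx u (P $ 1, P $ 2)"
    using assms[OF P Q] by blast
  \<comment> \<open>The third row of \<phi> is forced by the metric: 1 / a by the pairing with the
    third direction, - s / a by orthogonality of the images of \<partial>x and \<partial>y, and w by
    the square length of the image of \<partial>x.\<close>
  define w where "w = (2 * f (Q $ 1) (Q $ 2) * a\<^sup>2 - s\<^sup>2 - 2 * f (P $ 1) (P $ 2)) / (2 * a)"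
  define \<phi> :: "real^3 \<Rightarrow> real^3"
    where "\<phi> v = vector [a * v $ 1, s * v $ 1 + v $ 2, w * v $ 1 - s / a * v $ 2 + v $ 3 / a]" for v
  have w: "2 * a * w = 2 * f (Q $ 1) (Q $ 2) * a\<^sup>2 - s\<^sup>2 - 2 * f (P $ 1) (P $ 2)"
    using a by (simp add: w_def)
  have "linear \<phi>"
    by (intro linearI) (simp_all add: \<phi>_def vec_eq_iff forall_3 field_simps add_divide_distrib diff_divide_distrib)
  moreover have "metric_form (walker_metric f) Q (\<phi> v) (\<phi> v') = metric_form (walker_metric f) P v v'" for v v'
  proof -
    have "metric_form (walker_metric f) Q (\<phi> v) (\<phi> v') =
        (2 * a * w - 2 * f (Q $ 1) (Q $ 2) * a\<^sup>2 + s\<^sup>2) * v $ 1 * v' $ 1 + v $ 1 * v' $ 3 + v $ 3 * v' $ 1 + v $ 2 * v' $ 2"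
      using a(1) by (simp add: metric_form_walker \<phi>_def field_simps power2_eq_square)
    then show ?thesis by (simp add: w metric_form_walker)
  qed
  ultimately have iso: "linear_isometry (walker_metric f) P Q \<phi>" by (simp add: linear_isometry_def)
  have ar: "area_form (\<phi> v) (\<phi> v') = a * area_form v v'" for v v'
    by (simp add: area_form_def \<phi>_def algebra_simps)
  have comp: "\<phi> v $ 1 = a * v $ 1" "\<phi> v $ 2 = s * v $ 1 + v $ 2" for v
    by (simp_all add: \<phi>_def)
  have "tensor_apply (cov_deriv_curvature (walker_metric f) l) Q (map \<phi> vs) =
      inverse d powi (- int l - 2) * tensor_apply (cov_deriv_curvature (walker_metric f) l) P vs"
    if l: "l \<le> 1" and len: "length vs = l + 4" for l vs
  proof (cases "l = 0")
    case True
    then obtain v1 v2 v3 v4 where vs: "vs = [v1, v2, v3, v4]"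
      using len by (auto simp: length_Suc_conv numeral_eq_Suc)
    have "u (Q $ 1, Q $ 2) * (a * A * (a * B)) = d\<^sup>2 * (u (P $ 1, P $ 2) * (A * B))" for A B
      using eq(1) by (simp add: power2_eq_square) algebra
    then show ?thesis
      unfolding powi_neg_diff using True P Q by (simp add: vs curvature_apply_0 ar power2_eq_square mult.assoc)
  next
    case False
    then have l1: "l = 1" using l by simp
    then obtain v0 v1 v2 v3 v4 where vs: "vs = [v0, v1, v2, v3, v4]"
      using len by (auto simp: length_Suc_conv numeral_eq_Suc)
    have "(a * x * dx u (Q $ 1, Q $ 2) + (s * x + y) * dy u (Q $ 1, Q $ 2)) * (a * A * (a * B)) =
       d ^ 3 * ((x * dx u (P $ 1, P $ 2) + y * dy u (P $ 1, P $ 2)) * (A * B))" for A B x y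
    proof -
      have "(a * x * dx u (Q $ 1, Q $ 2) + (s * x + y) * dy u (Q $ 1, Q $ 2)) * (a * A * (a * B)) =
        (x * (a\<^sup>2 * (a * dx u (Q $ 1, Q $ 2) + s * dy u (Q $ 1, Q $ 2))) + y * (a\<^sup>2 * dy u (Q $ 1, Q $ 2))) * (A * B)"
        by (simp add: power2_eq_square algebra_simps)
      then show ?thesis unfolding eq(2,3) by (simp add: algebra_simps)
    qed
    from this[of "v0 $ 1" "v0 $ 2"] show ?thesis
      unfolding powi_neg_diff l1 using P Q by (simp add: vs curvature_apply_1[simplified] ar comp numeral_3_eq_3 mult.assoc)
  qed
  then show "\<exists>\<phi> c. linear_isometry (walker_metric f) P Q \<phi> \<and> c \<noteq> 0 \<and> (\<forall>l\<le>1. \<forall>vs. length vs = l + 4 \<longrightarrow>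
      tensor_apply (cov_deriv_curvature (walker_metric f) l) Q (map \<phi> vs) =
      c powi (- int l - 2) * tensor_apply (cov_deriv_curvature (walker_metric f) l) P vs)"
    using iso a(2) by (intro exI[of _ \<phi>] exI[of _ "inverse d"]) simp
qed

lemma u_same_sign:
  assumes "connected M" "\<And>q. q \<in> S \<Longrightarrow> u q \<noteq> 0" "p \<in> S" "q \<in> S"
  shows "u p / u q > 0"
  using connected_xy_image[OF assms(1)] smooth_on_continuous_on[OF smooth_u] assms(2-)
  by (rule same_sign_on_connected)

lemma homothety_1_curvature_homogeneous:
  assumes "connected M" "\<And>q. q \<in> S \<Longrightarrow> u q \<noteq> 0" "\<And>q. q \<in> S \<Longrightarrow> dy u q \<noteq> 0"
  shows "homothety_curvature_homogeneous 1 M (walker_metric f)"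
proof (rule homothety_curvature_homogeneousI)
  fix P Q assume "P \<in> M" "Q \<in> M"
  let ?p = "(P $ 1, P $ 2)" and ?q = "(Q $ 1, Q $ 2)"
  have S: "?p \<in> S" "?q \<in> S" using \<open>P \<in> M\<close> \<open>Q \<in> M\<close> by (auto intro: xy_imageI)
  define r where "r = u ?p / u ?q"
  have r: "r > 0" unfolding r_def by (rule u_same_sign[OF assms(1,2) S])
  have nz: "u ?p \<noteq> 0" "u ?q \<noteq> 0" "dy u ?p \<noteq> 0" "dy u ?q \<noteq> 0" using assms(2,3) S by blast+
  show "\<exists>a d s. a \<noteq> 0 \<and> d \<noteq> 0 \<and> a\<^sup>2 * u ?q = d\<^sup>2 * u ?p \<and> a\<^sup>2 * dy u ?q = d ^ 3 * dy u ?p \<and>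
    a\<^sup>2 * (a * dx u ?q + s * dy u ?q) = d ^ 3 * dx u ?p"
  proof -
    \<comment> \<open>The equations for u and u_y say a^2 / d^2 = r and a^2 u_y(Q) = d^3 u_y(P),
      which determine d and then a up to sign. The last equation is linear in s with coefficient a^2
      u_y(Q).\<close>
    define d where "d = r * dy u ?q / dy u ?p"
    define a where "a = sqrt r * d"
    define s where "s = (d ^ 3 * dx u ?p / a\<^sup>2 - a * dx u ?q) / dy u ?q"
    have d: "d \<noteq> 0" using r nz by (simp add: d_def)
    moreover have "a \<noteq> 0" "a\<^sup>2 = r * d\<^sup>2"
      using r d by (simp_all add: a_def power_mult_distrib)
    moreover have "r * u ?q = u ?p" using nz by (simp add: r_def)
    moreover have "d * dy u ?p = r * dy u ?q" using nz by (simp add: d_def)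
    moreover have "a * dx u ?q + s * dy u ?q = d ^ 3 * dx u ?p / a\<^sup>2" using nz by (simp add: s_def)
    ultimately show ?thesis
      by (intro exI[of _ a] exI[of _ d] exI[of _ s])
        (auto simp: power2_eq_square power3_eq_cube algebra_simps)
  qed
qed

end


section \<open>Homotheties between Walker metrics\<close>

lemma frechet_derivative_vec_nth:
  assumes "T differentiable (at p)" "((\<lambda>q. T q $ i) has_derivative D) (at p)"
  shows "frechet_derivative T (at p) v $ i = D v"
proof -
  have "((\<lambda>q. T q $ i) has_derivative (\<lambda>v. frechet_derivative T (at p) v $ i)) (at p)"
    using assms(1) by (intro bounded_linear.has_derivative[OF bounded_linear_vec_nth])
      (simp add: frechet_derivative_works)
  from has_derivative_unique[OF this assms(2)] show ?thesis by (simp add: fun_eq_iff)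
qed

lemma smooth_on_differentiable: "smooth_on S F \<Longrightarrow> p \<in> S \<Longrightarrow> F differentiable (at p)"
  using smooth_on_has_derivative differentiableI by blast

text \<open>The maps that preserve the shape of Walker metrics up to a factor \<open>\<mu>\<^sup>2\<close>; the coefficient
  \<open>-\<mu>h'/\<lambda>\<close> is what makes the \<open>dx dy\<close> term vanish.\<close>

definition walker_map ::
    "real \<Rightarrow> real \<Rightarrow> real \<Rightarrow> (real \<Rightarrow> real) \<Rightarrow> (real \<Rightarrow> real) \<Rightarrow> real^3 \<Rightarrow> real^3"
  where "walker_map l x1 \<mu> h m p = vector [l * p $ 1 + x1, \<mu> * p $ 2 + h (p $ 1),
    \<mu>\<^sup>2 / l * p $ 3 - \<mu> * deriv h (p $ 1) / l * p $ 2 + m (p $ 1)]"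

lemma walker_map_nth [simp]:
  "walker_map l x1 \<mu> h m p $ 1 = l * p $ 1 + x1"
  "walker_map l x1 \<mu> h m p $ 2 = \<mu> * p $ 2 + h (p $ 1)"
  "walker_map l x1 \<mu> h m p $ 3 = \<mu>\<^sup>2 / l * p $ 3 - \<mu> * deriv h (p $ 1) / l * p $ 2 + m (p $ 1)"
  by (simp_all add: walker_map_def)

locale walker_map_data =
  fixes I :: "real set" and l x1 \<mu> :: real and h m :: "real \<Rightarrow> real"
  assumes open_I: "open I" and l: "l \<noteq> 0" and \<mu>: "\<mu> \<noteq> 0"
    and smooth_h: "smooth_on I h" and smooth_m: "smooth_on I m"
begin

abbreviation T :: "real^3 \<Rightarrow> real^3" where "T \<equiv> walker_map l x1 \<mu> h m"

definition T_inv :: "real^3 \<Rightarrow> real^3"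
  where "T_inv q = (let x = (q $ 1 - x1) / l; y = (q $ 2 - h x) / \<mu> in
    vector [x, y, l / \<mu>\<^sup>2 * (q $ 3 + \<mu> * deriv h x / l * y - m x)])"

lemma open_dom: "open {p :: real^3. p $ 1 \<in> I}"
  using open_vimage[OF open_I, of "\<lambda>p :: real^3. p $ 1"] by (simp add: vimage_def continuous_intros)

lemma open_ran: "open {q :: real^3. (q $ 1 - x1) / l \<in> I}"
  using open_vimage[OF open_I, of "\<lambda>q :: real^3. (q $ 1 - x1) / l"] l
  by (simp add: vimage_def continuous_intros)

lemma smooth_nth: "smooth_on U (\<lambda>p :: real^3. p $ i)"
  by (rule smooth_on_bounded_linear[OF bounded_linear_vec_nth])

lemma smooth_T: "smooth_on {p. p $ 1 \<in> I} T"
proof (rule smooth_on_vec[OF open_dom])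
  let ?U = "{p :: real^3. p $ 1 \<in> I}"
  have c: "smooth_on ?U (\<lambda>p. k (p $ 1))" if "smooth_on I k" for k :: "real \<Rightarrow> real"
    by (rule smooth_on_compose[OF open_dom open_I that smooth_nth]) simp
  have d: "smooth_on ?U (\<lambda>p. \<mu>\<^sup>2 / l * p $ 3 - (\<mu> / l) * deriv h (p $ 1) * p $ 2 + m (p $ 1))"
    using c[OF smooth_m] c[OF smooth_on_real_deriv(1)[OF open_I smooth_h]]
    by (intro smooth_on_add smooth_on_diff smooth_on_mult smooth_on_const smooth_nth open_dom)
  have e: "smooth_on ?U (\<lambda>p. l * p $ 1 + x1)" "smooth_on ?U (\<lambda>p. \<mu> * p $ 2 + h (p $ 1))"
    using c[OF smooth_h] by (intro smooth_on_add smooth_on_mult smooth_on_const smooth_nth open_dom)+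
  show "smooth_on ?U (\<lambda>p. T p $ i)" for i
    using exhaust_3[of i] d e by auto
qed

lemma smooth_T_inv: "smooth_on {q. (q $ 1 - x1) / l \<in> I} T_inv"
proof (rule smooth_on_vec[OF open_ran])
  let ?V = "{q :: real^3. (q $ 1 - x1) / l \<in> I}"
  have x: "smooth_on ?V (\<lambda>q. (q $ 1 - x1) / l)"
    using l by (intro smooth_on_divide smooth_on_diff smooth_on_const smooth_nth open_ran)
  have c: "smooth_on ?V (\<lambda>q. k ((q $ 1 - x1) / l))" if "smooth_on I k" for k :: "real \<Rightarrow> real"
    by (rule smooth_on_compose[OF open_ran open_I that x]) simp
  have y: "smooth_on ?V (\<lambda>q. (q $ 2 - h ((q $ 1 - x1) / l)) / \<mu>)"
    using \<mu> c[OF smooth_h] by (intro smooth_on_divide smooth_on_diff smooth_on_const smooth_nth open_ran)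
  have z: "smooth_on ?V (\<lambda>q. l / \<mu>\<^sup>2 * (q $ 3 + (\<mu> / l) * deriv h ((q $ 1 - x1) / l) *
      ((q $ 2 - h ((q $ 1 - x1) / l)) / \<mu>) - m ((q $ 1 - x1) / l)))"
    using c[OF smooth_m] c[OF smooth_on_real_deriv(1)[OF open_I smooth_h]] y
    by (intro smooth_on_add smooth_on_diff smooth_on_mult smooth_on_const smooth_nth open_ran)
  show "smooth_on ?V (\<lambda>q. T_inv q $ i)" for i
    using exhaust_3[of i] x y z \<mu> by (auto simp: T_inv_def Let_def)
qed

lemma T_inv_T: "T_inv (T p) = p"
  using l \<mu> by (simp add: vec_eq_iff forall_3 T_inv_def Let_def field_simps power2_eq_square)

lemma T_T_inv: "T (T_inv q) = q"
  using l \<mu> by (simp add: vec_eq_iff forall_3 T_inv_def Let_def field_simps power2_eq_square)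

lemma T_in_ran: "(T p $ 1 - x1) / l = p $ 1"
  using l by simp

text \<open>As a preimage under the continuous inverse the image of an open set is seen to be
  open.\<close>

lemma T_image: "U \<subseteq> {p. p $ 1 \<in> I} \<Longrightarrow> T ` U = {q. (q $ 1 - x1) / l \<in> I} \<inter> T_inv -` U"
  by (force simp: T_inv_T T_in_ran T_T_inv image_iff simp del: walker_map_nth intro: T_T_inv[symmetric])

lemma open_T_image: "open U \<Longrightarrow> U \<subseteq> {p. p $ 1 \<in> I} \<Longrightarrow> open (T ` U)"
  unfolding T_image
  by (rule continuous_open_preimage[OF smooth_on_continuous_on[OF smooth_T_inv] open_ran])

lemma diffeomorphism_T:
  assumes "open U" "U \<subseteq> {p. p $ 1 \<in> I}"
  shows "diffeomorphism_between U (T ` U) T"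
proof -
  have V: "T ` U \<subseteq> {q. (q $ 1 - x1) / l \<in> I}" using T_image[OF assms(2)] by simp
  have 1: "smooth_on U T" "smooth_on (T ` U) T_inv"
    using smooth_on_subset[OF smooth_T assms(2)] smooth_on_subset[OF smooth_T_inv V] .
  have "homeomorphism U (T ` U) T T_inv"
    by (rule homeomorphismI) (use 1 T_inv_T T_T_inv in \<open>auto intro: smooth_on_continuous_on\<close>)
  with 1 show ?thesis unfolding diffeomorphism_between_def by blast
qed

text \<open>The third component is built so that every coefficient except that of dx^2 scales by
  \<mu>^2 by itself; \<open>eq\<close> is the remaining coefficient. Separating c from \<mu> lets a
  reflection \<mu> = -1 count as an isometry with c = 1.\<close>

lemma homothety_T:
  assumes U: "open U" "U \<subseteq> {p. p $ 1 \<in> I}" and c: "c\<^sup>2 = \<mu>\<^sup>2"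
    and eq: "\<And>p. p \<in> U \<Longrightarrow> \<mu>\<^sup>2 * f1 (p $ 1) (p $ 2) =
      l\<^sup>2 * f2 (l * p $ 1 + x1) (\<mu> * p $ 2 + h (p $ 1)) + \<mu> * deriv (deriv h) (p $ 1) * p $ 2
      - l * deriv m (p $ 1) - (deriv h (p $ 1))\<^sup>2 / 2"
  shows "homothety_between c U (walker_metric f1) (T ` U) (walker_metric f2) T"
  unfolding homothety_between_def
proof (intro conjI ballI allI)
  show "diffeomorphism_between U (T ` U) T" by (rule diffeomorphism_T[OF U])
  fix p v w assume p: "p \<in> U"
  then have pI: "p $ 1 \<in> I" using U by auto
  let ?h1 = "deriv h (p $ 1)" and ?h2 = "deriv (deriv h) (p $ 1)" and ?m1 = "deriv m (p $ 1)"
  let ?D = "frechet_derivative T (at p)"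
  have dT: "T differentiable (at p)" using smooth_on_differentiable[OF smooth_T] pI by simp
  note real_deriv = smooth_on_real_deriv(2)[OF open_I]
  have n: "((\<lambda>p :: real^3. p $ i) has_derivative (\<lambda>v. v $ i)) (at p)" for i
    by (rule bounded_linear_imp_has_derivative[OF bounded_linear_vec_nth])
  have k: "((\<lambda>p. k (p $ 1)) has_derivative (\<lambda>v. deriv k (p $ 1) * v $ 1)) (at p)"
    if "smooth_on I k" for k :: "real \<Rightarrow> real"
    using has_derivative_compose[OF n real_deriv[OF that pI, unfolded has_field_derivative_def]] .
  have D1: "?D v $ 1 = l * v $ 1" for v
    by (rule frechet_derivative_vec_nth[OF dT]) (auto intro!: derivative_eq_intros n)
  have D2: "?D v $ 2 = \<mu> * v $ 2 + ?h1 * v $ 1" for v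
    by (rule frechet_derivative_vec_nth[OF dT]) (auto intro!: derivative_eq_intros n k[OF smooth_h])
  have D3: "?D v $ 3 = \<mu>\<^sup>2 / l * v $ 3 - (\<mu> / l) * (?h1 * v $ 2 + ?h2 * v $ 1 * p $ 2) + ?m1 * v $ 1" for v
  proof (rule frechet_derivative_vec_nth[OF dT])
    have "((\<lambda>q. \<mu>\<^sup>2 / l * q $ 3 - (\<mu> / l) * (deriv h (q $ 1) * q $ 2) + m (q $ 1)) has_derivative
      (\<lambda>v. \<mu>\<^sup>2 / l * v $ 3 - (\<mu> / l) * (?h1 * v $ 2 + ?h2 * v $ 1 * p $ 2) + ?m1 * v $ 1)) (at p)"
      by (intro has_derivative_add has_derivative_diff has_derivative_mult_right has_derivative_mult n
          k[OF smooth_m] k[OF smooth_on_real_deriv(1)[OF open_I smooth_h]])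
    then show "((\<lambda>q. T q $ 3) has_derivative
      (\<lambda>v. \<mu>\<^sup>2 / l * v $ 3 - (\<mu> / l) * (?h1 * v $ 2 + ?h2 * v $ 1 * p $ 2) + ?m1 * v $ 1)) (at p)"
      by (simp add: mult.assoc)
  qed
  have "metric_form (walker_metric f2) (T p) (?D v) (?D w) =
     - 2 * (l\<^sup>2 * f2 (l * p $ 1 + x1) (\<mu> * p $ 2 + h (p $ 1)) + \<mu> * ?h2 * p $ 2 - l * ?m1 - ?h1\<^sup>2 / 2) * v $ 1 * w $ 1
     + \<mu>\<^sup>2 * (v $ 1 * w $ 3 + v $ 3 * w $ 1 + v $ 2 * w $ 2)"
    unfolding metric_form_walker D1 D2 D3 using l
    by (simp add: field_simps power2_eq_square)
  also have "\<dots> = c\<^sup>2 * metric_form (walker_metric f1) p v w"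
    unfolding eq[OF p, symmetric] metric_form_walker c by (simp add: algebra_simps)
  finally show "metric_form (walker_metric f2) (T p) (?D v) (?D w) = c\<^sup>2 * metric_form (walker_metric f1) p v w" .
qed

end

text \<open>It is enough to match y-derivatives: the two sides of the metric equation then differ on
  the box by a function of x, which the free component m absorbs. The domain is finally cut down to
  the part mapped into N.\<close>

lemma locally_isometric_at_walker:
  fixes f1 f2 :: "real \<Rightarrow> real \<Rightarrow> real"
  defines "F1 \<equiv> \<lambda>(x, y). f1 x y" and "F2 \<equiv> \<lambda>(x, y). f2 x y"
  assumes "open M" "open N" "P \<in> M" "Q \<in> N"
    and I: "open I" "is_interval I" "P $ 1 \<in> I" and J: "open J" "is_interval J" "P $ 2 \<in> J"
    and F1: "smooth_on (I \<times> J) F1" and F2: "open S2" "smooth_on S2 F2"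
    and S2: "\<And>x y. x \<in> I \<Longrightarrow> y \<in> J \<Longrightarrow> (l * x + x1, \<mu> * y + h x) \<in> S2"
    and l: "l \<noteq> 0" and \<mu>: "\<mu>\<^sup>2 = 1" and h: "smooth_on I h"
    and Q: "Q $ 1 = l * P $ 1 + x1" "Q $ 2 = \<mu> * P $ 2 + h (P $ 1)"
    and eq: "\<And>x y. x \<in> I \<Longrightarrow> y \<in> J \<Longrightarrow>
      dy F1 (x, y) = l\<^sup>2 * \<mu> * dy F2 (l * x + x1, \<mu> * y + h x) + \<mu> * deriv (deriv h) x"
  shows "locally_isometric_at M (walker_metric f1) P N (walker_metric f2) Q"
proof -
  define y0 where "y0 = P $ 2"
  \<comment> \<open>The metric equation on the slice y = y0, solved for m'.\<close>
  define G where "G x = (l\<^sup>2 * F2 (l * x + x1, \<mu> * y0 + h x) + \<mu> * y0 * deriv (deriv h) x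
    - (1/2) * (deriv h x)\<^sup>2 - F1 (x, y0)) * (1 / l)" for x
  have y0: "y0 \<in> J" using J by (simp add: y0_def)
  have id: "smooth_on I (\<lambda>x::real. x)" by (rule smooth_on_bounded_linear) (rule bounded_linear_ident)
  have s1: "smooth_on I (\<lambda>x. F2 (l * x + x1, \<mu> * y0 + h x))"
    using S2 y0 h
    by (intro smooth_on_compose[OF I(1) F2] smooth_on_Pair smooth_on_add smooth_on_mult smooth_on_const id I(1)) auto
  have s2: "smooth_on I (\<lambda>x. F1 (x, y0))"
    using y0 by (intro smooth_on_compose[OF I(1) open_Times[OF I(1) J(1)] F1] smooth_on_Pair smooth_on_const id I(1)) auto
  have h1: "smooth_on I (deriv h)" "smooth_on I (deriv (deriv h))"
    using smooth_on_real_deriv(1)[OF I(1)] h by blast+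
  have "smooth_on I G"
    unfolding G_def
    by (intro smooth_on_add smooth_on_diff smooth_on_mult smooth_on_power smooth_on_const s1 s2 h1 I(1))
  \<comment> \<open>The integration constant gives the image of P the third coordinate of Q.\<close>
  from smooth_antiderivative[OF I(1,2) this I(3)]
  obtain m where m: "smooth_on I m"
    "m (P $ 1) = Q $ 3 - \<mu>\<^sup>2 / l * P $ 3 + \<mu> * deriv h (P $ 1) / l * P $ 2"
    "\<And>x. x \<in> I \<Longrightarrow> (m has_real_derivative G x) (at x)" by blast
  interpret W: walker_map_data I l x1 \<mu> h m
    by standard (use I l \<mu> h m(1) in auto)
  have key: "F1 (x, y) = l\<^sup>2 * F2 (l * x + x1, \<mu> * y + h x) + \<mu> * deriv (deriv h) x * y - l * G x - (deriv h x)\<^sup>2 / 2"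
    if x: "x \<in> I" and y: "y \<in> J" for x y
  proof -
    define k where "k y = F1 (x, y) - l\<^sup>2 * F2 (l * x + x1, \<mu> * y + h x) - \<mu> * deriv (deriv h) x * y" for y
    have "(k has_real_derivative 0) (at y)" if y: "y \<in> J" for y
    proof -
      have a: "((\<lambda>y. F1 (x, y)) has_real_derivative dy F1 (x, y)) (at y)"
        by (rule has_real_derivative_dy[OF F1]) (use x y in auto)
      have b: "((\<lambda>y. F2 (l * x + x1, \<mu> * y + h x)) has_real_derivative
          0 * dx F2 (l * x + x1, \<mu> * y + h x) + \<mu> * dy F2 (l * x + x1, \<mu> * y + h x)) (at y)"
        by (rule has_real_derivative_compose_plane[where X = "\<lambda>_. l * x + x1" and Y = "\<lambda>y. \<mu> * y + h x", OF F2(2) S2[OF x y]])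
          (auto intro!: derivative_eq_intros)
      have "(k has_real_derivative dy F1 (x, y)
          - l\<^sup>2 * (0 * dx F2 (l * x + x1, \<mu> * y + h x) + \<mu> * dy F2 (l * x + x1, \<mu> * y + h x))
          - \<mu> * deriv (deriv h) x * 1) (at y)"
        unfolding k_def by (intro DERIV_diff DERIV_cmult a b DERIV_ident)
      then show ?thesis
        unfolding eq[OF x y] by (simp add: algebra_simps)
    qed
    from interval_constant[OF J(2) this y y0] have "k y = k y0" .
    moreover have "l * G x = l\<^sup>2 * F2 (l * x + x1, \<mu> * y0 + h x) + \<mu> * y0 * deriv (deriv h) x
        - (1/2) * (deriv h x)\<^sup>2 - F1 (x, y0)"
      using l by (simp add: G_def)
    ultimately show ?thesis by (simp add: k_def algebra_simps)
  qed
  define B where "B = {p :: real^3. p $ 1 \<in> I \<and> p $ 2 \<in> J}"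
  have "open {p :: real^3. p $ 2 \<in> J}"
    using open_vimage[OF J(1), of "\<lambda>p :: real^3. p $ 2"] by (simp add: vimage_def continuous_intros)
  then have B: "open B"
    unfolding B_def using W.open_dom by (simp add: Collect_conj_eq open_Int)
  define U where "U = (M \<inter> B) \<inter> W.T -` N"
  have "continuous_on (M \<inter> B) W.T"
    by (rule continuous_on_subset[OF smooth_on_continuous_on[OF W.smooth_T]]) (auto simp: B_def)
  then have U: "open U"
    unfolding U_def using assms(3,4) B by (intro continuous_open_preimage) auto
  have sub: "U \<subseteq> {p. p $ 1 \<in> I}" by (auto simp: U_def B_def)
  have TP: "W.T P = Q"
    using Q m(2) by (simp add: vec_eq_iff forall_3)
  have "isometry_between U (walker_metric f1) (W.T ` U) (walker_metric f2) W.T"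
  proof (rule W.homothety_T[OF U sub])
    show "1\<^sup>2 = \<mu>\<^sup>2" using \<mu> by simp
    fix p assume "p \<in> U"
    then have p: "p $ 1 \<in> I" "p $ 2 \<in> J" by (auto simp: U_def B_def)
    have "deriv m (p $ 1) = G (p $ 1)" using m(3)[OF p(1)] by (rule DERIV_imp_deriv)
    then show "\<mu>\<^sup>2 * f1 (p $ 1) (p $ 2) =
      l\<^sup>2 * f2 (l * p $ 1 + x1) (\<mu> * p $ 2 + h (p $ 1)) + \<mu> * deriv (deriv h) (p $ 1) * p $ 2
      - l * deriv m (p $ 1) - (deriv h (p $ 1))\<^sup>2 / 2"
      using key[OF p] \<mu> by (simp add: F1_def F2_def)
  qed
  moreover have "P \<in> U" using assms(5,6) I J TP by (simp add: U_def B_def)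
  moreover have "U \<subseteq> M" "W.T ` U \<subseteq> N" by (auto simp: U_def)
  moreover have "Q \<in> W.T ` U" using TP \<open>P \<in> U\<close> by force
  ultimately show ?thesis
    unfolding locally_isometric_at_def using U W.open_T_image[OF U sub] TP by blast
qed


section \<open>Quadratic profiles\<close>

lemma C_diff_on_local:
  assumes "\<And>p. p \<in> S \<Longrightarrow> \<exists>U. p \<in> U \<and> open U \<and> C_diff_on k U F"
  shows "C_diff_on k S F"
  using assms
proof (induction k arbitrary: F)
  case 0
  have "isCont F p" if p: "p \<in> S" for p
  proof -
    obtain U where "p \<in> U" "open U" "continuous_on U F" using 0[OF p] by auto
    then show ?thesis by (simp add: continuous_on_eq_continuous_at)
  qed
  then show ?case by (simp add: continuous_at_imp_continuous_on)
next
  case (Suc k)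
  have "C_diff_on k S (\<lambda>p. frechet_derivative F (at p) v)" for v
  proof (rule Suc.IH)
    fix p assume "p \<in> S"
    from Suc.prems[OF this] show "\<exists>U. p \<in> U \<and> open U \<and> C_diff_on k U (\<lambda>p. frechet_derivative F (at p) v)"
      by auto
  qed
  moreover have "F differentiable (at p)" if "p \<in> S" for p
    using Suc.prems[OF that] by auto
  ultimately show ?case by simp
qed

lemma smooth_on_local:
  assumes "\<And>p. p \<in> S \<Longrightarrow> \<exists>U. p \<in> U \<and> open U \<and> smooth_on U F"
  shows "smooth_on S F"
  unfolding smooth_on_def
proof
  fix k show "C_diff_on k S F"
  proof (rule C_diff_on_local)
    fix p assume "p \<in> S"
    from assms[OF this] show "\<exists>U. p \<in> U \<and> open U \<and> C_diff_on k U F"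
      unfolding smooth_on_def by blast
  qed
qed

lemma open_contains_square:
  fixes S :: "(real \<times> real) set"
  assumes "open S" "(x, y) \<in> S"
  obtains e where "e > 0" "ball x e \<times> ball y e \<subseteq> S"
proof -
  obtain A B where AB': "open A" "open B" "(x, y) \<in> A \<times> B" "A \<times> B \<subseteq> S"
    using assms by (rule open_prod_elim)
  then have AB: "open A" "open B" "x \<in> A" "y \<in> B" "A \<times> B \<subseteq> S" by simp_all
  obtain e1 where e1: "e1 > 0" "ball x e1 \<subseteq> A" using AB(1,3) open_contains_ball by blast
  obtain e2 where e2: "e2 > 0" "ball y e2 \<subseteq> B" using AB(2,4) open_contains_ball by blast
  note e = e1 e2
  have "ball x (min e1 e2) \<subseteq> A" "ball y (min e1 e2) \<subseteq> B" using e by auto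
  then have "ball x (min e1 e2) \<times> ball y (min e1 e2) \<subseteq> S" using AB(5) by blast
  with e show ?thesis by (intro that[of "min e1 e2"]) auto
qed

text \<open>Reduction of order: with \<open>E'' = (\<mu>\<^sup>2 - \<mu>) t\<^sup>-\<^sup>2 E\<close> for \<open>E = |t|\<^sup>\<mu>\<close>, the function \<open>H = E K\<close> solves the
  inhomogeneous equation as soon as \<open>(E\<^sup>2 K')' = E r\<close>.  A complex exponent covers all real \<open>\<kappa>\<close> at once, and the
  real part of a complex solution is again a solution.\<close>

lemma euler_ode_solution:
  fixes r :: "real \<Rightarrow> real"
  assumes I: "open I" "is_interval I" "xP \<in> I" "x0 \<notin> I" and r: "smooth_on I r"
  obtains h where "smooth_on I h" "h xP = c"
    "\<And>x. x \<in> I \<Longrightarrow> deriv (deriv h) x = \<kappa> * inverse ((x - x0)\<^sup>2) * h x + r x"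
proof -
  have ne: "x \<noteq> x0" if "x \<in> I" for x using that I by blast
  have "x > x0 \<longleftrightarrow> xP > x0" if "x \<in> I" for x
    using mem_is_interval_1_I[OF I(2) that I(3), of x0] mem_is_interval_1_I[OF I(2) I(3) that, of x0]
      ne[OF that] ne[OF I(3)] I(4) by (metis linorder_le_less_linear order_le_less)
  then obtain \<sigma> :: real where \<sigma>: "\<sigma> * (x - x0) > 0" if "x \<in> I" for x
    using ne
    by (cases "xP > x0") (rule that[of 1], force, rule that[of "-1"], force)
  \<comment> \<open>A root of \<mu>^2 - \<mu> = \<kappa>, non-real for \<kappa> < -1/4.\<close>
  define \<mu> where "\<mu> = 1/2 + csqrt (1/4 + complex_of_real \<kappa>)"
  have \<mu>: "\<mu> * \<mu> - \<mu> = \<kappa>"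
    using power2_csqrt[of "1/4 + complex_of_real \<kappa>"] by (simp add: \<mu>_def power2_eq_square algebra_simps)
  define t where "t x = complex_of_real (1 / (x - x0))" for x
  have L: "((\<lambda>x. complex_of_real (ln (\<sigma> * (x - x0)))) has_vector_derivative t x) (at x)" if "x \<in> I" for x
  proof -
    have "((\<lambda>x. ln (\<sigma> * (x - x0))) has_real_derivative 1 / (x - x0)) (at x)"
      using \<sigma>[OF that] ne[OF that] by (auto intro!: derivative_eq_intros simp: divide_simps)
    then show ?thesis
      unfolding t_def by (rule has_vector_derivative_of_real)
  qed
  have ex: "((\<lambda>x. exp (b * complex_of_real (ln (\<sigma> * (x - x0))))) has_vector_derivative
      b * t x * exp (b * complex_of_real (ln (\<sigma> * (x - x0))))) (at x)" if "x \<in> I" for x b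
  proof -
    have "((\<lambda>x. b * complex_of_real (ln (\<sigma> * (x - x0)))) has_vector_derivative b * t x) (at x)"
      by (rule has_vector_derivative_mult_right[OF L[OF that]])
    from field_vector_diff_chain_at[OF this DERIV_exp] show ?thesis by (simp add: o_def)
  qed
  define E where "E x = exp (\<mu> * complex_of_real (ln (\<sigma> * (x - x0))))" for x
  define Ei where "Ei x = exp (- \<mu> * complex_of_real (ln (\<sigma> * (x - x0))))" for x
  have E: "(E has_vector_derivative \<mu> * t x * E x) (at x)"
    and Ei: "(Ei has_vector_derivative - \<mu> * t x * Ei x) (at x)" if "x \<in> I" for x
    unfolding E_def Ei_def by (rule ex[OF that])+
  have EEi: "E x * Ei x = 1" for x by (simp add: E_def Ei_def exp_minus)
  have E0: "E x \<noteq> 0" for x by (simp add: E_def)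
  have t: "(t has_vector_derivative - (t x * t x)) (at x)" if "x \<in> I" for x
  proof -
    have "((\<lambda>x. 1 / (x - x0)) has_real_derivative - (1 / (x - x0) * (1 / (x - x0)))) (at x)"
      using ne[OF that] by (auto intro!: derivative_eq_intros)
    from has_vector_derivative_of_real[OF this, where 'a = complex] show ?thesis by (simp add: t_def[abs_def])
  qed
  have cont: "isCont E x" "isCont Ei x" if "x \<in> I" for x
    using has_vector_derivative_continuous[OF E[OF that]] has_vector_derivative_continuous[OF Ei[OF that]] .
  have cr: "isCont r x" if "x \<in> I" for x
    using smooth_on_continuous_on[OF r] continuous_on_eq_continuous_at[OF I(1)] that by blast
  \<comment> \<open>In the reduction of order \<open>K1\<close> is E^2 K' and \<open>K2\<close> is
    K; the value of \<open>K2\<close> at \<open>xP\<close> imposes h(xP) = c.\<close>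
  have "continuous_on I (\<lambda>x. E x * r x)"
    using cont cr by (intro continuous_at_imp_continuous_on) (auto intro!: continuous_intros)
  from continuous_antiderivative[OF I(1,2) this I(3)]
  obtain K1 where K1: "\<And>x. x \<in> I \<Longrightarrow> (K1 has_vector_derivative E x * r x) (at x)" by blast
  have "continuous_on I (\<lambda>x. K1 x * (Ei x * Ei x))"
    using cont has_vector_derivative_continuous[OF K1]
    by (intro continuous_at_imp_continuous_on) (auto intro!: continuous_intros)
  from continuous_antiderivative[OF I(1,2) this I(3)]
  obtain K2 where K2: "K2 xP = c / E xP" "\<And>x. x \<in> I \<Longrightarrow> (K2 has_vector_derivative K1 x * (Ei x * Ei x)) (at x)"
    by blast
  define H where "H x = E x * K2 x" for x
  define H1 where "H1 x = \<mu> * t x * H x + K1 x * Ei x" for x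
  have H: "(H has_vector_derivative H1 x) (at x)" if "x \<in> I" for x
  proof -
    have "E x * (K1 x * (Ei x * Ei x)) + \<mu> * t x * E x * K2 x = H1 x"
      using EEi[of x] by (simp add: H1_def H_def algebra_simps)
    then show ?thesis
      using has_vector_derivative_mult[OF E[OF that] K2(2)[OF that]] by (simp add: H_def[abs_def])
  qed
  have H1: "(H1 has_vector_derivative complex_of_real (\<kappa> * inverse ((x - x0)\<^sup>2)) * H x + complex_of_real (r x)) (at x)"
    if "x \<in> I" for x
  proof -
    have "(H1 has_vector_derivative (\<mu> * t x * H1 x + \<mu> * - (t x * t x) * H x)
        + (K1 x * (- \<mu> * t x * Ei x) + E x * r x * Ei x)) (at x)"
    proof -
      have "((\<lambda>x. \<mu> * t x * H x) has_vector_derivative (\<mu> * t x * H1 x + \<mu> * - (t x * t x) * H x)) (at x)"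
        by (rule has_vector_derivative_mult[OF has_vector_derivative_mult_right[OF t[OF that]] H[OF that]])
      from has_vector_derivative_add[OF this has_vector_derivative_mult[OF K1[OF that] Ei[OF that]]]
      show ?thesis by (simp add: H1_def[abs_def])
    qed
    moreover have "(\<mu> * t x * H1 x + \<mu> * - (t x * t x) * H x) + (K1 x * (- \<mu> * t x * Ei x) + E x * r x * Ei x)
        = (\<mu> * \<mu> - \<mu>) * (t x * t x) * H x + r x * (E x * Ei x)"
      by (simp add: H1_def algebra_simps)
    moreover have "t x * t x = complex_of_real (inverse ((x - x0)\<^sup>2))"
      by (simp add: t_def power2_eq_square inverse_eq_divide)
    ultimately show ?thesis by (simp add: \<mu> EEi)
  qed
  define h where "h x = Re (H x)" for x
  define h1 where "h1 x = Re (H1 x)" for x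
  have h: "(h has_real_derivative h1 x) (at x)" if "x \<in> I" for x
    using bounded_linear.has_vector_derivative[OF bounded_linear_Re H[OF that]]
    by (simp add: has_real_derivative_iff_has_vector_derivative h_def[abs_def] h1_def)
  have h1: "(h1 has_real_derivative \<kappa> * inverse ((x - x0)\<^sup>2) * h x + r x) (at x)" if "x \<in> I" for x
    using bounded_linear.has_vector_derivative[OF bounded_linear_Re H1[OF that]]
    by (simp add: has_real_derivative_iff_has_vector_derivative h_def h1_def[abs_def] del: of_real_mult of_real_inverse)
  have id: "smooth_on I (\<lambda>x::real. x)" by (rule smooth_on_bounded_linear) (rule bounded_linear_ident)
  have "smooth_on I (\<lambda>x. \<kappa> * inverse ((x - x0)\<^sup>2))"
    using ne by (intro smooth_on_mult smooth_on_inverse smooth_on_power smooth_on_diff smooth_on_const id I(1)) auto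
  then have "smooth_on I h" by (rule smooth_on_linear_ode2[OF I(1) _ r h h1])
  moreover have "h xP = c" by (simp add: h_def H_def K2(1) E0)
  moreover have "deriv (deriv h) x = \<kappa> * inverse ((x - x0)\<^sup>2) * h x + r x" if "x \<in> I" for x
  proof -
    have "(deriv h has_real_derivative \<kappa> * inverse ((x - x0)\<^sup>2) * h x + r x) (at x)"
      by (rule has_field_derivative_transform_within_open[OF h1[OF that] I(1) that])
        (metis h DERIV_imp_deriv)
    then show ?thesis by (rule DERIV_imp_deriv)
  qed
  ultimately show ?thesis by (rule that)
qed

lemma dy_eqI:
  assumes "smooth_on S G" "open W" "W \<subseteq> S" "(x, y) \<in> W"
    "\<And>y'. (x, y') \<in> W \<Longrightarrow> G (x, y') = k y'" "(k has_real_derivative D) (at y)"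
  shows "dy G (x, y) = D"
proof -
  have "((\<lambda>y. G (x, y)) has_real_derivative dy G (x, y)) (at y)"
    using assms(3,4) by (intro has_real_derivative_dy[OF assms(1)]) auto
  then have "(k has_real_derivative dy G (x, y)) (at y)"
    by (rule has_field_derivative_transform_within_open[OF _ open_slice[OF assms(2)]]) (use assms in auto)
  then show ?thesis using assms(6) DERIV_unique by blast
qed

lemma open_column:
  fixes S :: "('a::topological_space \<times> 'b::topological_space) set"
  shows "open S \<Longrightarrow> open {x. (x, y) \<in> S}"
  using open_vimage[of S "\<lambda>x. (x, y)"] by (simp add: vimage_def continuous_on_Pair)

lemma powi_neg2: "x powi (-2) = inverse (x\<^sup>2)" for x :: real
  by (simp add: power_int_minus)

lemma is_interval_ball_real: "is_interval (ball (x::real) e)"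
  by (simp add: is_interval_convex_1)

context walker
begin

text \<open>Two y-derivatives erase the local coefficients \<beta> and \<gamma>, so the local
  descriptions merge into one global formula for u.\<close>

lemma quadratic_form_u:
  assumes "locally_quadratic_form_on M f a x0"
  shows "x0 \<notin> x_image M" and "q \<in> S \<Longrightarrow> u q = 2 * a * inverse ((fst q - x0)\<^sup>2)"
proof -
  show "x0 \<notin> x_image M"
    using assms unfolding locally_quadratic_form_on_def quadratic_form_on_def x_image_def by blast
  assume "q \<in> S"
  then obtain p where p: "p \<in> M" "q = (p $ 1, p $ 2)" by (auto simp: xy_image_def)
  obtain U \<beta> \<gamma> where U: "open U" "p \<in> U" "U \<subseteq> M" and
    f: "\<And>x y. (x, y) \<in> xy_image U \<Longrightarrow> F (x, y) = a * (x - x0) powi (-2) * y\<^sup>2 + \<beta> x * y + \<gamma> x"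
    using assms p(1) unfolding locally_quadratic_form_on_def quadratic_form_on_def by fastforce
  define W where "W = xy_image U"
  have W: "open W" "W \<subseteq> S" "q \<in> W"
    using U open_xy_image p(2) by (auto simp: W_def xy_image_def)
  have 1: "dy F (x, y) = 2 * a * inverse ((x - x0)\<^sup>2) * y + \<beta> x" if "(x, y) \<in> W" for x y
    by (rule dy_eqI[OF smooth_F W(1,2) that, where k = "\<lambda>y. a * (x - x0) powi (-2) * y\<^sup>2 + \<beta> x * y + \<gamma> x"])
      (use f in \<open>auto simp: W_def powi_neg2 intro!: derivative_eq_intros\<close>)
  have "u (x, y) = 2 * a * inverse ((x - x0)\<^sup>2)" if "(x, y) \<in> W" for x y
    by (rule dy_eqI[OF smooth_on_dy[OF smooth_F] W(1,2) that,
          where k = "\<lambda>y. 2 * a * inverse ((x - x0)\<^sup>2) * y + \<beta> x"])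
      (use 1 in \<open>auto intro!: derivative_eq_intros\<close>)
  then show "u q = 2 * a * inverse ((fst q - x0)\<^sup>2)" using W(3) by (cases q) simp
qed

lemma u_depends_on_x:
  assumes "\<And>x y. (x, y) \<in> S \<Longrightarrow> u (x, y) = \<alpha> x" "(x, y) \<in> S"
  shows "dy u (x, y) = 0" and "(\<alpha> has_real_derivative dx u (x, y)) (at x)"
proof -
  show "dy u (x, y) = 0"
    by (rule dy_eqI[OF smooth_u open_S subset_refl assms(2), where k = "\<lambda>_. \<alpha> x"]) (auto simp: assms)
  have "((\<lambda>x. u (x, y)) has_real_derivative dx u (x, y)) (at x)"
    by (rule has_real_derivative_dx[OF smooth_u assms(2)])
  then show "(\<alpha> has_real_derivative dx u (x, y)) (at x)"
    by (rule has_field_derivative_transform_within_open[OF _ open_column[OF open_S, of y]])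
      (use assms in auto)
qed

lemma x_imageE: assumes "x \<in> x_image M" obtains y where "(x, y) \<in> S"
  using assms by (auto simp: x_image_def xy_image_def)

text \<open>u and u_x have degrees -2 and -3 in x - x0. These are matched by d^2 and d^3 when a = 1
  and d is the quotient of the values of x - x0 at P and at Q; since u_y = 0, the shear has no
  effect.\<close>

lemma inverse_square_homothety:
  assumes "x0 \<notin> x_image M" "\<And>q. q \<in> S \<Longrightarrow> u q = b * inverse ((fst q - x0)\<^sup>2)"
  shows "homothety_curvature_homogeneous 1 M (walker_metric f)"
proof (rule homothety_curvature_homogeneousI)
  fix P Q assume "P \<in> M" "Q \<in> M"
  then have S: "(P $ 1, P $ 2) \<in> S" "(Q $ 1, Q $ 2) \<in> S" by (auto intro: xy_imageI)
  have ne: "x \<noteq> x0" if "(x, y) \<in> S" for x y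
    using that assms(1) by (auto simp: x_image_def xy_image_def)
  have u: "u (x, y) = b * inverse ((x - x0)\<^sup>2)" if "(x, y) \<in> S" for x y
    using assms(2)[OF that] by simp
  have y: "dy u (x, y) = 0" if "(x, y) \<in> S" for x y by (rule u_depends_on_x(1)[OF u that])
  have x: "dx u (x, y) = - 2 * b / (x - x0) ^ 3" if "(x, y) \<in> S" for x y
  proof -
    have e: "b * - (inverse (z\<^sup>2) * (2 * z) * inverse (z\<^sup>2)) = - 2 * b / z ^ 3" if "z \<noteq> 0" for z
      using that by (simp add: power2_eq_square power3_eq_cube field_simps)
    have "((\<lambda>x. (x - x0)\<^sup>2) has_real_derivative 2 * (x - x0)) (at x)"
      by (auto intro!: derivative_eq_intros)
    from DERIV_cmult[OF DERIV_inverse'[OF this], of b]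
    have "((\<lambda>x. b * inverse ((x - x0)\<^sup>2)) has_real_derivative - 2 * b / (x - x0) ^ 3) (at x)"
      using ne[OF that] e[of "x - x0"] by simp
    with u_depends_on_x(2)[OF u that] show ?thesis using DERIV_unique by blast
  qed
  let ?d = "(Q $ 1 - x0) / (P $ 1 - x0)"
  have n: "P $ 1 - x0 \<noteq> 0" "Q $ 1 - x0 \<noteq> 0" using ne S by force+
  let ?p = "P $ 1 - x0" let ?q = "Q $ 1 - x0"
  have "b * inverse (?q\<^sup>2) = (inverse ?d)\<^sup>2 * (b * inverse (?p\<^sup>2))"
    using n by (simp add: field_simps)
  moreover have "- 2 * b / ?q ^ 3 = (inverse ?d) ^ 3 * (- 2 * b / ?p ^ 3)"
    using n by (simp add: field_simps)
  ultimately show "\<exists>a d s. a \<noteq> 0 \<and> d \<noteq> 0 \<and>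
    a\<^sup>2 * u (Q $ 1, Q $ 2) = d\<^sup>2 * u (P $ 1, P $ 2) \<and>
    a\<^sup>2 * dy u (Q $ 1, Q $ 2) = d ^ 3 * dy u (P $ 1, P $ 2) \<and>
    a\<^sup>2 * (a * dx u (Q $ 1, Q $ 2) + s * dy u (Q $ 1, Q $ 2)) = d ^ 3 * dx u (P $ 1, P $ 2)"
    using S n by (intro exI[of _ 1] exI[of _ "inverse ?d"] exI[of _ 0]) (simp add: u x y)
qed

text \<open>Homothety \<open>1\<close>-curvature homogeneity makes \<open>\<alpha>'\<^sup>2 / \<alpha>\<^sup>3\<close> constant, i.e. \<open>|\<alpha>|\<close> to the power \<open>-1/2\<close> is affine.\<close>

lemma homothety_inverse_square:
  assumes M: "connected M" "M \<noteq> {}"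
    and u: "\<And>x y. (x, y) \<in> S \<Longrightarrow> u (x, y) = \<alpha> x" and u0: "\<And>q. q \<in> S \<Longrightarrow> u q \<noteq> 0"
    and \<alpha>': "\<And>x. x \<in> x_image M \<Longrightarrow> deriv \<alpha> x \<noteq> 0"
    and hom: "homothety_curvature_homogeneous 1 M (walker_metric f)"
  obtains a x0 where "a \<noteq> 0" "x0 \<notin> x_image M" "\<And>q. q \<in> S \<Longrightarrow> u q = 2 * a * inverse ((fst q - x0)\<^sup>2)"
proof -
  let ?X = "x_image M"
  have X: "open ?X" "connected ?X" by (simp_all add: open_x_image open_M connected_x_image M)
  obtain P where P: "P \<in> M" using M(2) by blast
  define \<alpha>P where "\<alpha>P = \<alpha> (P $ 1)"
  have PS: "(P $ 1, P $ 2) \<in> S" using P by (rule xy_imageI)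
  have d: "(\<alpha> has_real_derivative deriv \<alpha> x) (at x)" and dx: "dx u (x, y) = deriv \<alpha> x"
    if "(x, y) \<in> S" for x y
    using u_depends_on_x(2)[OF u that] DERIV_imp_deriv by metis+
  have nz: "\<alpha> x \<noteq> 0" if "x \<in> ?X" for x
    using that u u0 by (metis x_imageE)
  \<comment> \<open>With this sign \<sigma> \<alpha> = |\<alpha>| on the whole x-range.\<close>
  define \<sigma> where "\<sigma> = sgn \<alpha>P"
  have \<sigma>2: "\<sigma> * \<sigma> = 1" using nz[of "P $ 1"] P by (auto simp: \<sigma>_def \<alpha>P_def x_image_def sgn_if)
  have \<sigma>0: "\<sigma> \<noteq> 0" using \<sigma>2 by auto
  have pos: "\<sigma> * \<alpha> x > 0" if x: "x \<in> ?X" for x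
  proof -
    obtain y where y: "(x, y) \<in> S" using x by (rule x_imageE)
    have "\<alpha> x / \<alpha>P > 0"
      using u_same_sign[OF M(1) u0 y PS] u[OF y] u[OF PS] by (simp add: \<alpha>P_def)
    then show ?thesis by (auto simp: \<sigma>_def zero_less_divide_iff sgn_if)
  qed
  define \<kappa> where "\<kappa> = (deriv \<alpha> (P $ 1))\<^sup>2 / (\<sigma> * \<alpha>P) ^ 3"
  have \<kappa>: "(deriv \<alpha> x)\<^sup>2 = \<kappa> * (\<sigma> * \<alpha> x) ^ 3" if x: "x \<in> ?X" for x
  proof -
    obtain y where y: "(x, y) \<in> S" using x by (rule x_imageE)
    then obtain Q where Q: "Q \<in> M" "Q $ 1 = x" "Q $ 2 = y" by (auto simp: xy_image_def)
    obtain a d where ad: "a \<noteq> 0" "d \<noteq> 0" "a\<^sup>2 * \<alpha> x = d\<^sup>2 * \<alpha>P" "a\<^sup>2 * (a * deriv \<alpha> x) = d ^ 3 * deriv \<alpha> (P $ 1)"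
      by (rule homothety_curvature_homogeneousD[OF hom order_refl P Q(1) u0[OF PS]])
        (simp add: Q u[OF y] u[OF PS] \<alpha>P_def dx[OF y] dx[OF PS] u_depends_on_x(1)[OF u y] u_depends_on_x(1)[OF u PS])
    \<comment> \<open>The square of the equation for \<alpha>' and the cube of that for \<alpha>
      carry the same factors a^6 and d^6, so both unknowns drop out.\<close>
    have "(a ^ 3 * deriv \<alpha> x)\<^sup>2 = (d ^ 3 * deriv \<alpha> (P $ 1))\<^sup>2"
      using ad(4) by (simp add: power3_eq_cube power2_eq_square mult.assoc)
    then have "a ^ 6 * (deriv \<alpha> x)\<^sup>2 = d ^ 6 * (deriv \<alpha> (P $ 1))\<^sup>2"
      by (simp add: power_mult_distrib power_mult[symmetric])
    moreover have "(a\<^sup>2 * (\<sigma> * \<alpha> x)) ^ 3 = (d\<^sup>2 * (\<sigma> * \<alpha>P)) ^ 3"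
      using ad(3) by (simp add: algebra_simps)
    then have "a ^ 6 * (\<sigma> * \<alpha> x) ^ 3 = d ^ 6 * (\<sigma> * \<alpha>P) ^ 3"
      by (simp add: power_mult_distrib power_mult[symmetric])
    moreover have "\<sigma> * \<alpha>P > 0" using pos[of "P $ 1"] P by (simp add: \<alpha>P_def x_image_def)
    then have "\<sigma> * \<alpha>P \<noteq> 0" by linarith
    then have "(\<sigma> * \<alpha>P) ^ 3 \<noteq> 0" by (rule power_not_zero)
    then have "(deriv \<alpha> (P $ 1))\<^sup>2 = \<kappa> * (\<sigma> * \<alpha>P) ^ 3" by (simp add: \<kappa>_def)
    ultimately have "a ^ 6 * (deriv \<alpha> x)\<^sup>2 = a ^ 6 * (\<kappa> * (\<sigma> * \<alpha> x) ^ 3)"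
      by (metis mult.left_commute)
    then show ?thesis using ad(1) by simp
  qed
  \<comment> \<open>w = |\<alpha>|^(-1/2), whose derivative - \<sigma> \<alpha>' / (2
    |\<alpha>|^(3/2)) has the constant square \<kappa> / 4.\<close>
  define w where "w x = 1 / sqrt (\<sigma> * \<alpha> x)" for x
  define w' where "w' x = - (\<sigma> * deriv \<alpha> x) / (2 * (\<sigma> * \<alpha> x) * sqrt (\<sigma> * \<alpha> x))" for x
  have w: "(w has_real_derivative w' x) (at x)" if x: "x \<in> ?X" for x
  proof -
    obtain y where y: "(x, y) \<in> S" using x by (rule x_imageE)
    have D: "((\<lambda>x. sqrt (\<sigma> * \<alpha> x)) has_real_derivative \<sigma> * deriv \<alpha> x * inverse (sqrt (\<sigma> * \<alpha> x)) / 2) (at x)"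
      using pos[OF x] d[OF y] by (auto intro!: derivative_eq_intros)
    have s: "sqrt (\<sigma> * \<alpha> x) > 0" "\<sigma> * \<alpha> x = sqrt (\<sigma> * \<alpha> x) * sqrt (\<sigma> * \<alpha> x)"
      using pos[OF x] by simp_all
    have "((\<lambda>x. inverse (sqrt (\<sigma> * \<alpha> x))) has_real_derivative
      - (inverse (sqrt (\<sigma> * \<alpha> x)) * (\<sigma> * deriv \<alpha> x * inverse (sqrt (\<sigma> * \<alpha> x)) / 2)
        * inverse (sqrt (\<sigma> * \<alpha> x)))) (at x)"
      by (rule DERIV_inverse'[OF D]) (use s(1) in linarith)
    moreover have "- (inverse r * (b * inverse r / 2) * inverse r) = - b / (2 * (r * r) * r)" if "r > 0" for r b :: real
      using that by (simp add: field_simps)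
    ultimately show ?thesis
      using s by (simp only: w_def[abs_def] w'_def inverse_eq_divide)
  qed
  have w2: "(w' x)\<^sup>2 = \<kappa> / 4" if x: "x \<in> ?X" for x
  proof -
    have s: "(sqrt (\<sigma> * \<alpha> x))\<^sup>2 = \<sigma> * \<alpha> x" using pos[OF x] by simp
    have "(w' x)\<^sup>2 = (\<sigma> * \<sigma>) * (deriv \<alpha> x)\<^sup>2 / (4 * (\<sigma> * \<alpha> x)\<^sup>2 * (sqrt (\<sigma> * \<alpha> x))\<^sup>2)"
      by (simp only: w'_def power_divide power_mult_distrib power2_minus) (simp add: power2_eq_square)
    also have "\<dots> = \<kappa> * (\<sigma> * \<alpha> x) ^ 3 / (4 * (\<sigma> * \<alpha> x) ^ 3)"
      unfolding s \<sigma>2 \<kappa>[OF x] by (simp add: power2_eq_square power3_eq_cube mult.assoc)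
    finally show ?thesis using pos[OF x] by (auto split: if_splits)
  qed
  \<comment> \<open>Near x the derivative of \<alpha> is u_x along a line of fixed height, which is
    how its continuity is known.\<close>
  have cont: "isCont (deriv \<alpha>) x" if x: "x \<in> ?X" for x
  proof -
    obtain y where y: "(x, y) \<in> S" using x by (rule x_imageE)
    have c: "isCont (\<lambda>x. dx u (x, y)) x"
      using has_real_derivative_dx[OF smooth_on_dx[OF smooth_u] y] by (rule DERIV_isCont)
    have "eventually (\<lambda>x. dx u (x, y) = deriv \<alpha> x) (nhds x)"
      using eventually_nhds_in_open[OF open_column[OF open_S, of y], of x] y
      by (auto elim!: eventually_mono simp: dx)
    from isCont_cong[OF this] c show ?thesis by simp
  qed
  have wc: "connected (w' ` ?X)"
  proof (rule connected_continuous_image[OF continuous_at_imp_continuous_on X(2)], rule ballI)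
    fix x assume x: "x \<in> ?X"
    then obtain y where y: "(x, y) \<in> S" by (rule x_imageE)
    show "isCont w' x"
      unfolding w'_def using cont[OF x] nz[OF x] \<sigma>0 DERIV_isCont[OF d[OF y]]
      by (auto intro!: continuous_intros)
  qed
  have PX: "P $ 1 \<in> ?X" using P by (auto simp: x_image_def)
  define k where "k = w' (P $ 1)"
  have k0: "k \<noteq> 0" using \<alpha>'[OF PX] pos[OF PX] by (auto simp: k_def w'_def)
  \<comment> \<open>A continuous function on a connected set with constant square and without zeros
    cannot change from k to - k; zeros of w' would be zeros of \<alpha>'.\<close>
  have wk: "w' x = k" if x: "x \<in> ?X" for x
  proof (rule ccontr)
    assume "w' x \<noteq> k"
    moreover have "(w' x)\<^sup>2 = k\<^sup>2" using w2[OF x] w2[OF PX] by (simp add: k_def)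
    ultimately have mk: "w' x = - k" by (auto simp: power2_eq_iff)
    let ?A = "w' ` ?X"
    have A: "is_interval ?A" using wc by (simp add: is_interval_connected_1)
    have "w' x \<in> ?A" using x by (rule imageI)
    then have m: "- k \<in> ?A" by (simp only: mk)
    have "w' (P $ 1) \<in> ?A" using PX by (rule imageI)
    then have p: "k \<in> ?A" by (simp only: k_def)
    have "0 \<in> ?A"
    proof (cases "k > 0")
      case True
      then show ?thesis by (intro mem_is_interval_1_I[OF A m p]) linarith+
    next
      case False
      then show ?thesis by (intro mem_is_interval_1_I[OF A p m]) linarith+
    qed
    then obtain x' where x': "x' \<in> ?X" "w' x' = 0" by (metis imageE)
    then have "deriv \<alpha> x' = 0" using nz[OF x'(1)] \<sigma>0 pos[OF x'(1)] by (simp add: w'_def)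
    then show False using \<alpha>' x'(1) by blast
  qed
  have conv: "convex ?X" using X(2) by (simp add: is_interval_convex_1[symmetric] is_interval_connected_1)
  have "\<exists>c. \<forall>x\<in>?X. w x - k * x = c"
  proof (rule has_field_derivative_zero_constant[OF conv])
    fix x assume x: "x \<in> ?X"
    have "((\<lambda>x. w x - k * x) has_real_derivative w' x - k * 1) (at x)"
      by (intro DERIV_diff DERIV_cmult DERIV_ident w x)
    then show "((\<lambda>x. w x - k * x) has_real_derivative 0) (at x within ?X)"
      using wk[OF x] by (simp add: has_field_derivative_at_within)
  qed
  then obtain c where c: "w x = k * x + c" if "x \<in> ?X" for x by (force simp: algebra_simps)
  define x0 where "x0 = - c / k"
  have wx: "w x = k * (x - x0)" if "x \<in> ?X" for x
    using c[OF that] k0 by (simp add: x0_def algebra_simps)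
  have wpos: "w x > 0" if "x \<in> ?X" for x using pos[OF that] by (simp add: w_def)
  show ?thesis
  \<comment> \<open>From |\<alpha>| = 1 / w^2 and w = k (x - x0) the coefficient 2 a is \<sigma> /
    k^2.\<close>
  proof (rule that[of "\<sigma> / (2 * k\<^sup>2)" x0])
    show "\<sigma> / (2 * k\<^sup>2) \<noteq> 0" using \<sigma>2 k0 by auto
    show "x0 \<notin> ?X" using wx[of x0] wpos[of x0] by auto
    fix q assume q: "q \<in> S"
    then obtain x y where xy: "q = (x, y)" by (cases q)
    have x: "x \<in> ?X" using q by (auto simp: xy x_image_def xy_image_def)
    have "\<sigma> * \<alpha> x = 1 / (w x)\<^sup>2" using pos[OF x] by (simp add: w_def power_divide)
    then have "\<sigma> * \<sigma> * \<alpha> x = \<sigma> / (k * (x - x0))\<^sup>2" using wx[OF x] by (simp add: mult.assoc)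
    then have "\<alpha> x = \<sigma> / (k * (x - x0))\<^sup>2" by (simp only: \<sigma>2 mult_1)
    moreover have "u q = \<alpha> x" using u[of x y] q by (simp only: xy)
    ultimately show "u q = 2 * (\<sigma> / (2 * k\<^sup>2)) * inverse ((fst q - x0)\<^sup>2)"
      by (simp only: xy fst_conv power_mult_distrib divide_inverse inverse_mult_distrib) simp
  qed
qed

end

section \<open>Normal form and local homogeneity of quadratic profiles\<close>

context walker
begin

lemma affine_in_y:
  assumes u: "\<And>x y. (x, y) \<in> S \<Longrightarrow> u (x, y) = \<alpha> x"
    and J: "is_interval J" "\<And>y. y \<in> J \<Longrightarrow> (x, y) \<in> S" and y: "y \<in> J" "y0 \<in> J"
  shows "dy F (x, y) = dy F (x, y0) + \<alpha> x * (y - y0)"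
    and "F (x, y) = F (x, y0) + dy F (x, y0) * (y - y0) + \<alpha> x * (y - y0)\<^sup>2 / 2"
proof -
  have 1: "dy F (x, y) = dy F (x, y0) + \<alpha> x * (y - y0)" if y: "y \<in> J" for y
  proof -
    have "((\<lambda>y. dy F (x, y) - \<alpha> x * (y - y0)) has_real_derivative 0) (at y)" if y: "y \<in> J" for y
      using has_real_derivative_dy[OF smooth_on_dy[OF smooth_F] J(2)[OF y]] u[OF J(2)[OF y]]
      by (auto intro!: derivative_eq_intros)
    from interval_constant[OF J(1) this y \<open>y0 \<in> J\<close>] show ?thesis by simp
  qed
  then show "dy F (x, y) = dy F (x, y0) + \<alpha> x * (y - y0)" using y by blast
  have "((\<lambda>y. F (x, y) - dy F (x, y0) * (y - y0) - \<alpha> x * (y - y0)\<^sup>2 / 2) has_real_derivative 0) (at y)"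
    if y: "y \<in> J" for y
    using has_real_derivative_dy[OF smooth_F J(2)[OF y]] 1[OF y]
    by (auto intro!: derivative_eq_intros)
  from interval_constant[OF J(1) this y]
  show "F (x, y) = F (x, y0) + dy F (x, y0) * (y - y0) + \<alpha> x * (y - y0)\<^sup>2 / 2" by simp
qed

text \<open>On a connected slice f is a single quadratic polynomial in y, so \<beta> and \<gamma> do
  not depend on the base height. This compensates for the arbitrary, possibly discontinuous choice
  \<open>Y\<close>: near a given x both can be computed at one fixed height, where they are visibly
  smooth.\<close>

lemma quadratic_form_on_slices:
  assumes U: "open U" "U \<subseteq> M" "connected_y_slices U" and x0: "x0 \<notin> x_image U"
    and u: "\<And>q. q \<in> S \<Longrightarrow> u q = 2 * a * inverse ((fst q - x0)\<^sup>2)"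
  shows "quadratic_form_on U f a x0"
proof -
  let ?W = "xy_image U"
  have W: "open ?W" "?W \<subseteq> S" using U(1,2) open_xy_image by (auto simp: xy_image_def)
  define \<alpha> where "\<alpha> x = 2 * a * inverse ((x - x0)\<^sup>2)" for x
  have u': "u (x, y) = \<alpha> x" if "(x, y) \<in> S" for x y using u[OF that] by (simp add: \<alpha>_def)
  define Y where "Y x = (SOME y. (x, y) \<in> ?W)" for x
  have Y: "(x, Y x) \<in> ?W" if "(x, y) \<in> ?W" for x y
    unfolding Y_def using that by (rule someI)
  define \<beta> where "\<beta> x = dy F (x, Y x) - \<alpha> x * Y x" for x
  define \<gamma> where "\<gamma> x = F (x, Y x) - \<alpha> x * (Y x)\<^sup>2 / 2 - \<beta> x * Y x" for x
  have slice: "is_interval {y. (x, y) \<in> ?W}" for x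
    using U(3) by (simp add: connected_y_slices_def is_interval_connected_1)
  have aff: "dy F (x, y) = dy F (x, Y x) + \<alpha> x * (y - Y x)"
    "F (x, y) = F (x, Y x) + dy F (x, Y x) * (y - Y x) + \<alpha> x * (y - Y x)\<^sup>2 / 2" if "(x, y) \<in> ?W" for x y
    using affine_in_y[of \<alpha> "{y. (x, y) \<in> ?W}" x y "Y x"] u' slice W(2) that Y[OF that] by blast+
  have \<beta>: "\<beta> x = dy F (x, y) - \<alpha> x * y" if "(x, y) \<in> ?W" for x y
    using aff(1)[OF that] by (simp add: \<beta>_def algebra_simps)
  have \<gamma>: "\<gamma> x = F (x, y) - \<alpha> x * y\<^sup>2 / 2 - \<beta> x * y" if "(x, y) \<in> ?W" for x y
    unfolding \<gamma>_def \<beta>_def aff(2)[OF that] by (simp add: field_simps power2_eq_square)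
  have id: "smooth_on B (\<lambda>x::real. x)" for B by (rule smooth_on_bounded_linear) (rule bounded_linear_ident)
  have s\<alpha>: "smooth_on B \<alpha>" if "open B" "x0 \<notin> B" for B
    unfolding \<alpha>_def using that
    by (intro smooth_on_mult smooth_on_inverse smooth_on_power smooth_on_diff smooth_on_const id) auto
  have loc: "\<exists>B. x \<in> B \<and> open B \<and> smooth_on B \<beta> \<and> smooth_on B \<gamma>" if x: "x \<in> x_image U" for x
  proof -
    obtain y where y: "(x, y) \<in> ?W" using x by (auto simp: x_image_def xy_image_def)
    define B where "B = {x. (x, y) \<in> ?W}"
    have B: "open B" "x \<in> B" using open_column[OF W(1)] y by (auto simp: B_def)
    have xB: "x0 \<notin> B" using x0 by (auto simp: B_def x_image_def xy_image_def)
    have c: "smooth_on B (\<lambda>x. G (x, y))" if "smooth_on S G" for G :: "real \<times> real \<Rightarrow> real"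
      by (intro smooth_on_compose[OF B(1) open_S that] smooth_on_Pair smooth_on_const id B(1))
        (use W(2) in \<open>auto simp: B_def\<close>)
    have "smooth_on B (\<lambda>x. dy F (x, y) - \<alpha> x * y)"
      by (intro smooth_on_diff smooth_on_mult smooth_on_const s\<alpha> c smooth_on_dy smooth_F B(1) xB)
    then have sb: "smooth_on B \<beta>" by (rule smooth_on_cong[OF B(1), rotated]) (auto simp: B_def \<beta>)
    have "smooth_on B (\<lambda>x. F (x, y) - \<alpha> x * (y\<^sup>2 / 2) - \<beta> x * y)"
      by (intro smooth_on_diff smooth_on_mult smooth_on_const s\<alpha> c smooth_F B(1) xB sb)
    then have "smooth_on B \<gamma>" by (rule smooth_on_cong[OF B(1), rotated]) (auto simp: B_def \<gamma>)
    with B sb show ?thesis by blast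
  qed
  have "smooth_on (x_image U) \<beta>" "smooth_on (x_image U) \<gamma>"
    by (rule smooth_on_local, use loc in blast)+
  moreover have "f x y = a * (x - x0) powi (-2) * y\<^sup>2 + \<beta> x * y + \<gamma> x" if "(x, y) \<in> ?W" for x y
    using \<gamma>[OF that] by (simp add: powi_neg2 \<alpha>_def)
  ultimately show ?thesis unfolding quadratic_form_on_def using x0 by blast
qed

text \<open>The shadow of a ball is convex and therefore has connected y-slices, so the slice
  argument applies to the ball with the global a and x0.\<close>

lemma locally_quadratic_form_onI:
  assumes "x0 \<notin> x_image M" and u: "\<And>q. q \<in> S \<Longrightarrow> u q = 2 * a * inverse ((fst q - x0)\<^sup>2)"
  shows "locally_quadratic_form_on M f a x0"
  unfolding locally_quadratic_form_on_def
proof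
  fix P assume "P \<in> M"
  then obtain e where e: "e > 0" "ball P e \<subseteq> M" using open_M open_contains_ball by blast
  have "connected {y. (x, y) \<in> xy_image (ball P e)}" for x
  proof -
    have c: "convex (xy_image (ball P e))"
      unfolding xy_image_def
      by (rule convex_linear_image) (auto intro: linearI)
    have "(1 - t) *\<^sub>R y + t *\<^sub>R z \<in> {y. (x, y) \<in> xy_image (ball P e)}"
      if "y \<in> {y. (x, y) \<in> xy_image (ball P e)}" "z \<in> {y. (x, y) \<in> xy_image (ball P e)}" "0 \<le> t" "t \<le> 1" for y z t
    proof -
      have "(1 - t) *\<^sub>R (x, y) + t *\<^sub>R (x, z) = (x, (1 - t) *\<^sub>R y + t *\<^sub>R z)"
        by (simp add: algebra_simps)
      with convexD_alt[OF c, of "(x, y)" "(x, z)" t] that show ?thesis by simp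
    qed
    then have "convex {y. (x, y) \<in> xy_image (ball P e)}"
      unfolding convex_alt by blast
    then show ?thesis by (rule convex_connected)
  qed
  then have "connected_y_slices (ball P e)" by (simp add: connected_y_slices_def)
  moreover have "x0 \<notin> x_image (ball P e)" using e(2) assms(1) by (auto simp: x_image_def)
  ultimately have "quadratic_form_on (ball P e) f a x0"
    using e(2) u by (intro quadratic_form_on_slices) auto
  then show "\<exists>U. open U \<and> P \<in> U \<and> U \<subseteq> M \<and> quadratic_form_on U f a x0"
    using e by (intro exI[of _ "ball P e"]) auto
qed

text \<open>The map x to l x + x1 fixes x0 and carries the abscissa of P to that of Q. Since
  \<alpha> has degree -2 in x - x0, it satisfies l^2 \<alpha>(l x + x1) = \<alpha>(x), and the
  quadratic parts agree. Matching the affine parts by a shear y + h(x) is an Euler equation for h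
  with prescribed value at P.\<close>

lemma inverse_square_locally_homogeneous:
  assumes "connected M" and x0: "x0 \<notin> x_image M"
    and u: "\<And>q. q \<in> S \<Longrightarrow> u q = 2 * a * inverse ((fst q - x0)\<^sup>2)"
  shows "locally_homogeneous M (walker_metric f)"
  unfolding locally_homogeneous_def
proof (intro ballI)
  fix P Q assume P: "P \<in> M" and Q: "Q \<in> M"
  define \<alpha> where "\<alpha> x = 2 * a * inverse ((x - x0)\<^sup>2)" for x
  have u': "u (x, y) = \<alpha> x" if "(x, y) \<in> S" for x y using u[OF that] by (simp add: \<alpha>_def)
  have PS: "(P $ 1, P $ 2) \<in> S" and QS: "(Q $ 1, Q $ 2) \<in> S" using P Q by (auto intro: xy_imageI)
  obtain d where d: "d > 0" "ball (P $ 1) d \<times> ball (P $ 2) d \<subseteq> S"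
    using open_contains_square[OF open_S PS] .
  obtain e where e: "e > 0" "ball (Q $ 1) e \<times> ball (Q $ 2) e \<subseteq> S"
    using open_contains_square[OF open_S QS] .
  have ne: "x \<noteq> x0" if "(x, y) \<in> S" for x y
    using that x0 by (auto simp: x_image_def xy_image_def)
  define l where "l = (Q $ 1 - x0) / (P $ 1 - x0)"
  have l: "l \<noteq> 0" using ne[OF PS] ne[OF QS] by (simp add: l_def)
  define x1 where "x1 = x0 - l * x0"
  have lP: "l * P $ 1 + x1 = Q $ 1"
  proof -
    have "l * (P $ 1 - x0) = Q $ 1 - x0" using ne[OF PS] by (simp add: l_def)
    then show ?thesis by (simp add: x1_def algebra_simps)
  qed
  have l\<alpha>: "l\<^sup>2 * \<alpha> (l * x + x1) = \<alpha> x" for x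
  proof -
    have "l * x + x1 - x0 = l * (x - x0)" by (simp add: x1_def algebra_simps)
    then show ?thesis using l by (simp add: \<alpha>_def power_mult_distrib)
  qed
  define d' where "d' = min d (e / \<bar>l\<bar>)"
  have d': "d' > 0" using d e l by (simp add: d'_def)
  define I where "I = ball (P $ 1) d'"
  have I: "open I" "is_interval I" "P $ 1 \<in> I" "I \<subseteq> ball (P $ 1) d"
    using d' by (auto simp: I_def is_interval_ball_real d'_def)
  have lI: "l * x + x1 \<in> ball (Q $ 1) e" if "x \<in> I" for x
  proof -
    have "l * x + x1 - Q $ 1 = l * (x - P $ 1)" using lP by (simp add: algebra_simps)
    then have "\<bar>l * x + x1 - Q $ 1\<bar> = \<bar>l\<bar> * \<bar>x - P $ 1\<bar>" by (simp add: abs_mult)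
    also have "\<dots> < \<bar>l\<bar> * (e / \<bar>l\<bar>)"
      using that l by (intro mult_strict_left_mono) (auto simp: I_def d'_def dist_real_def)
    finally show ?thesis using l by (simp add: dist_real_def abs_minus_commute)
  qed
  have IS: "(x, y) \<in> S" if "x \<in> I" "y \<in> ball (P $ 2) d" for x y using that I(4) d(2) by blast
  have JS: "(l * x + x1, y) \<in> S" if "x \<in> I" "y \<in> ball (Q $ 2) e" for x y using that lI e(2) by blast
  have xI: "x0 \<notin> I" using IS[of x0 "P $ 2"] d(1) ne by auto
  \<comment> \<open>What remains of f_y(x, y) - l^2 f_y(l x + x1, y + h) once both terms are
    expanded around the heights of P and Q and - \<alpha> h is split off.\<close>
  define r where "r x = dy F (x, P $ 2) - l\<^sup>2 * dy F (l * x + x1, Q $ 2) + \<alpha> x * (Q $ 2 - P $ 2)" for x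
  have id: "smooth_on I (\<lambda>x::real. x)" by (rule smooth_on_bounded_linear) (rule bounded_linear_ident)
  have "smooth_on I r"
    unfolding r_def \<alpha>_def using xI d(1) e(1)
    by (intro smooth_on_add smooth_on_diff smooth_on_mult smooth_on_inverse smooth_on_power smooth_on_const I(1) id
        smooth_on_compose[OF I(1) open_S smooth_on_dy[OF smooth_F]] smooth_on_Pair IS JS) auto
  from euler_ode_solution[OF I(1-3) xI this, of "Q $ 2 - P $ 2" "- 2 * a"]
  obtain h where h: "smooth_on I h" "h (P $ 1) = Q $ 2 - P $ 2" and
    ode: "\<And>x. x \<in> I \<Longrightarrow> deriv (deriv h) x = - 2 * a * inverse ((x - x0)\<^sup>2) * h x + r x" by blast
  have "isCont h (P $ 1)"
    using smooth_on_continuous_on[OF h(1)] continuous_on_eq_continuous_at[OF I(1)] I(3) by blast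
  then obtain d2 where d2: "d2 > 0" "\<And>x. dist x (P $ 1) < d2 \<Longrightarrow> dist (h x) (h (P $ 1)) < e / 2"
    unfolding continuous_at_eps_delta using e(1) by (meson half_gt_zero)
  \<comment> \<open>The shift h and the height y each get half of e, so that the image stays in the
    square around Q.\<close>
  define I' where "I' = ball (P $ 1) (min d' d2)"
  define J where "J = ball (P $ 2) (min d (e / 2))"
  have I': "open I'" "is_interval I'" "P $ 1 \<in> I'" "I' \<subseteq> I"
    using d' d2(1) by (auto simp: I'_def I_def is_interval_ball_real)
  have J: "open J" "is_interval J" "P $ 2 \<in> J" "J \<subseteq> ball (P $ 2) d"
    using d(1) e(1) by (auto simp: J_def is_interval_ball_real)
  have hJ: "1 * y + h x \<in> ball (Q $ 2) e" if "x \<in> I'" "y \<in> J" for x y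
  proof -
    have "dist (h x) (Q $ 2 - P $ 2) < e / 2" using d2(2)[of x] that h(2) by (simp add: I'_def dist_commute)
    moreover have "dist y (P $ 2) < e / 2" using that by (simp add: J_def dist_commute)
    ultimately show ?thesis by (simp add: dist_real_def abs_if split: if_splits)
  qed
  show "locally_isometric_at M (walker_metric f) P M (walker_metric f) Q"
  proof (rule locally_isometric_at_walker[where ?x1.0 = x1 and \<mu> = 1 and h = h,
        OF open_M open_M P Q I'(1-3) J(1-3) _ open_S smooth_F _ l])
    show "smooth_on (I' \<times> J) F"
      by (rule smooth_on_subset[OF smooth_F]) (use IS I'(4) J(4) in blast)
    show "(1::real)\<^sup>2 = 1" by simp
    show "smooth_on I' h" by (rule smooth_on_subset[OF h(1) I'(4)])
    show "Q $ 1 = l * P $ 1 + x1" "Q $ 2 = 1 * P $ 2 + h (P $ 1)" using lP h(2) by simp_all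
    fix x y assume x: "x \<in> I'" and y: "y \<in> J"
    have xI: "x \<in> I" using x I'(4) by blast
    show "(l * x + x1, 1 * y + h x) \<in> S" using JS[OF xI hJ[OF x y]] .
    have 1: "dy F (x, y) = dy F (x, P $ 2) + \<alpha> x * (y - P $ 2)"
      by (rule affine_in_y(1)[where J = "ball (P $ 2) d", OF u'])
        (use IS[OF xI] y J(4) d(1) in \<open>auto simp: is_interval_ball_real\<close>)
    have 2: "dy F (l * x + x1, 1 * y + h x) = dy F (l * x + x1, Q $ 2) + \<alpha> (l * x + x1) * (1 * y + h x - Q $ 2)"
      by (rule affine_in_y(1)[where J = "ball (Q $ 2) e", OF u'])
        (use JS[OF xI] hJ[OF x y] e(1) in \<open>auto simp: is_interval_ball_real\<close>)
    have 3: "deriv (deriv h) x = - \<alpha> x * h x + r x" using ode[OF xI] by (simp add: \<alpha>_def)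
    have "l\<^sup>2 * dy F (l * x + x1, 1 * y + h x) =
        l\<^sup>2 * dy F (l * x + x1, Q $ 2) + \<alpha> x * (y + h x - Q $ 2)"
      unfolding 2 by (simp add: l\<alpha>[of x, symmetric] algebra_simps)
    then show "dy F (x, y) = l\<^sup>2 * 1 * dy F (l * x + x1, 1 * y + h x) + 1 * deriv (deriv h) x"
      unfolding 1 3 r_def by (simp add: algebra_simps)
  qed
qed

end


section \<open>Homothety 2-curvature homogeneity\<close>

lemma dx_mult:
  fixes A B :: "real \<times> real \<Rightarrow> real"
  assumes "smooth_on S A" "smooth_on S B" "q \<in> S"
  shows "dx (\<lambda>q. A q * B q) q = A q * dx B q + dx A q * B q"
  using fun_cong[OF frechet_derivative_at[OF has_derivative_mult[OF
          smooth_on_has_derivative[OF assms(1,3)] smooth_on_has_derivative[OF assms(2,3)]]], of "(1, 0)"]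
  by (simp add: dx_def)

lemma dy_mult:
  fixes A B :: "real \<times> real \<Rightarrow> real"
  assumes "smooth_on S A" "smooth_on S B" "q \<in> S"
  shows "dy (\<lambda>q. A q * B q) q = A q * dy B q + dy A q * B q"
  using fun_cong[OF frechet_derivative_at[OF has_derivative_mult[OF
          smooth_on_has_derivative[OF assms(1,3)] smooth_on_has_derivative[OF assms(2,3)]]], of "(0, 1)"]
  by (simp add: dy_def)

lemma dx_divide:
  fixes A B :: "real \<times> real \<Rightarrow> real"
  assumes "smooth_on S A" "smooth_on S B" "q \<in> S" "B q \<noteq> 0"
  shows "dx (\<lambda>q. A q / B q) q = (dx A q * B q - A q * dx B q) / (B q)\<^sup>2"
  using fun_cong[OF frechet_derivative_at[OF has_derivative_divide'[OF
          smooth_on_has_derivative[OF assms(1,3)] smooth_on_has_derivative[OF assms(2,3)] assms(4)]], of "(1, 0)"]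
  by (simp add: dx_def power2_eq_square)

lemma dy_divide:
  fixes A B :: "real \<times> real \<Rightarrow> real"
  assumes "smooth_on S A" "smooth_on S B" "q \<in> S" "B q \<noteq> 0"
  shows "dy (\<lambda>q. A q / B q) q = (dy A q * B q - A q * dy B q) / (B q)\<^sup>2"
  using fun_cong[OF frechet_derivative_at[OF has_derivative_divide'[OF
          smooth_on_has_derivative[OF assms(1,3)] smooth_on_has_derivative[OF assms(2,3)] assms(4)]], of "(0, 1)"]
  by (simp add: dy_def power2_eq_square)

lemma dy_diff:
  fixes A B :: "real \<times> real \<Rightarrow> real"
  assumes "smooth_on S A" "smooth_on S B" "q \<in> S"
  shows "dy (\<lambda>q. A q - B q) q = dy A q - dy B q"
  using fun_cong[OF frechet_derivative_at[OF has_derivative_diff[OF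
          smooth_on_has_derivative[OF assms(1,3)] smooth_on_has_derivative[OF assms(2,3)]]], of "(0, 1)"]
  by (simp add: dy_def)

lemma dx_const: "dx (\<lambda>_. c) q = 0" and dy_const: "dy (\<lambda>_. c) q = 0"
  by (simp_all add: dx_def dy_def)

lemma constant_if_dx_dy_zero:
  assumes "open S" "connected S" "smooth_on S G"
    "\<And>q. q \<in> S \<Longrightarrow> dx G q = 0" "\<And>q. q \<in> S \<Longrightarrow> dy G q = 0" "p \<in> S" "q \<in> S"
  shows "G p = G q"
  by (rule has_derivative_zero_unique_connected[OF assms(1,2) _ assms(6,7)])
    (use has_derivative_dx_dy[OF assms(3)] assms(4,5) in simp)

text \<open>Eliminating \<open>a\<close>, \<open>d\<close>, \<open>s\<close> from the transformation rules leaves three invariants of weight zero.\<close>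

lemma homothety_2_invariants:
  fixes a d s \<epsilon> :: real
  assumes a: "a \<noteq> 0" and \<epsilon>: "\<epsilon>\<^sup>2 = 1"
    and 0: "a\<^sup>2 * U = d\<^sup>2 * p0"
    and y: "a\<^sup>2 * (\<epsilon> * Uy) = d ^ 3 * py"
    and x: "a\<^sup>2 * (a * Ux + s * Uy) = d ^ 3 * px"
    and yy: "a\<^sup>2 * Uyy = d ^ 4 * pyy"
    and xy: "a\<^sup>2 * (\<epsilon> * (a * Uxy + s * Uyy)) = d ^ 4 * pxy"
    and xx: "a\<^sup>2 * (a\<^sup>2 * Uxx + 2 * a * s * Uxy + s\<^sup>2 * Uyy) = d ^ 4 * pxx"
    and p: "p0 \<noteq> 0" "py \<noteq> 0"
  shows "U * Uyy = p0 * pyy / py\<^sup>2 * Uy\<^sup>2"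
    and "(Uxy * Uy - Ux * Uyy)\<^sup>2 = (pxy * py - px * pyy)\<^sup>2 / (p0 * py ^ 4) * (U * Uy ^ 4)"
    and "Uxx * Uy\<^sup>2 - 2 * Ux * Uy * Uxy + Ux\<^sup>2 * Uyy =
      (pxx * py\<^sup>2 - 2 * px * py * pxy + px\<^sup>2 * pyy) / (p0\<^sup>2 * py\<^sup>2) * (U\<^sup>2 * Uy\<^sup>2)"
proof -
  have y2: "a ^ 4 * Uy\<^sup>2 = d ^ 6 * py\<^sup>2"
  proof -
    have "a ^ 4 * Uy\<^sup>2 = (a\<^sup>2 * (\<epsilon> * Uy))\<^sup>2" using \<epsilon> by algebra
    also have "\<dots> = d ^ 6 * py\<^sup>2" unfolding y by algebra
    finally show ?thesis .
  qed
  have "a ^ 4 * (U * Uyy) = (a\<^sup>2 * U) * (a\<^sup>2 * Uyy)" by algebra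
  also have "\<dots> = p0 * pyy / py\<^sup>2 * (d ^ 6 * py\<^sup>2)" unfolding 0 yy using p by (simp add: field_simps)
  also have "\<dots> = a ^ 4 * (p0 * pyy / py\<^sup>2 * Uy\<^sup>2)" unfolding y2[symmetric] by simp
  finally show "U * Uyy = p0 * pyy / py\<^sup>2 * Uy\<^sup>2" by (rule iffD1[OF mult_left_cancel[OF power_not_zero[OF a]]])
  \<comment> \<open>The bracket is Hess u on \<partial>y and the field X = u_y \<partial>x - u_x
    \<partial>y tangent to the level curves of u; the shear cancels.\<close>
  have D: "a ^ 5 * (Uxy * Uy - Ux * Uyy) = d ^ 7 * (pxy * py - px * pyy)"
  proof -
    have "a ^ 5 * (Uxy * Uy - Ux * Uyy) =
      (a\<^sup>2 * (\<epsilon> * (a * Uxy + s * Uyy))) * (a\<^sup>2 * (\<epsilon> * Uy)) - (a\<^sup>2 * (a * Ux + s * Uy)) * (a\<^sup>2 * Uyy)"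
      using \<epsilon> by algebra
    also have "\<dots> = d ^ 7 * (pxy * py - px * pyy)" unfolding x y xy yy by algebra
    finally show ?thesis .
  qed
  have 04: "a ^ 10 * (U * Uy ^ 4) = d ^ 14 * (p0 * py ^ 4)"
  proof -
    have "a ^ 10 * (U * Uy ^ 4) = (a\<^sup>2 * U) * (a ^ 4 * Uy\<^sup>2)\<^sup>2" by algebra
    also have "\<dots> = d ^ 14 * (p0 * py ^ 4)" unfolding 0 y2 by algebra
    finally show ?thesis .
  qed
  have "a ^ 10 * (Uxy * Uy - Ux * Uyy)\<^sup>2 = (a ^ 5 * (Uxy * Uy - Ux * Uyy))\<^sup>2" by algebra
  also have "\<dots> = (pxy * py - px * pyy)\<^sup>2 / (p0 * py ^ 4) * (d ^ 14 * (p0 * py ^ 4))"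
    unfolding D using p by (simp add: power_mult_distrib power_mult[symmetric])
  also have "\<dots> = a ^ 10 * ((pxy * py - px * pyy)\<^sup>2 / (p0 * py ^ 4) * (U * Uy ^ 4))"
    unfolding 04[symmetric] by simp
  finally show "(Uxy * Uy - Ux * Uyy)\<^sup>2 = (pxy * py - px * pyy)\<^sup>2 / (p0 * py ^ 4) * (U * Uy ^ 4)"
    by (rule iffD1[OF mult_left_cancel[OF power_not_zero[OF a]]])
  \<comment> \<open>Hess u (X, X) for the same field X; again s cancels.\<close>
  have N: "a ^ 8 * (Uxx * Uy\<^sup>2 - 2 * Ux * Uy * Uxy + Ux\<^sup>2 * Uyy) =
      d ^ 10 * (pxx * py\<^sup>2 - 2 * px * py * pxy + px\<^sup>2 * pyy)"
  proof -
    let ?xx = "a\<^sup>2 * (a\<^sup>2 * Uxx + 2 * a * s * Uxy + s\<^sup>2 * Uyy)" and ?x = "a\<^sup>2 * (a * Ux + s * Uy)"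
      and ?y = "a\<^sup>2 * (\<epsilon> * Uy)" and ?xy = "a\<^sup>2 * (\<epsilon> * (a * Uxy + s * Uyy))"
    have "a ^ 8 * (Uxx * Uy\<^sup>2 - 2 * Ux * Uy * Uxy + Ux\<^sup>2 * Uyy) =
      ?xx * ?y\<^sup>2 - 2 * ?x * ?y * ?xy + ?x\<^sup>2 * (a\<^sup>2 * Uyy)"
      using \<epsilon> by algebra
    also have "\<dots> = d ^ 10 * (pxx * py\<^sup>2 - 2 * px * py * pxy + px\<^sup>2 * pyy)" unfolding x y xy yy xx by algebra
    finally show ?thesis .
  qed
  have 22: "a ^ 8 * (U\<^sup>2 * Uy\<^sup>2) = d ^ 10 * (p0\<^sup>2 * py\<^sup>2)"
  proof -
    have "a ^ 8 * (U\<^sup>2 * Uy\<^sup>2) = (a\<^sup>2 * U)\<^sup>2 * (a ^ 4 * Uy\<^sup>2)" by algebra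
    also have "\<dots> = d ^ 10 * (p0\<^sup>2 * py\<^sup>2)" unfolding 0 y2 by algebra
    finally show ?thesis .
  qed
  have "a ^ 8 * (Uxx * Uy\<^sup>2 - 2 * Ux * Uy * Uxy + Ux\<^sup>2 * Uyy) =
      (pxx * py\<^sup>2 - 2 * px * py * pxy + px\<^sup>2 * pyy) / (p0\<^sup>2 * py\<^sup>2) * (d ^ 10 * (p0\<^sup>2 * py\<^sup>2))"
    unfolding N using p by simp
  also have "\<dots> = a ^ 8 * ((pxx * py\<^sup>2 - 2 * px * py * pxy + px\<^sup>2 * pyy) / (p0\<^sup>2 * py\<^sup>2) * (U\<^sup>2 * Uy\<^sup>2))"
    unfolding 22[symmetric] by simp
  finally show "Uxx * Uy\<^sup>2 - 2 * Ux * Uy * Uxy + Ux\<^sup>2 * Uyy =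
      (pxx * py\<^sup>2 - 2 * px * py * pxy + px\<^sup>2 * pyy) / (p0\<^sup>2 * py\<^sup>2) * (U\<^sup>2 * Uy\<^sup>2)"
    by (rule iffD1[OF mult_left_cancel[OF power_not_zero[OF a]]])
qed

locale homothety_2_walker = walker +
  assumes conn: "connected M" and nonempty: "M \<noteq> {}"
    and u0: "\<And>q. q \<in> xy_image M \<Longrightarrow> dy (dy (\<lambda>(x, y). f x y)) q \<noteq> 0"
    and uy0: "\<And>q. q \<in> xy_image M \<Longrightarrow> dy (dy (dy (\<lambda>(x, y). f x y))) q \<noteq> 0"
    and hom: "homothety_curvature_homogeneous 2 M (walker_metric f)"
begin

lemma invariants:
  obtains k m n where
    "\<And>q. q \<in> S \<Longrightarrow> u q * dy (dy u) q = k * (dy u q)\<^sup>2"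
    "\<And>q. q \<in> S \<Longrightarrow> (dx (dy u) q * dy u q - dx u q * dy (dy u) q)\<^sup>2 = m * (u q * dy u q ^ 4)"
    "\<And>q. q \<in> S \<Longrightarrow> hess_u 1 1 q * (dy u q)\<^sup>2 - 2 * dx u q * dy u q * dx (dy u) q + (dx u q)\<^sup>2 * dy (dy u) q
      = n * ((u q)\<^sup>2 * (dy u q)\<^sup>2)"
proof -
  obtain P where P: "P \<in> M" using nonempty by blast
  define p where "p = (P $ 1, P $ 2)"
  have p: "p \<in> S" using P xy_imageI by (simp add: p_def)
  have hess: "hess_u 1 2 q = dx (dy u) q" "hess_u 2 2 q = dy (dy u) q" for q by (simp_all add: hess_u_def)
  have *: "u q * dy (dy u) q = u p * dy (dy u) p / (dy u p)\<^sup>2 * (dy u q)\<^sup>2 \<and>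
    (dx (dy u) q * dy u q - dx u q * dy (dy u) q)\<^sup>2 =
      (dx (dy u) p * dy u p - dx u p * dy (dy u) p)\<^sup>2 / (u p * dy u p ^ 4) * (u q * dy u q ^ 4) \<and>
    hess_u 1 1 q * (dy u q)\<^sup>2 - 2 * dx u q * dy u q * dx (dy u) q + (dx u q)\<^sup>2 * dy (dy u) q =
      (hess_u 1 1 p * (dy u p)\<^sup>2 - 2 * dx u p * dy u p * dx (dy u) p + (dx u p)\<^sup>2 * dy (dy u) p)
        / ((u p)\<^sup>2 * (dy u p)\<^sup>2) * ((u q)\<^sup>2 * (dy u q)\<^sup>2)" if q: "q \<in> S" for q
  proof -
    obtain Q where Q: "Q \<in> M" "q = (Q $ 1, Q $ 2)" using q by (auto simp: xy_image_def)
    obtain a d s \<epsilon> where *: "a \<noteq> 0" "\<epsilon>\<^sup>2 = 1"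
      "a\<^sup>2 * u q = d\<^sup>2 * u p" "a\<^sup>2 * (\<epsilon> * dy u q) = d ^ 3 * dy u p"
      "a\<^sup>2 * (a * dx u q + s * dy u q) = d ^ 3 * dx u p"
      "a\<^sup>2 * dy (dy u) q = d ^ 4 * dy (dy u) p"
      "a\<^sup>2 * (\<epsilon> * (a * dx (dy u) q + s * dy (dy u) q)) = d ^ 4 * dx (dy u) p"
      "a\<^sup>2 * (a\<^sup>2 * hess_u 1 1 q + 2 * a * s * dx (dy u) q + s\<^sup>2 * dy (dy u) q) = d ^ 4 * hess_u 1 1 p"
      by (rule homothety_curvature_homogeneousD[OF hom _ P Q(1) u0[OF p, unfolded p_def]])
        (simp_all add: Q(2) p_def hess)
    from homothety_2_invariants[OF * u0[OF p] uy0[OF p]] show ?thesis by blast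
  qed
  show ?thesis by (rule that) (use * in blast)+
qed

text \<open>v is the reciprocal of the logarithmic y-derivative of u, and - w is the slope of its
  level curves: if u is a function of y + h(x), then w = h'.\<close>

definition v :: "real \<times> real \<Rightarrow> real" where "v = (\<lambda>q. u q / dy u q)"
definition w :: "real \<times> real \<Rightarrow> real" where "w = (\<lambda>q. dx u q / dy u q)"

lemma smooth_uy: "smooth_on S (dy u)" by (rule smooth_on_dy[OF smooth_u])

lemma smooth_ux: "smooth_on S (dx u)" by (rule smooth_on_dx[OF smooth_u])

lemma smooth_v: "smooth_on S v"
  unfolding v_def using uy0 by (intro smooth_on_divide open_S smooth_u smooth_uy) auto

lemma smooth_w: "smooth_on S w"
  unfolding w_def using uy0 by (intro smooth_on_divide open_S smooth_ux smooth_uy) auto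

lemma v0: "q \<in> S \<Longrightarrow> v q \<noteq> 0" using u0 uy0 by (simp add: v_def)

lemma dx_u: "q \<in> S \<Longrightarrow> dx u q = w q * dy u q" using uy0 by (simp add: w_def)

lemma u_v: "q \<in> S \<Longrightarrow> u q = v q * dy u q" using uy0 by (simp add: v_def)

text \<open>The invariants in a form that integrates at once: v is affine in y with slope 1 - k, w
  is locally a function of x, and f_y - w_x is the y-antiderivative u v / (2 - k) of u.\<close>

lemma structure_equations:
  obtains k where "k \<noteq> 2" "\<And>q. q \<in> S \<Longrightarrow> dy v q = 1 - k" "\<And>q. q \<in> S \<Longrightarrow> dy w q = 0"
    "\<And>q. q \<in> S \<Longrightarrow> dx v q = (1 - k) * w q"
    "\<And>q. q \<in> S \<Longrightarrow> dy F q = dx w q + u q * v q / (2 - k)"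
proof -
  obtain k m n where K: "\<And>q. q \<in> S \<Longrightarrow> u q * dy (dy u) q = k * (dy u q)\<^sup>2"
    and Mm: "\<And>q. q \<in> S \<Longrightarrow> (dx (dy u) q * dy u q - dx u q * dy (dy u) q)\<^sup>2 = m * (u q * dy u q ^ 4)"
    and N: "\<And>q. q \<in> S \<Longrightarrow> hess_u 1 1 q * (dy u q)\<^sup>2 - 2 * dx u q * dy u q * dx (dy u) q + (dx u q)\<^sup>2 * dy (dy u) q
      = n * ((u q)\<^sup>2 * (dy u q)\<^sup>2)"
    using invariants by blast
  note cm = dx_dy_commute[OF open_S smooth_u]
  have vy: "dy v q = 1 - k" if q: "q \<in> S" for q
  proof -
    have "dy v q = (dy u q * dy u q - u q * dy (dy u) q) / (dy u q)\<^sup>2"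
      unfolding v_def by (rule dy_divide[OF smooth_u smooth_uy q uy0[OF q]])
    then show ?thesis using uy0[OF q] by (simp add: K[OF q] power2_eq_square[symmetric] diff_divide_distrib)
  qed
  have wy: "dy w q = (dx (dy u) q * dy u q - dx u q * dy (dy u) q) / (dy u q)\<^sup>2" if q: "q \<in> S" for q
    using dy_divide[OF smooth_ux smooth_uy q uy0[OF q]] cm[OF q] by (simp add: w_def)
  have vx: "dx v q = (1 - k) * w q - v q * dy w q" if q: "q \<in> S" for q
  proof -
    have "dx v q = (dx u q * dy u q - u q * dx (dy u) q) / (dy u q)\<^sup>2"
      unfolding v_def by (rule dx_divide[OF smooth_u smooth_uy q uy0[OF q]])
    also have "\<dots> = (1 - u q * dy (dy u) q / (dy u q)\<^sup>2) * w q - v q * dy w q"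
      unfolding wy[OF q] using uy0[OF q] by (simp add: v_def w_def field_simps power2_eq_square)
    finally show ?thesis using uy0[OF q] unfolding K[OF q] by simp
  qed
  \<comment> \<open>v_y is constant, so the mixed derivative of v vanishes; in the y-derivative of
    v_x the terms (1 - k) w_y cancel and - v w_yy is left.\<close>
  have wyy: "dy (dy w) q = 0" if q: "q \<in> S" for q
  proof -
    have "dx (\<lambda>_. 1 - k) q = dx (dy v) q"
      by (rule dx_cong[OF open_S smooth_on_const _ q]) (simp add: vy)
    then have "0 = dy (dx v) q" using dx_dy_commute[OF open_S smooth_v q] by (simp add: dx_const)
    also have "\<dots> = dy (\<lambda>q. (1 - k) * w q - v q * dy w q) q"
      by (rule dy_cong[OF open_S smooth_on_dx[OF smooth_v] vx q])
    also have "\<dots> = (1 - k) * dy w q - (v q * dy (dy w) q + dy v q * dy w q)"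
      by (simp add: dy_diff[OF smooth_on_mult[OF open_S smooth_on_const smooth_w]
            smooth_on_mult[OF open_S smooth_v smooth_on_dy[OF smooth_w]] q]
          dy_mult[OF smooth_on_const smooth_w q] dy_mult[OF smooth_v smooth_on_dy[OF smooth_w] q] dy_const)
    finally show ?thesis using v0[OF q] by (simp add: vy[OF q])
  qed
  have w2: "dy w q * dy w q = u q * m" if q: "q \<in> S" for q
  proof -
    have "dy w q * dy w q = (dx (dy u) q * dy u q - dx u q * dy (dy u) q)\<^sup>2 / dy u q ^ 4"
      unfolding wy[OF q] by (simp add: power2_eq_square power4_eq_xxxx)
    then show ?thesis unfolding Mm[OF q] using uy0[OF q] by simp
  qed
  \<comment> \<open>The second invariant has become w_y^2 = m u. By w_yy = 0 its y-derivative reads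
    0 = m u_y.\<close>
  have "m = 0"
  proof -
    obtain q where q: "q \<in> S" using nonempty xy_imageI by blast
    note s = smooth_on_dy[OF smooth_w]
    have "dy (\<lambda>q. dy w q * dy w q) q = dy (\<lambda>q. u q * m) q"
      by (rule dy_cong[OF open_S smooth_on_mult[OF open_S s s] w2 q])
    then have "0 = dy u q * m"
      by (simp add: dy_mult[OF s s q] wyy[OF q] dy_mult_right[OF smooth_u q])
    then show ?thesis using uy0[OF q] by simp
  qed
  then have wy0: "dy w q = 0" if "q \<in> S" for q using w2[OF that] by simp
  have uxy: "dx (dy u) q = w q * dy (dy u) q" if q: "q \<in> S" for q
  proof -
    have "dy (dx u) q = dy (\<lambda>q. w q * dy u q) q"
      by (rule dy_cong[OF open_S smooth_ux dx_u q])
    then show ?thesis using cm[OF q] by (simp add: dy_mult[OF smooth_w smooth_uy q] wy0[OF q])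
  qed
  have uxx: "dx (dx u) q = dx w q * dy u q + w q * dx (dy u) q" if q: "q \<in> S" for q
  proof -
    have "dx (dx u) q = dx (\<lambda>q. w q * dy u q) q"
      by (rule dx_cong[OF open_S smooth_ux dx_u q])
    then show ?thesis by (simp add: dx_mult[OF smooth_w smooth_uy q])
  qed
  have Fy: "dy F q = dx w q - n * (u q * v q)" if q: "q \<in> S" for q
  proof -
    have "hess_u 1 1 q * (dy u q)\<^sup>2 - 2 * dx u q * dy u q * dx (dy u) q + (dx u q)\<^sup>2 * dy (dy u) q =
        (dx w q - dy F q) * (dy u q * (dy u q)\<^sup>2)"
      unfolding hess_u_def by (simp add: uxx[OF q] uxy[OF q] dx_u[OF q] algebra_simps power2_eq_square)
    moreover have "a\<^sup>2 * c\<^sup>2 = a * b * (c * c\<^sup>2)" if "a = b * c" for a b c :: real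
      using that by algebra
    from this[OF u_v[OF q]] have "(u q)\<^sup>2 * (dy u q)\<^sup>2 = u q * v q * (dy u q * (dy u q)\<^sup>2)" .
    ultimately have "(dx w q - dy F q) * (dy u q * (dy u q)\<^sup>2) = n * (u q * v q) * (dy u q * (dy u q)\<^sup>2)"
      using N[OF q] by (simp only: mult.assoc)
    then have "dx w q - dy F q = n * (u q * v q)" using uy0[OF q] by simp
    then show ?thesis by simp
  qed
  \<comment> \<open>The y-derivative of f_y = w_x - n u v: here w_x contributes nothing and (u v)_y
    = (2 - k) u, so u = - n (2 - k) u.\<close>
  have n: "n * (2 - k) = - 1"
  proof -
    obtain q where q: "q \<in> S" using nonempty xy_imageI by blast
    have "dx (\<lambda>_. 0) q = dx (dy w) q"
      by (rule dx_cong[OF open_S smooth_on_const _ q]) (simp add: wy0)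
    then have 0: "dy (dx w) q = 0" using dx_dy_commute[OF open_S smooth_w q] by (simp add: dx_const)
    have s: "smooth_on S (\<lambda>q. n * (u q * v q))"
      by (intro smooth_on_mult open_S smooth_on_const smooth_u smooth_v)
    have "u q = dy (\<lambda>q. dx w q - n * (u q * v q)) q"
      by (rule dy_cong[OF open_S smooth_on_dy[OF smooth_F] Fy q])
    also have "\<dots> = - n * (u q * (1 - k) + dy u q * v q)"
      by (simp add: dy_diff[OF smooth_on_dx[OF smooth_w] s q] 0
          dy_mult[OF smooth_on_const smooth_on_mult[OF open_S smooth_u smooth_v] q] dy_const
          dy_mult[OF smooth_u smooth_v q] vy[OF q])
    also have "\<dots> = - n * (2 - k) * u q"
      by (simp add: v_def uy0[OF q] algebra_simps)
    finally have "u q * (n * (2 - k) + 1) = 0" by (simp add: algebra_simps)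
    then show ?thesis using u0[OF q] by simp
  qed
  show ?thesis
  proof (rule that[of k])
    show k: "k \<noteq> 2" using n by auto
    then have "n = - 1 / (2 - k)" using n by (simp add: field_simps)
    then show "dy F q = dx w q + u q * v q / (2 - k)" if "q \<in> S" for q using Fy[OF that] by simp
    show "dx v q = (1 - k) * w q" if "q \<in> S" for q using vx[OF that] wy0[OF that] by simp
  qed (use vy wy0 in auto)
qed

end

section \<open>Local isometries onto models whose profile depends on y alone\<close>

lemma smooth_on_snd:
  fixes g :: "real \<Rightarrow> real"
  assumes "open N" "smooth_on N g"
  shows "smooth_on (UNIV \<times> N) (\<lambda>(x :: real, y). g y)"
proof -
  have "smooth_on (UNIV \<times> N) (\<lambda>q :: real \<times> real. g (snd q))"
    by (rule smooth_on_compose[OF open_Times[OF open_UNIV assms(1)] assms smooth_on_bounded_linear[OF bounded_linear_snd]]) auto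
  then show ?thesis by (simp add: case_prod_unfold)
qed

lemma dy_snd:
  assumes "open N" "smooth_on N g" "y \<in> N"
  shows "dy (\<lambda>(x, y). g y) (x, y) = deriv g y"
  by (rule dy_eqI[OF smooth_on_snd[OF assms(1,2)] open_Times[OF open_UNIV assms(1)] subset_refl, where k = g])
    (use assms smooth_on_real_deriv(2) in auto)

context walker
begin

text \<open>Specialises the target to a profile g(y). The sign \<epsilon> reflects points where y +
  h(x) is negative into a model that lives on y > 0, and l stretches x to adjust a positive
  factor.\<close>

lemma locally_isometric_at_model:
  assumes P: "P \<in> M" and I: "open I" "is_interval I" "P $ 1 \<in> I" and J: "open J" "is_interval J" "P $ 2 \<in> J"
    and IJ: "I \<times> J \<subseteq> S" and N: "open N" "smooth_on N g" and h: "smooth_on I h"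
    and l: "l \<noteq> 0" and \<epsilon>: "\<epsilon> * \<epsilon> = 1"
    and dom: "\<And>x y. x \<in> I \<Longrightarrow> y \<in> J \<Longrightarrow> \<epsilon> * (y + h x) \<in> N"
    and eq: "\<And>x y. x \<in> I \<Longrightarrow> y \<in> J \<Longrightarrow> dy F (x, y) = l\<^sup>2 * \<epsilon> * deriv g (\<epsilon> * (y + h x)) + deriv (deriv h) x"
  shows "\<exists>Q\<in>{p. p $ 2 \<in> N}. locally_isometric_at M (walker_metric f) P {p. p $ 2 \<in> N} (walker_metric (\<lambda>x y. g y)) Q"
proof -
  let ?N = "{p :: real^3. p $ 2 \<in> N}"
  let ?h = "\<lambda>x. \<epsilon> * h x"
  define Q :: "real^3" where "Q = vector [l * P $ 1, \<epsilon> * (P $ 2 + h (P $ 1)), 0]"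
  have Q: "Q \<in> ?N" using dom[OF I(3) J(3)] by (simp add: Q_def)
  have N': "open ?N"
    using open_vimage[OF N(1), of "\<lambda>p :: real^3. p $ 2"] by (simp add: vimage_def continuous_intros)
  have h1: "deriv ?h x = \<epsilon> * deriv h x" if "x \<in> I" for x
    by (intro DERIV_imp_deriv DERIV_cmult smooth_on_real_deriv(2)[OF I(1) h that])
  have h2: "deriv (deriv ?h) x = \<epsilon> * deriv (deriv h) x" if x: "x \<in> I" for x
  proof -
    have "((\<lambda>x. \<epsilon> * deriv h x) has_real_derivative \<epsilon> * deriv (deriv h) x) (at x)"
      by (intro DERIV_cmult smooth_on_real_deriv(2)[OF I(1) smooth_on_real_deriv(1)[OF I(1) h] x])
    then have "(deriv ?h has_real_derivative \<epsilon> * deriv (deriv h) x) (at x)"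
      by (rule has_field_derivative_transform_within_open[OF _ I(1) x]) (simp add: h1)
    then show ?thesis by (rule DERIV_imp_deriv)
  qed
  have "locally_isometric_at M (walker_metric f) P ?N (walker_metric (\<lambda>x y. g y)) Q"
  proof (rule locally_isometric_at_walker[where ?x1.0 = 0 and \<mu> = \<epsilon> and h = ?h,
        OF open_M N' P Q I J _ open_Times[OF open_UNIV N(1)] smooth_on_snd[OF N] _ l])
    show "smooth_on (I \<times> J) F" by (rule smooth_on_subset[OF smooth_F IJ])
    show "\<epsilon>\<^sup>2 = 1" using \<epsilon> by (simp add: power2_eq_square)
    show "smooth_on I ?h" by (intro smooth_on_mult smooth_on_const h I(1))
    show "Q $ 1 = l * P $ 1 + 0" "Q $ 2 = \<epsilon> * P $ 2 + \<epsilon> * h (P $ 1)"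
      by (simp_all add: Q_def algebra_simps)
    fix x y assume xy: "x \<in> I" "y \<in> J"
    show "(l * x + 0, \<epsilon> * y + \<epsilon> * h x) \<in> UNIV \<times> N" using dom[OF xy] by (simp add: algebra_simps)
    have "dy (\<lambda>(x, y). g y) (l * x + 0, \<epsilon> * y + \<epsilon> * h x) = deriv g (\<epsilon> * (y + h x))"
      using dy_snd[OF N dom[OF xy]] by (simp add: algebra_simps)
    then show "dy F (x, y) = l\<^sup>2 * \<epsilon> * dy (\<lambda>(x, y). g y) (l * x + 0, \<epsilon> * y + \<epsilon> * h x) + \<epsilon> * deriv (deriv ?h) x"
      using eq[OF xy] \<epsilon> by (simp add: h2[OF xy(1)] mult.assoc[symmetric])
  qed
  with Q show ?thesis by blast
qed

end

context homothety_2_walker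
begin

text \<open>For k \<noteq> 1 the shift is forced: h = v / (1 - k) - y makes y + h(x) a multiple of
  v, which puts the singularity of the power law at 0. For k = 1 any antiderivative of w
  serves.\<close>

lemma local_shift:
  assumes P: "P \<in> M" and vy: "\<And>q. q \<in> S \<Longrightarrow> dy v q = 1 - k" and wy: "\<And>q. q \<in> S \<Longrightarrow> dy w q = 0"
    and vx: "\<And>q. q \<in> S \<Longrightarrow> dx v q = (1 - k) * w q"
  obtains I J h where "open I" "is_interval I" "P $ 1 \<in> I" "open J" "is_interval J" "P $ 2 \<in> J" "I \<times> J \<subseteq> S"
    "smooth_on I h" "\<forall>x\<in>I. \<forall>y\<in>J. (h has_real_derivative w (x, y)) (at x)"
    "\<forall>x\<in>I. \<forall>y\<in>J. deriv (deriv h) x = dx w (x, y)"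
    "k \<noteq> 1 \<longrightarrow> (\<forall>x\<in>I. \<forall>y\<in>J. v (x, y) = (1 - k) * (y + h x))"
proof -
  obtain e where e: "e > 0" "ball (P $ 1) e \<times> ball (P $ 2) e \<subseteq> S"
    using open_contains_square[OF open_S xy_imageI[OF P]] .
  define I where "I = ball (P $ 1) e"
  define J where "J = ball (P $ 2) e"
  have I: "open I" "is_interval I" "P $ 1 \<in> I" and J: "open J" "is_interval J" "P $ 2 \<in> J"
    using e(1) by (simp_all add: I_def J_def is_interval_ball_real)
  have IJ: "I \<times> J \<subseteq> S" using e(2) by (simp add: I_def J_def)
  have S: "(x, y) \<in> S" if "x \<in> I" "y \<in> J" for x y using IJ that by blast
  have wc: "w (x, y) = w (x, P $ 2)" if "x \<in> I" "y \<in> J" for x y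
  proof (rule interval_constant[OF J(2) _ that(2) J(3)])
    fix y assume "y \<in> J"
    then show "((\<lambda>y. w (x, y)) has_real_derivative 0) (at y)"
      using has_real_derivative_dy[OF smooth_w S[OF that(1)]] wy[OF S[OF that(1)]] by simp
  qed
  have vc: "v (x, y) = v (x, P $ 2) + (1 - k) * (y - P $ 2)" if x: "x \<in> I" and "y \<in> J" for x y
  proof -
    have "v (x, y) - (1 - k) * (y - P $ 2) = v (x, P $ 2) - (1 - k) * (P $ 2 - P $ 2)"
    proof (rule interval_constant[OF J(2) _ that(2) J(3)])
      fix y assume y: "y \<in> J"
      have "((\<lambda>y. v (x, y) - (1 - k) * (y - P $ 2)) has_real_derivative dy v (x, y) - (1 - k) * (1 - 0)) (at y)"
        by (intro DERIV_diff DERIV_cmult DERIV_ident DERIV_const has_real_derivative_dy[OF smooth_v S[OF x y]])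
      then show "((\<lambda>y. v (x, y) - (1 - k) * (y - P $ 2)) has_real_derivative 0) (at y)"
        using vy[OF S[OF x y]] by simp
    qed
    then show ?thesis by simp
  qed
  have id: "smooth_on I (\<lambda>x::real. x)" by (rule smooth_on_bounded_linear) (rule bounded_linear_ident)
  have row: "smooth_on I (\<lambda>x. G (x, P $ 2))" if "smooth_on S G" for G :: "real \<times> real \<Rightarrow> real"
    using S J(3) by (intro smooth_on_compose[OF I(1) open_S that] smooth_on_Pair smooth_on_const id I(1)) auto
  obtain h where h: "smooth_on I h" "\<And>x. x \<in> I \<Longrightarrow> (h has_real_derivative w (x, P $ 2)) (at x)"
    and hv: "\<And>x y. k \<noteq> 1 \<Longrightarrow> x \<in> I \<Longrightarrow> y \<in> J \<Longrightarrow> v (x, y) = (1 - k) * (y + h x)"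
  proof (cases "k = 1")
    case True
    obtain h where "smooth_on I h" "\<And>x. x \<in> I \<Longrightarrow> (h has_real_derivative w (x, P $ 2)) (at x)"
      by (rule smooth_antiderivative[OF I(1,2) row[OF smooth_w] I(3)]) blast
    then show ?thesis using True by (intro that) auto
  next
    case False
    define h where "h x = 1 / (1 - k) * v (x, P $ 2) - P $ 2" for x
    have "smooth_on I h"
      unfolding h_def by (intro smooth_on_diff smooth_on_mult smooth_on_const row smooth_v I(1))
    moreover have "(h has_real_derivative w (x, P $ 2)) (at x)" if x: "x \<in> I" for x
    proof -
      have "(h has_real_derivative 1 / (1 - k) * dx v (x, P $ 2) - 0) (at x)"
        unfolding h_def
        by (intro DERIV_diff DERIV_cmult DERIV_const has_real_derivative_dx[OF smooth_v S[OF x J(3)]])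
      then show ?thesis using False by (simp add: vx[OF S[OF x J(3)]])
    qed
    moreover have "v (x, y) = (1 - k) * (y + h x)" if "x \<in> I" "y \<in> J" for x y
    proof -
      have "(1 - k) * (P $ 2 + h x) = v (x, P $ 2)" using False by (simp add: h_def)
      then show ?thesis using vc[OF that] by (simp add: algebra_simps)
    qed
    ultimately show ?thesis by (intro that) auto
  qed
  have "deriv (deriv h) x = dx w (x, y)" if x: "x \<in> I" and y: "y \<in> J" for x y
  proof -
    have "(deriv h has_real_derivative dx w (x, y)) (at x)"
      by (rule has_field_derivative_transform_within_open[OF has_real_derivative_dx[OF smooth_w S[OF x y]] I(1) x])
        (metis h(2) wc[OF _ y] DERIV_imp_deriv)
    then show ?thesis by (rule DERIV_imp_deriv)
  qed
  moreover have "(h has_real_derivative w (x, y)) (at x)" if "x \<in> I" "y \<in> J" for x y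
    using h(2)[OF that(1)] wc[OF that] by simp
  ultimately show ?thesis using that[OF I J IJ h(1)] hv by blast
qed

text \<open>On the box, \<open>u\<close> is a function of \<open>y + h x\<close> because \<open>u\<^sub>x = w u\<^sub>y = h' u\<^sub>y\<close>; \<open>E\<close> is the reciprocal of a
  candidate for it.\<close>

lemma u_profile:
  assumes I: "is_interval I" "x0 \<in> I" and J: "is_interval J" "y0 \<in> J" and IJ: "I \<times> J \<subseteq> S"
    and h: "\<And>x y. x \<in> I \<Longrightarrow> y \<in> J \<Longrightarrow> (h has_real_derivative w (x, y)) (at x)"
    and E: "\<And>x y. x \<in> I \<Longrightarrow> y \<in> J \<Longrightarrow> (E has_real_derivative E' (y + h x)) (at (y + h x))"
    and eq: "\<And>x y. x \<in> I \<Longrightarrow> y \<in> J \<Longrightarrow> u (x, y) * E' (y + h x) + dy u (x, y) * E (y + h x) = 0"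
    and xy: "x \<in> I" "y \<in> J"
  shows "u (x, y) * E (y + h x) = u (x0, y0) * E (y0 + h x0)"
proof -
  have S: "(x, y) \<in> S" if "x \<in> I" "y \<in> J" for x y using IJ that by blast
  have 1: "u (x, y) * E (y + h x) = u (x, y0) * E (y0 + h x)"
  proof (rule interval_constant[OF J(1) _ xy(2) J(2)])
    fix y assume y: "y \<in> J"
    have "((\<lambda>y. y + h x) has_real_derivative 1) (at y)" by (auto intro!: derivative_eq_intros)
    from DERIV_mult[OF has_real_derivative_dy[OF smooth_u S[OF xy(1) y]] DERIV_chain2[OF E[OF xy(1) y] this]]
    show "((\<lambda>y. u (x, y) * E (y + h x)) has_real_derivative 0) (at y)"
      using eq[OF xy(1) y] by (simp add: algebra_simps)
  qed
  have "u (x, y0) * E (y0 + h x) = u (x0, y0) * E (y0 + h x0)"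
  proof (rule interval_constant[OF I(1) _ xy(1) I(2)])
    fix x assume x: "x \<in> I"
    have "((\<lambda>x. y0 + h x) has_real_derivative w (x, y0)) (at x)"
      using h[OF x J(2)] by (auto intro!: derivative_eq_intros)
    from DERIV_mult[OF has_real_derivative_dx[OF smooth_u S[OF x J(2)]] DERIV_chain2[OF E[OF x J(2)] this]]
    have "((\<lambda>x. u (x, y0) * E (y0 + h x)) has_real_derivative
      w (x, y0) * (u (x, y0) * E' (y0 + h x) + dy u (x, y0) * E (y0 + h x))) (at x)"
      by (simp add: dx_u[OF S[OF x J(2)]] algebra_simps)
    then show "((\<lambda>x. u (x, y0) * E (y0 + h x)) has_real_derivative 0) (at x)"
      using eq[OF x J(2)] by simp
  qed
  with 1 show ?thesis by simp
qed

text \<open>k = 1 gives the exponential; otherwise u is a multiple of |y + h|^p with p = 1 / (1 -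
  k), and f has exponent p + 2, with the logarithm at p = -2. One model must serve all points: its
  sign and parameter come from global data, while the modulus of the box-dependent factor C goes
  into l.\<close>

lemma classification:
  "(\<exists>s\<in>{1, -1}. \<exists>a. a \<noteq> 0 \<and>
     locally_isometric M (walker_metric f) UNIV (walker_metric (\<lambda>x y. s * exp (a * y)))) \<or>
   (\<exists>s\<in>{1, -1}. locally_isometric M (walker_metric f) upper_half (walker_metric (\<lambda>x y. s * ln y))) \<or>
   (\<exists>s\<in>{1, -1}. \<exists>e. e \<notin> {0, 1, 2} \<and>
     locally_isometric M (walker_metric f) upper_half (walker_metric (\<lambda>x y. s * y powr e)))"
proof -
  obtain k where k: "k \<noteq> 2" and vy: "\<And>q. q \<in> S \<Longrightarrow> dy v q = 1 - k" and wy: "\<And>q. q \<in> S \<Longrightarrow> dy w q = 0"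
    and vx: "\<And>q. q \<in> S \<Longrightarrow> dx v q = (1 - k) * w q"
    and Fy: "\<And>q. q \<in> S \<Longrightarrow> dy F q = dx w q + u q * v q / (2 - k)"
    using structure_equations by blast
  obtain q0 where q0: "q0 \<in> S" using nonempty xy_imageI by blast
  define \<sigma> where "\<sigma> = sgn (u q0)"
  have \<sigma>: "sgn (u q) = \<sigma>" "\<sigma> * \<sigma> = 1" if "q \<in> S" for q
    using u_same_sign[OF conn u0 q0 that] u0[OF q0]
    by (auto simp: \<sigma>_def zero_less_divide_iff sgn_if)
  have \<sigma>2: "\<sigma> * \<sigma> = 1" using \<sigma>(2)[OF q0] .
  have upper: "upper_half = {p. p $ 2 \<in> {0<..}}" by (auto simp: upper_half_def)
  have S': "(x, y) \<in> S" if "I \<times> J \<subseteq> S" "x \<in> I" "y \<in> J" for x y I J using that by blast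
  have sgn_const: "sgn C = \<sigma>" if "u q * E = C" "E > 0" "q \<in> S" for q E C
    using \<sigma>(1)[OF that(3)] that(1,2) by (auto simp: sgn_mult)
  show ?thesis
  proof (cases "k = 1")
    case True
    define a where "a = 1 / v q0"
    have a0: "a \<noteq> 0" using v0[OF q0] by (simp add: a_def)
    have va: "v q = 1 / a" if "q \<in> S" for q
    proof -
      have "v q = v q0"
        by (rule constant_if_dx_dy_zero[OF open_S connected_xy_image[OF conn] smooth_v _ _ that q0])
          (use vx vy True in auto)
      then show ?thesis by (simp add: a_def)
    qed
    have "\<exists>Q\<in>UNIV. locally_isometric_at M (walker_metric f) P UNIV (walker_metric (\<lambda>x y. \<sigma> * exp (a * y))) Q"
      if P: "P \<in> M" for P
    proof -
      obtain I J h where I: "open I" "is_interval I" "P $ 1 \<in> I" and J: "open J" "is_interval J" "P $ 2 \<in> J"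
        and IJ: "I \<times> J \<subseteq> S" and hs: "smooth_on I h"
        and box: "\<forall>x\<in>I. \<forall>y\<in>J. (h has_real_derivative w (x, y)) (at x)"
        "\<forall>x\<in>I. \<forall>y\<in>J. deriv (deriv h) x = dx w (x, y)"
        "k \<noteq> 1 \<longrightarrow> (\<forall>x\<in>I. \<forall>y\<in>J. v (x, y) = (1 - k) * (y + h x))"
        by (rule local_shift[OF P vy wy vx])
      have h: "(h has_real_derivative w (x, y)) (at x)"
        and h2: "deriv (deriv h) x = dx w (x, y)" if "x \<in> I" "y \<in> J" for x y
        using box(1,2) that by blast+
      define C where "C = u (P $ 1, P $ 2) * exp (- a * (P $ 2 + h (P $ 1)))"
      have uC: "u (x, y) = C * exp (a * (y + h x))" if xy: "x \<in> I" "y \<in> J" for x y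
      proof -
        have "u (x, y) * exp (- a * (y + h x)) = C"
          unfolding C_def
        proof (rule u_profile[where E' = "\<lambda>t. - a * exp (- a * t)", OF I(2,3) J(2,3) IJ h _ _ xy])
          fix x y assume xy: "x \<in> I" "y \<in> J"
          show "((\<lambda>t. exp (- a * t)) has_real_derivative - a * exp (- a * (y + h x))) (at (y + h x))"
            by (auto intro!: derivative_eq_intros)
          have "dy u (x, y) = a * u (x, y)"
            using va[OF S'[OF IJ xy]] u_v[OF S'[OF IJ xy]] a0 by simp
          then show "u (x, y) * (- a * exp (- a * (y + h x))) + dy u (x, y) * exp (- a * (y + h x)) = 0"
            by simp
        qed
        then have "u (x, y) * (exp (- a * (y + h x)) * exp (a * (y + h x))) = C * exp (a * (y + h x))" by simp
        then show ?thesis by (simp add: exp_add[symmetric])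
      qed
      have sC: "sgn C = \<sigma>"
        by (rule sgn_const[OF C_def[symmetric] _ xy_imageI[OF P]]) simp
      \<comment> \<open>Needed is u v = (C / a) e^(a (y + h)), while the model contributes l^2
        \<sigma> a times the same exponential; C has sign \<sigma>.\<close>
      define l where "l = sqrt \<bar>C\<bar> / a"
      have C0: "C \<noteq> 0" using sC \<sigma>2 by auto
      have l: "l \<noteq> 0" "l\<^sup>2 * \<sigma> * a = C / a"
        using a0 C0 sC by (auto simp: l_def power_divide power2_eq_square sgn_if split: if_splits)
      have g: "smooth_on UNIV (\<lambda>y::real. \<sigma> * exp (a * y))"
        by (intro smooth_on_mult smooth_on_const smooth_on_compose[OF open_UNIV open_UNIV smooth_on_exp]
            smooth_on_bounded_linear[OF bounded_linear_ident] open_UNIV) auto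
      have dg: "deriv (\<lambda>y. \<sigma> * exp (a * y)) y = \<sigma> * a * exp (a * y)" for y
        by (intro DERIV_imp_deriv) (auto intro!: derivative_eq_intros)
      have "\<exists>Q\<in>{p. p $ 2 \<in> UNIV}. locally_isometric_at M (walker_metric f) P {p. p $ 2 \<in> UNIV}
          (walker_metric (\<lambda>x y. \<sigma> * exp (a * y))) Q"
      proof (rule locally_isometric_at_model[OF P I J IJ open_UNIV g hs l(1), of 1])
        fix x y assume xy: "x \<in> I" "y \<in> J"
        have "dy F (x, y) = dx w (x, y) + u (x, y) * v (x, y)"
          using Fy[OF S'[OF IJ xy]] True by simp
        also have "\<dots> = C / a * exp (a * (y + h x)) + deriv (deriv h) x"
          by (simp add: h2[OF xy] uC[OF xy] va[OF S'[OF IJ xy]])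
        finally show "dy F (x, y) = l\<^sup>2 * 1 * deriv (\<lambda>y. \<sigma> * exp (a * y)) (1 * (y + h x)) + deriv (deriv h) x"
          unfolding dg l(2)[symmetric] by (simp add: mult.assoc)
      qed auto
      then show ?thesis by simp
    qed
    moreover have "\<sigma> \<in> {1, -1}" using \<sigma>2 by (simp add: square_eq_1_iff)
    ultimately show ?thesis using a0 unfolding locally_isometric_def by blast
  next
    case False
    \<comment> \<open>The exponent of u, from u_y / u = 1 / v = p / (y + h); the value -1 would mean
      k = 2.\<close>
    define p where "p = 1 / (1 - k)"
    define c where "c = (1 - k) / (2 - k)"
    have c0: "c \<noteq> 0" using False k by (simp add: c_def)
    have p: "p \<noteq> 0" "p \<noteq> - 1" using False k by (auto simp: p_def field_simps)
    have local_model: "\<exists>I J h \<epsilon> C. open I \<and> is_interval I \<and> P $ 1 \<in> I \<and> open J \<and> is_interval J \<and> P $ 2 \<in> J \<and>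
        I \<times> J \<subseteq> S \<and> smooth_on I h \<and> \<epsilon> * \<epsilon> = 1 \<and> sgn C = \<sigma> \<and>
        (\<forall>x\<in>I. \<forall>y\<in>J. \<epsilon> * (y + h x) \<in> {0<..} \<and>
           dy F (x, y) = C * c * \<epsilon> * (\<epsilon> * (y + h x)) powr (p + 1) + deriv (deriv h) x)"
      if P: "P \<in> M" for P
    proof -
      obtain I J h where I: "open I" "is_interval I" "P $ 1 \<in> I" and J: "open J" "is_interval J" "P $ 2 \<in> J"
        and IJ: "I \<times> J \<subseteq> S" and hs: "smooth_on I h"
        and box: "\<forall>x\<in>I. \<forall>y\<in>J. (h has_real_derivative w (x, y)) (at x)"
        "\<forall>x\<in>I. \<forall>y\<in>J. deriv (deriv h) x = dx w (x, y)"
        "k \<noteq> 1 \<longrightarrow> (\<forall>x\<in>I. \<forall>y\<in>J. v (x, y) = (1 - k) * (y + h x))"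
        by (rule local_shift[OF P vy wy vx])
      have h: "(h has_real_derivative w (x, y)) (at x)"
        and h2: "deriv (deriv h) x = dx w (x, y)"
        and hv: "v (x, y) = (1 - k) * (y + h x)" if "x \<in> I" "y \<in> J" for x y
        using box False that by blast+
      \<comment> \<open>v has no zeros on the connected box, so y + h(x) keeps this sign
        there.\<close>
      define \<epsilon> where "\<epsilon> = sgn (P $ 2 + h (P $ 1))"
      have conn_IJ: "connected (I \<times> J)"
        using I(2) J(2) by (intro connected_Times) (simp_all add: is_interval_connected_1)
      have vv: "v (x, y) / v (P $ 1, P $ 2) > 0" if "x \<in> I" "y \<in> J" for x y
        by (rule same_sign_on_connected[OF conn_IJ continuous_on_subset[OF smooth_on_continuous_on[OF smooth_v] IJ]])
          (use v0 IJ that I J in auto)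
      have \<epsilon>: "\<epsilon> * (y + h x) > 0" "\<epsilon> * \<epsilon> = 1" if "x \<in> I" "y \<in> J" for x y
        using vv[OF that] False
        by (auto simp: hv[OF that] hv[OF I(3) J(3)] \<epsilon>_def zero_less_divide_iff zero_less_mult_iff mult_less_0_iff sgn_if)
      define C where "C = u (P $ 1, P $ 2) * (\<epsilon> * (P $ 2 + h (P $ 1))) powr (- p)"
      have uC: "u (x, y) = C * (\<epsilon> * (y + h x)) powr p" if xy: "x \<in> I" "y \<in> J" for x y
      proof -
        have "u (x, y) * (\<epsilon> * (y + h x)) powr (- p) = C"
          unfolding C_def
        proof (rule u_profile[where E = "\<lambda>t. (\<epsilon> * t) powr (- p)" and E' = "\<lambda>t. - p * \<epsilon> * (\<epsilon> * t) powr (- p - 1)",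
              OF I(2,3) J(2,3) IJ h _ _ xy])
          fix x y assume xy: "x \<in> I" "y \<in> J"
          show "((\<lambda>t. (\<epsilon> * t) powr (- p)) has_real_derivative - p * \<epsilon> * (\<epsilon> * (y + h x)) powr (- p - 1)) (at (y + h x))"
            using \<epsilon>[OF xy] by (auto intro!: derivative_eq_intros)
          have y0: "y + h x \<noteq> 0" using \<epsilon>(1)[OF xy] by auto
          have 1: "u (x, y) * p = (y + h x) * dy u (x, y)"
            using u_v[OF S'[OF IJ xy]] False by (simp add: hv[OF xy] p_def)
          have "(\<epsilon> * (y + h x)) powr (- p) = (\<epsilon> * (y + h x)) powr ((- p - 1) + 1)" by simp
          also have "\<dots> = (\<epsilon> * (y + h x)) powr (- p - 1) * (\<epsilon> * (y + h x))"
            unfolding powr_add using \<epsilon>(1)[OF xy] by simp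
          finally have 2: "(\<epsilon> * (y + h x)) powr (- p) = (\<epsilon> * (y + h x)) powr (- p - 1) * (\<epsilon> * (y + h x))" .
          have "U * (- p * e * R) + D * T = 0" if "U * p = Y * D" "T = R * (e * Y)" for U D T R Y e :: real
            using that by algebra
          from this[OF 1 2] show "u (x, y) * (- p * \<epsilon> * (\<epsilon> * (y + h x)) powr (- p - 1))
              + dy u (x, y) * (\<epsilon> * (y + h x)) powr (- p) = 0" .
        qed
        then have "u (x, y) * ((\<epsilon> * (y + h x)) powr (- p) * (\<epsilon> * (y + h x)) powr p) = C * (\<epsilon> * (y + h x)) powr p"
          by simp
        then show ?thesis using \<epsilon>(1)[OF xy] by (auto simp: powr_add[symmetric] split: if_splits)
      qed
      have sC: "sgn C = \<sigma>"
        by (rule sgn_const[OF C_def[symmetric] _ xy_imageI[OF P]]) (use \<epsilon>(1)[OF I(3) J(3)] in auto)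
      have "dy F (x, y) = C * c * \<epsilon> * (\<epsilon> * (y + h x)) powr (p + 1) + deriv (deriv h) x" if xy: "x \<in> I" "y \<in> J" for x y
      proof -
        have e: "(\<epsilon> * (y + h x)) powr (p + 1) = (\<epsilon> * (y + h x)) powr p * (\<epsilon> * (y + h x))"
          unfolding powr_add using \<epsilon>(1)[OF xy] by simp
        have "\<epsilon> * (\<epsilon> * (y + h x)) powr (p + 1) = (\<epsilon> * \<epsilon>) * ((\<epsilon> * (y + h x)) powr p * (y + h x))"
          unfolding e by (simp only: mult_ac)
        then have e': "\<epsilon> * (\<epsilon> * (y + h x)) powr (p + 1) = (\<epsilon> * (y + h x)) powr p * (y + h x)"
          using \<epsilon>(2)[OF xy] by simp
        have "u (x, y) * v (x, y) / (2 - k) = C * c * (\<epsilon> * (\<epsilon> * (y + h x)) powr (p + 1))"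
          unfolding e' by (simp add: uC[OF xy] hv[OF xy] c_def)
        then show ?thesis using Fy[OF S'[OF IJ xy]] h2[OF xy] by (simp add: mult.assoc)
      qed
      then show ?thesis using I J IJ hs \<epsilon> sC I(3) J(3)
        by (intro exI[of _ I] exI[of _ J] exI[of _ h] exI[of _ \<epsilon>] exI[of _ C]) auto
    qed
    \<comment> \<open>A factor l^2 can absorb only a modulus; the sign that is left depends on
      \<sigma> and d and not on the base point.\<close>
    have scale: "\<exists>l. l \<noteq> 0 \<and> l\<^sup>2 * sgn (\<sigma> * d) = C * d" if "sgn C = \<sigma>" "d \<noteq> 0" for C d :: real
    proof -
      have "C * d \<noteq> 0" using that \<sigma>2 by auto
      moreover have "sgn (\<sigma> * d) = sgn (C * d)" using that(1) by (auto simp: sgn_mult)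
      ultimately show ?thesis
        by (intro exI[of _ "sqrt \<bar>C * d\<bar>"]) (simp add: abs_mult_sgn)
    qed
    have sgn_cases: "sgn (\<sigma> * d) \<in> {1, -1}" if "d \<noteq> 0" for d
      using that \<sigma>2 by (auto simp: sgn_if)
    \<comment> \<open>d is the factor that differentiation brings out of the unsigned model: 1 for
      the logarithm, e for the power.\<close>
    have model: "locally_isometric M (walker_metric f) upper_half (walker_metric (\<lambda>x y. g y))"
      if g: "smooth_on {0<..} g" and d: "d \<noteq> 0"
        and dg: "\<And>y. y > 0 \<Longrightarrow> (g has_real_derivative sgn (\<sigma> * (c / d)) * d * y powr (p + 1)) (at y)" for g d
    proof -
      have "\<exists>Q\<in>upper_half. locally_isometric_at M (walker_metric f) P upper_half (walker_metric (\<lambda>x y. g y)) Q"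
        if P: "P \<in> M" for P
      proof -
        obtain I J h \<epsilon> C where I: "open I" "is_interval I" "P $ 1 \<in> I" and J: "open J" "is_interval J" "P $ 2 \<in> J"
          and IJ: "I \<times> J \<subseteq> S" and hs: "smooth_on I h" and \<epsilon>: "\<epsilon> * \<epsilon> = 1" and C: "sgn C = \<sigma>"
          and dom: "\<And>x y. x \<in> I \<Longrightarrow> y \<in> J \<Longrightarrow> \<epsilon> * (y + h x) \<in> {0<..}"
          and eq: "\<And>x y. x \<in> I \<Longrightarrow> y \<in> J \<Longrightarrow>
            dy F (x, y) = C * c * \<epsilon> * (\<epsilon> * (y + h x)) powr (p + 1) + deriv (deriv h) x"
          using local_model[OF P] by metis
        obtain l where l: "l \<noteq> 0" "l\<^sup>2 * sgn (\<sigma> * (c / d)) = C * (c / d)"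
          using scale[OF C, of "c / d"] c0 d by auto
        have l2: "C * c = l\<^sup>2 * sgn (\<sigma> * (c / d)) * d" unfolding l(2) using d by simp
        show ?thesis unfolding upper
        proof (rule locally_isometric_at_model[OF P I J IJ open_greaterThan g hs l(1) \<epsilon> dom])
          fix x y assume xy: "x \<in> I" "y \<in> J"
          have "deriv g (\<epsilon> * (y + h x)) = sgn (\<sigma> * (c / d)) * d * (\<epsilon> * (y + h x)) powr (p + 1)"
            using dom[OF xy] by (intro DERIV_imp_deriv dg) simp
          then show "dy F (x, y) = l\<^sup>2 * \<epsilon> * deriv g (\<epsilon> * (y + h x)) + deriv (deriv h) x"
            unfolding eq[OF xy] l2 by (simp only: mult_ac)
        qed
      qed
      then show ?thesis by (simp add: locally_isometric_def)
    qed
    show ?thesis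
    proof (cases "p = - 2")
      case True
      define s where "s = sgn (\<sigma> * (c / 1))"
      have "locally_isometric M (walker_metric f) upper_half (walker_metric (\<lambda>x y. s * ln y))"
        unfolding s_def
        by (rule model[where d = 1], intro smooth_on_mult smooth_on_const smooth_on_ln)
          (auto intro!: derivative_eq_intros simp: True powr_minus divide_inverse)
      moreover have "s \<in> {1, -1}" unfolding s_def using c0 by (intro sgn_cases) simp
      ultimately show ?thesis by blast
    next
      case p2: False
      define e where "e = p + 2"
      \<comment> \<open>p \<noteq> 0, p \<noteq> -1 and p \<noteq> -2 exclude the exponents 2, 1 and
        0 in turn.\<close>
      have e: "e \<noteq> 0" "e \<notin> {0, 1, 2}" using p p2 by (auto simp: e_def)
      define s where "s = sgn (\<sigma> * (c / e))"
      have "locally_isometric M (walker_metric f) upper_half (walker_metric (\<lambda>x y. s * y powr e))"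
      proof (rule model[OF _ e(1)])
        show "smooth_on {0<..} (\<lambda>y::real. s * y powr e)"
          by (intro smooth_on_mult smooth_on_const smooth_on_powr) auto
        fix y :: real assume "y > 0"
        then have "((\<lambda>y. s * y powr e) has_real_derivative s * e * y powr (e - 1)) (at y)"
          by (auto intro!: derivative_eq_intros)
        moreover have "e - 1 = p + 1" by (simp add: e_def)
        ultimately show "((\<lambda>y. s * y powr e) has_real_derivative sgn (\<sigma> * (c / e)) * e * y powr (p + 1)) (at y)"
          by (simp only: s_def)
      qed
      moreover have "s \<in> {1, -1}" unfolding s_def using c0 e(1) by (intro sgn_cases) simp
      ultimately show ?thesis using e(2) by blast
    qed
  qed
qed

end


section \<open>Rigidity of isometries between half-space models\<close>

lemma has_real_derivative_partial:
  assumes "smooth_on U A" "p \<in> U"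
  shows "((\<lambda>t. A (p + t *\<^sub>R axis i 1)) has_real_derivative partial_deriv i A p) (at 0)"
  using has_real_derivative_along_line[OF assms(1), of p 0 "axis i 1"] assms(2) by (simp add: partial_deriv_def)

lemma smooth_on_partial_deriv: "smooth_on U A \<Longrightarrow> smooth_on U (partial_deriv i A)"
  unfolding partial_deriv_def[abs_def] by (rule smooth_on_frechet_derivative)

lemma partial_deriv_commute:
  "open U \<Longrightarrow> smooth_on U A \<Longrightarrow> p \<in> U \<Longrightarrow>
    partial_deriv i (partial_deriv j A) p = partial_deriv j (partial_deriv i A) p"
  unfolding partial_deriv_def[abs_def] by (rule frechet_derivative_symmetric)

lemma partial_deriv_eqI:
  assumes "open U" "smooth_on U A" "p \<in> U" "\<And>q. q \<in> U \<Longrightarrow> A q = B q"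
    "((\<lambda>t. B (p + t *\<^sub>R axis i 1)) has_real_derivative d) (at 0)"
  shows "partial_deriv i A p = d"
proof -
  have U: "open ((\<lambda>t. p + t *\<^sub>R axis i 1) -` U)"
    by (rule open_vimage[OF assms(1)]) (intro continuous_intros)
  have "((\<lambda>t. B (p + t *\<^sub>R axis i 1)) has_real_derivative partial_deriv i A p) (at 0)"
    by (rule has_field_derivative_transform_within_open[OF has_real_derivative_partial[OF assms(2,3)] U])
      (use assms(3,4) in auto)
  then show ?thesis using assms(5) DERIV_unique by blast
qed

text \<open>A common setting for logarithm and powers. The condition \<open>ratio\<close> says g'''
  / g'' = r / y, so the height can be recovered from g'' and its derivative. Working with the
  isometry equations alone avoids having to prove that curvature is natural under T.\<close>

locale model_isometry =
  fixes g d1 d2 d3 :: "real \<Rightarrow> real" and U :: "(real^3) set" and T :: "real^3 \<Rightarrow> real^3" and r :: real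
  assumes d1: "\<forall>y>0. (g has_real_derivative d1 y) (at y)"
    and d2: "\<forall>y>0. (d1 has_real_derivative d2 y) (at y)"
    and d3: "\<forall>y>0. (d2 has_real_derivative d3 y) (at y)"
    and d1_nz: "\<And>y. y > 0 \<Longrightarrow> d1 y \<noteq> 0"
    and d2_nz: "\<And>y. y > 0 \<Longrightarrow> d2 y \<noteq> 0"
    and ratio: "\<And>y. y > 0 \<Longrightarrow> d3 y * y = r * d2 y" and r: "r \<noteq> 0"
    and U: "open U" "U \<subseteq> upper_half" and T: "smooth_on U T" "\<And>p. p \<in> U \<Longrightarrow> T p \<in> upper_half"
    and iso: "\<And>p v w. p \<in> U \<Longrightarrow> metric_form (walker_metric (\<lambda>x. g)) (T p)
      (frechet_derivative T (at p) v) (frechet_derivative T (at p) w) = metric_form (walker_metric (\<lambda>x. g)) p v w"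
begin

abbreviation X where "X \<equiv> \<lambda>p. T p $ 1"
abbreviation Y where "Y \<equiv> \<lambda>p. T p $ 2"
abbreviation Z where "Z \<equiv> \<lambda>p. T p $ 3"
abbreviation D :: "3 \<Rightarrow> (real^3 \<Rightarrow> real) \<Rightarrow> real^3 \<Rightarrow> real" where "D \<equiv> partial_deriv"

lemma pos: "p \<in> U \<Longrightarrow> p $ 2 > 0" "p \<in> U \<Longrightarrow> Y p > 0"
  using U T by (auto simp: upper_half_def)

lemma smooth: "smooth_on U (\<lambda>p. T p $ k)" by (rule smooth_on_vec_nth[OF U(1) T(1)])

lemma smooth_D: "smooth_on U (D i (\<lambda>p. T p $ k))" by (rule smooth_on_partial_deriv[OF smooth])

lemma smooth_DD: "smooth_on U (D j (D i (\<lambda>p. T p $ k)))" by (rule smooth_on_partial_deriv[OF smooth_D])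

lemma T_nth: "p \<in> U \<Longrightarrow> frechet_derivative T (at p) (axis i 1) $ k = D i (\<lambda>p. T p $ k) p"
  using frechet_derivative_vec_nth[OF smooth_on_differentiable[OF T(1)] smooth_on_has_derivative[OF smooth]]
  by (simp add: partial_deriv_def)

lemma isometry_eq:
  assumes "p \<in> U"
  shows "- 2 * g (Y p) * D l X p * D m X p + D l X p * D m Z p + D l Z p * D m X p + D l Y p * D m Y p =
    metric_form (walker_metric (\<lambda>x. g)) p (axis l 1) (axis m 1)"
  using iso[OF assms, of "axis l 1" "axis m 1"] by (simp add: metric_form_walker T_nth[OF assms])

lemma comm: "p \<in> U \<Longrightarrow> D i (D j (\<lambda>p. T p $ k)) p = D j (D i (\<lambda>p. T p $ k)) p"
  by (rule partial_deriv_commute[OF U(1) smooth])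

lemma line_T: "p \<in> U \<Longrightarrow> ((\<lambda>t. T (p + t *\<^sub>R axis i 1) $ k) has_real_derivative D i (\<lambda>p. T p $ k) p) (at 0)"
  by (rule has_real_derivative_partial[OF smooth])

lemma line_D: "p \<in> U \<Longrightarrow> ((\<lambda>t. D l (\<lambda>p. T p $ k) (p + t *\<^sub>R axis i 1)) has_real_derivative
    D i (D l (\<lambda>p. T p $ k)) p) (at 0)"
  by (rule has_real_derivative_partial[OF smooth_D])

lemma line_DD: "p \<in> U \<Longrightarrow> ((\<lambda>t. D j (D l (\<lambda>p. T p $ k)) (p + t *\<^sub>R axis i 1)) has_real_derivative
    D i (D j (D l (\<lambda>p. T p $ k))) p) (at 0)"
  by (rule has_real_derivative_partial[OF smooth_DD])

lemma line_Y:
  assumes "p \<in> U" "\<forall>y>0. (e has_real_derivative e' y) (at y)"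
  shows "((\<lambda>t. e (Y (p + t *\<^sub>R axis i 1))) has_real_derivative e' (Y p) * D i Y p) (at 0)"
  using DERIV_chain2[of e "e' (Y p)" "\<lambda>t. Y (p + t *\<^sub>R axis i 1)" 0, OF _ line_T[OF assms(1)]]
    assms(2) pos(2)[OF assms(1)] by simp

lemma line_y:
  assumes "p \<in> U" "\<forall>y>0. (e has_real_derivative e' y) (at y)"
  shows "((\<lambda>t. e ((p + t *\<^sub>R axis i 1) $ 2)) has_real_derivative e' (p $ 2) * axis i 1 $ 2) (at 0)"
proof -
  have "((\<lambda>t. (p + t *\<^sub>R axis i 1) $ 2) has_real_derivative axis i 1 $ 2) (at 0)"
    by (auto intro!: derivative_eq_intros)
  from DERIV_chain2[OF _ this, of e "e' (p $ 2)"] show ?thesis using assms(2) pos(1)[OF assms(1)] by simp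
qed

text \<open>\<open>B i l m = \<langle>\<partial>\<^sub>i\<partial>\<^sub>lT, \<partial>\<^sub>mT\<rangle>\<close>; the usual Koszul combination of the differentiated isometry equations
  isolates it.\<close>

definition B :: "real^3 \<Rightarrow> 3 \<Rightarrow> 3 \<Rightarrow> 3 \<Rightarrow> real"
  where "B p i l m = - 2 * g (Y p) * D i (D l X) p * D m X p + D i (D l X) p * D m Z p
    + D i (D l Z) p * D m X p + D i (D l Y) p * D m Y p"

definition dG :: "real^3 \<Rightarrow> 3 \<Rightarrow> 3 \<Rightarrow> 3 \<Rightarrow> real"
  where "dG p i l m = (if i = 2 \<and> l = 1 \<and> m = 1 then - 2 * d1 (p $ 2) else 0)"

lemma isometry_eq_deriv:
  assumes p: "p \<in> U"
  shows "B p i l m + B p i m l - 2 * d1 (Y p) * D i Y p * D l X p * D m X p = dG p i l m"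
proof -
  let ?L = "\<lambda>p. - 2 * g (Y p) * D l X p * D m X p + D l X p * D m Z p + D l Z p * D m X p + D l Y p * D m Y p"
  have L: "((\<lambda>t. ?L (p + t *\<^sub>R axis i 1)) has_real_derivative
      B p i l m + B p i m l - 2 * d1 (Y p) * D i Y p * D l X p * D m X p) (at 0)"
    by (rule DERIV_cong, (rule DERIV_const line_Y[OF p d1] line_D[OF p] DERIV_add DERIV_cmult DERIV_mult)+) (simp add: B_def algebra_simps)
  let ?R = "\<lambda>p :: real^3. - 2 * g (p $ 2) * (axis l 1 $ 1) * (axis m 1 $ 1) + axis l 1 $ 1 * axis m 1 $ 3
      + axis l 1 $ 3 * axis m 1 $ 1 + axis l 1 $ 2 * axis m 1 $ 2"
  have "((\<lambda>t. ?R (p + t *\<^sub>R axis i 1)) has_real_derivative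
      - 2 * (d1 (p $ 2) * axis i 1 $ 2) * (axis l 1 $ 1) * (axis m 1 $ 1)) (at 0)"
    by (rule DERIV_cong, (rule DERIV_const line_y[OF p d1] DERIV_add DERIV_cmult DERIV_mult)+) simp
  moreover have "- 2 * (d1 (p $ 2) * axis i 1 $ 2) * (axis l 1 $ 1) * (axis m 1 $ 1) = dG p i l m"
    by (auto simp: dG_def axis_def)
  ultimately have R: "((\<lambda>t. ?R (p + t *\<^sub>R axis i 1)) has_real_derivative dG p i l m) (at 0)" by simp
  have "open ((\<lambda>t. p + t *\<^sub>R axis i 1) -` U)"
    by (rule open_vimage[OF U(1)]) (intro continuous_intros)
  then have "((\<lambda>t. ?R (p + t *\<^sub>R axis i 1)) has_real_derivative
      B p i l m + B p i m l - 2 * d1 (Y p) * D i Y p * D l X p * D m X p) (at 0)"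
    by (rule has_field_derivative_transform_within_open[OF L])
      (use p isometry_eq in \<open>auto simp: metric_form_walker\<close>)
  with R show ?thesis using DERIV_unique by blast
qed

lemma B_sym: "p \<in> U \<Longrightarrow> B p i l m = B p l i m"
  by (simp add: B_def comm[of p i l])

lemma koszul:
  assumes p: "p \<in> U"
  shows "2 * B p i l m = dG p i l m + dG p l i m - dG p m i l
    + 2 * d1 (Y p) * (D i Y p * D l X p * D m X p + D l Y p * D i X p * D m X p - D m Y p * D i X p * D l X p)"
  using isometry_eq_deriv[OF p, of i l m] isometry_eq_deriv[OF p, of l i m] isometry_eq_deriv[OF p, of m i l]
    B_sym[OF p, of l i m] B_sym[OF p, of m i l] B_sym[OF p, of m l i]
  by (simp add: algebra_simps)

text \<open>Pairing with the third direction extracts the X-component, so B is contracted with the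
  vector c that T' sends there. The terms of \<open>koszul\<close> that come from the target metric
  vanish, because dX and dY annihilate c; the entries of c are found by pairing with the images of
  the coordinate vectors.\<close>

lemma second_derivs_X:
  assumes p: "p \<in> U"
  shows "2 * D i (D l X) p = (dG p i l 1 + dG p l i 1 - dG p 1 i l) * D 3 X p
    + (dG p i l 2 + dG p l i 2 - dG p 2 i l) * D 2 X p"
proof -
  let ?T' = "frechet_derivative T (at p)"
  have lin: "linear ?T'" using smooth_on_has_derivative[OF T(1) p] has_derivative_linear by blast
  have "inj ?T'"
    unfolding linear_injective_0[OF lin]
  proof (intro allI impI)
    fix v assume "?T' v = 0"
    then have "metric_form (walker_metric (\<lambda>x. g)) p v w = 0" for w
      using iso[OF p, of v w] by (simp add: metric_form_walker)
    from this[of "axis 3 1"] this[of "axis 2 1"] this[of "axis 1 1"] show "v = 0"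
      by (simp add: metric_form_walker axis_def vec_eq_iff forall_3)
  qed
  then have "surj ?T'" using linear_injective_imp_surjective[OF lin] by simp
  then obtain c where c: "?T' c = axis 3 1" by (metis surjD)
  have ce: "(\<Sum>m\<in>UNIV. c $ m *\<^sub>R axis m 1) = c"
    using basis_expansion[of c] by (simp add: scalar_mult_eq_scaleR)
  have "?T' (\<Sum>m\<in>UNIV. c $ m *\<^sub>R axis m 1) = (\<Sum>m\<in>UNIV. c $ m *\<^sub>R ?T' (axis m 1))"
    by (simp only: linear_sum[OF lin] linear_scale[OF lin])
  then have "?T' c = (\<Sum>m\<in>UNIV. c $ m *\<^sub>R ?T' (axis m 1))" by (simp only: ce)
  then have Tc: "?T' c $ k = (\<Sum>m\<in>UNIV. c $ m * D m (\<lambda>p. T p $ k) p)" for k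
    by (simp add: T_nth[OF p])
  have ck: "c $ 1 * D 1 X p + c $ 2 * D 2 X p + c $ 3 * D 3 X p = 0"
    "c $ 1 * D 1 Y p + c $ 2 * D 2 Y p + c $ 3 * D 3 Y p = 0"
    "c $ 1 * D 1 Z p + c $ 2 * D 2 Z p + c $ 3 * D 3 Z p = 1"
    using Tc[of 1] Tc[of 2] Tc[of 3] unfolding c sum_3 by (simp_all add: axis_def)
  have c12: "c $ 1 = D 3 X p" "c $ 2 = D 2 X p"
    using iso[OF p, of c "axis 3 1"] iso[OF p, of c "axis 2 1"] T_nth[OF p]
    unfolding c by (simp_all add: metric_form_walker axis_def)
  have "2 * D i (D l X) p = c $ 1 * (2 * B p i l 1) + c $ 2 * (2 * B p i l 2) + c $ 3 * (2 * B p i l 3)"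
    unfolding B_def using ck by algebra
  also have "\<dots> = (dG p i l 1 + dG p l i 1 - dG p 1 i l) * c $ 1 + (dG p i l 2 + dG p l i 2 - dG p 2 i l) * c $ 2
      + (dG p i l 3 + dG p l i 3 - dG p 3 i l) * c $ 3"
    unfolding koszul[OF p] using ck by algebra
  also have "dG p i l 3 + dG p l i 3 - dG p 3 i l = 0" by (simp add: dG_def)
  finally show ?thesis by (simp add: c12)
qed

lemma X_derivs:
  assumes p: "p \<in> U"
  shows "D 1 (D 1 X) p = d1 (p $ 2) * D 2 X p" "D 2 (D 1 X) p = - (d1 (p $ 2) * D 3 X p)"
    "D 1 (D 3 X) p = 0" "D 2 (D 2 X) p = 0" "D 2 (D 3 X) p = 0"
  using second_derivs_X[OF p, of 1 1] second_derivs_X[OF p, of 2 1] second_derivs_X[OF p, of 1 3]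
    second_derivs_X[OF p, of 2 2] second_derivs_X[OF p, of 2 3]
  by (simp_all add: dG_def)

text \<open>X_112 computed in two ways: X_11 = g' X_2 gives g'' X_2 because X_22 = 0, and X_12 = -
  g' X_3 gives 0 because X_13 = 0.\<close>

lemma X2: assumes p: "p \<in> U" shows "D 2 X p = 0"
proof -
  have "D 2 (D 1 (D 1 X)) p = d1 (p $ 2) * D 2 (D 2 X) p + d2 (p $ 2) * (axis 2 1 :: real^3) $ 2 * D 2 X p"
    by (rule partial_deriv_eqI[OF U(1) smooth_DD p], erule X_derivs(1))
      (rule DERIV_cong, (rule line_y[OF p d2] line_D[OF p] DERIV_mult)+, simp)
  moreover have "D 1 (D 2 (D 1 X)) p = 0"
    by (rule partial_deriv_eqI[OF U(1) smooth_DD p], erule X_derivs(2))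
      (rule DERIV_cong, (rule DERIV_minus line_y[OF p d2] line_D[OF p] DERIV_mult)+, simp add: X_derivs(3)[OF p] axis_def)
  moreover have "D 2 (D 1 (D 1 X)) p = D 1 (D 2 (D 1 X)) p"
    by (rule partial_deriv_commute[OF U(1) smooth_D p])
  ultimately show ?thesis using d2_nz[OF pos(1)[OF p]] by (simp add: X_derivs(4)[OF p] axis_def)
qed

lemma D_zero: "(\<And>q. q \<in> U \<Longrightarrow> D l (\<lambda>p. T p $ k) q = c) \<Longrightarrow> p \<in> U \<Longrightarrow> D i (D l (\<lambda>p. T p $ k)) p = 0"
  by (rule partial_deriv_eqI[OF U(1) smooth_D]) auto

text \<open>X_2 = 0 makes X_12 = - g' X_3 vanish, and g' has no zeros.\<close>

lemma X3: assumes p: "p \<in> U" shows "D 3 X p = 0"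
proof -
  have "D 2 (D 1 X) p = 0" using D_zero[of 2 1 0 p 1] X2 comm[OF p, of 1 2 1] p by simp
  then show ?thesis using X_derivs(2)[OF p] d1_nz[OF pos(1)[OF p]] by simp
qed

lemma first_derivs:
  assumes p: "p \<in> U"
  shows "D 1 X p * D 3 Z p = 1" "D 3 Y p = 0" "D 2 Y p * D 2 Y p = 1"
    "D 1 X p * D 2 Z p + D 1 Y p * D 2 Y p = 0"
    "- 2 * g (Y p) * D 1 X p * D 1 X p + 2 * D 1 X p * D 1 Z p + D 1 Y p * D 1 Y p = - 2 * g (p $ 2)"
  using isometry_eq[OF p, of 1 3] isometry_eq[OF p, of 3 3] isometry_eq[OF p, of 2 2]
    isometry_eq[OF p, of 1 2] isometry_eq[OF p, of 1 1]
  by (simp_all add: metric_form_walker X2[OF p] X3[OF p] axis_def)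

lemma Y2_derivs: assumes p: "p \<in> U" shows "D i (D 2 Y) p = 0"
proof -
  have "((\<lambda>t. D 2 Y (p + t *\<^sub>R axis i 1) * D 2 Y (p + t *\<^sub>R axis i 1)) has_real_derivative
      D i (D 2 Y) p * D 2 Y p + D i (D 2 Y) p * D 2 Y p) (at 0)"
    using DERIV_mult[OF line_D[OF p, of 2 2 i] line_D[OF p, of 2 2 i]] by simp
  moreover have "((\<lambda>t. D 2 Y (p + t *\<^sub>R axis i 1) * D 2 Y (p + t *\<^sub>R axis i 1)) has_real_derivative 0) (at 0)"
  proof (rule has_field_derivative_transform_within_open[OF DERIV_const])
    show "open ((\<lambda>t. p + t *\<^sub>R axis i 1) -` U)"
      by (rule open_vimage[OF U(1)]) (intro continuous_intros)
  qed (use p first_derivs(3) in auto)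
  ultimately have "D i (D 2 Y) p * D 2 Y p + D i (D 2 Y) p * D 2 Y p = 0" using DERIV_unique by blast
  then show ?thesis using first_derivs(3)[OF p] by auto
qed

lemma X1_derivs: "p \<in> U \<Longrightarrow> D 1 (D 1 X) p = 0" "p \<in> U \<Longrightarrow> D 2 (D 1 X) p = 0"
  by (simp_all add: X_derivs X2 X3)

text \<open>The (1,1) isometry equation differentiated in y and the (1,2) equation differentiated in
  x share Z_12; eliminating it leaves a relation free of Z.\<close>

lemma relation_1:
  assumes p: "p \<in> U"
  shows "d1 (Y p) * D 2 Y p * D 1 X p * D 1 X p + D 1 (D 1 Y) p * D 2 Y p = d1 (p $ 2)"
proof -
  have op: "open ((\<lambda>t. p + t *\<^sub>R axis i 1) -` U)" for i
    by (rule open_vimage[OF U(1)]) (intro continuous_intros)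
  have Y21: "D 2 (D 1 Y) p = 0" "D 1 (D 2 Y) p = 0" using Y2_derivs[OF p] comm[OF p, of 2 1 2] by simp_all
  let ?L = "\<lambda>p. - 2 * g (Y p) * D 1 X p * D 1 X p + 2 * D 1 X p * D 1 Z p + D 1 Y p * D 1 Y p"
  have "((\<lambda>t. ?L (p + t *\<^sub>R axis 2 1)) has_real_derivative
      - 2 * (d1 (Y p) * D 2 Y p) * D 1 X p * D 1 X p + 2 * D 1 X p * D 2 (D 1 Z) p) (at 0)"
    by (rule DERIV_cong, (rule DERIV_const line_Y[OF p d1] line_D[OF p] DERIV_add DERIV_cmult DERIV_mult)+)
      (simp add: X1_derivs[OF p] Y21)
  moreover have "((\<lambda>t. ?L (p + t *\<^sub>R axis 2 1)) has_real_derivative - 2 * (d1 (p $ 2) * (axis 2 1 :: real^3) $ 2)) (at 0)"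
    by (rule has_field_derivative_transform_within_open[OF DERIV_cmult[OF line_y[OF p d1]] op[of 2]])
      (use p first_derivs(5) in auto)
  ultimately have 1: "- 2 * (d1 (Y p) * D 2 Y p) * D 1 X p * D 1 X p + 2 * D 1 X p * D 2 (D 1 Z) p =
      - 2 * (d1 (p $ 2) * (axis 2 1 :: real^3) $ 2)" by (rule DERIV_unique)
  let ?L = "\<lambda>p. D 1 X p * D 2 Z p + D 1 Y p * D 2 Y p"
  have "((\<lambda>t. ?L (p + t *\<^sub>R axis 1 1)) has_real_derivative
      D 1 X p * D 1 (D 2 Z) p + D 1 (D 1 Y) p * D 2 Y p) (at 0)"
    by (rule DERIV_cong, (rule DERIV_const line_D[OF p] DERIV_add DERIV_cmult DERIV_mult)+) (simp add: X1_derivs[OF p] Y21)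
  moreover have "((\<lambda>t. ?L (p + t *\<^sub>R axis 1 1)) has_real_derivative 0) (at 0)"
    by (rule has_field_derivative_transform_within_open[OF DERIV_const op[of 1]])
      (use p first_derivs(4) in auto)
  ultimately have 2: "D 1 X p * D 1 (D 2 Z) p + D 1 (D 1 Y) p * D 2 Y p = 0" by (rule DERIV_unique)
  show ?thesis using 1 2 comm[OF p, of 2 1 3] by (simp add: axis_def algebra_simps)
qed

text \<open>The y-derivative of \<open>relation_1\<close>. It is the transformation law of the
  curvature coefficient g'', with X_1 the area factor of T up to sign.\<close>

lemma relation_2:
  assumes p: "p \<in> U"
  shows "d2 (Y p) * D 1 X p * D 1 X p = d2 (p $ 2)"
proof -
  have op: "open ((\<lambda>t. p + t *\<^sub>R axis 2 1) -` U)"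
    by (rule open_vimage[OF U(1)]) (intro continuous_intros)
  have "D 2 (D 1 (D 1 Y)) p = D 1 (D 2 (D 1 Y)) p" by (rule partial_deriv_commute[OF U(1) smooth_D p])
  also have "\<dots> = 0"
    by (rule partial_deriv_eqI[OF U(1) smooth_DD p, where B = "\<lambda>_. 0"]) (use comm[of _ 2 1 2] Y2_derivs in auto)
  finally have Y112: "D 2 (D 1 (D 1 Y)) p = 0" .
  let ?L = "\<lambda>p. d1 (Y p) * D 2 Y p * D 1 X p * D 1 X p + D 1 (D 1 Y) p * D 2 Y p"
  have "((\<lambda>t. ?L (p + t *\<^sub>R axis 2 1)) has_real_derivative
      d2 (Y p) * D 2 Y p * D 2 Y p * D 1 X p * D 1 X p) (at 0)"
    by (rule DERIV_cong, (rule DERIV_const line_Y[OF p d2] line_D[OF p] line_DD[OF p] DERIV_add DERIV_cmult DERIV_mult)+)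
      (simp add: X1_derivs[OF p] Y2_derivs[OF p] Y112)
  moreover have "((\<lambda>t. ?L (p + t *\<^sub>R axis 2 1)) has_real_derivative d2 (p $ 2) * (axis 2 1 :: real^3) $ 2) (at 0)"
    by (rule has_field_derivative_transform_within_open[OF line_y[OF p d2] op]) (use p relation_1 in auto)
  ultimately have "d2 (Y p) * D 2 Y p * D 2 Y p * D 1 X p * D 1 X p = d2 (p $ 2) * (axis 2 1 :: real^3) $ 2" by (rule DERIV_unique)
  moreover have "d2 (Y p) * D 2 Y p * D 2 Y p * D 1 X p * D 1 X p = (D 2 Y p * D 2 Y p) * (d2 (Y p) * D 1 X p * D 1 X p)"
    by simp
  ultimately show ?thesis unfolding first_derivs(3)[OF p] by (simp add: axis_def)
qed

lemma relation_3:
  assumes p: "p \<in> U"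
  shows "d3 (Y p) * D 2 Y p * D 1 X p * D 1 X p = d3 (p $ 2)"
proof -
  have op: "open ((\<lambda>t. p + t *\<^sub>R axis 2 1) -` U)"
    by (rule open_vimage[OF U(1)]) (intro continuous_intros)
  let ?L = "\<lambda>p. d2 (Y p) * D 1 X p * D 1 X p"
  have "((\<lambda>t. ?L (p + t *\<^sub>R axis 2 1)) has_real_derivative d3 (Y p) * D 2 Y p * D 1 X p * D 1 X p) (at 0)"
    by (rule DERIV_cong, (rule DERIV_const line_Y[OF p d3] line_D[OF p] DERIV_add DERIV_cmult DERIV_mult)+) (simp add: X1_derivs[OF p])
  moreover have "((\<lambda>t. ?L (p + t *\<^sub>R axis 2 1)) has_real_derivative d3 (p $ 2) * (axis 2 1 :: real^3) $ 2) (at 0)"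
    by (rule has_field_derivative_transform_within_open[OF line_y[OF p d3] op]) (use p relation_2 in auto)
  ultimately have "d3 (Y p) * D 2 Y p * D 1 X p * D 1 X p = d3 (p $ 2) * (axis 2 1 :: real^3) $ 2" by (rule DERIV_unique)
  then show ?thesis by (simp add: axis_def)
qed

text \<open>The quotient of \<open>relation_3\<close> and \<open>relation_2\<close> compares g''' /
  g'' at both points: r Y_2 / Y = r / y. Hence Y = Y_2 y with Y_2 = 1 or -1, and both heights are
  positive.\<close>

lemma preserves_y:
  assumes p: "p \<in> U"
  shows "T p $ 2 = p $ 2"
proof -
  let ?y = "p $ 2" and ?e = "D 2 Y p" and ?a = "D 1 X p"
  note pos = pos[OF p]
  have "d3 ?y * ?y * Y p = (d3 (Y p) * Y p) * ?e * ?a * ?a * ?y"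
    unfolding relation_3[OF p, symmetric] by simp
  also have "\<dots> = r * ?e * ?y * (d2 (Y p) * ?a * ?a)" unfolding ratio[OF pos(2)] by simp
  also have "\<dots> = r * ?e * ?y * d2 ?y" unfolding relation_2[OF p] ..
  finally have "(r * d2 ?y) * Y p = (r * d2 ?y) * (?e * ?y)"
    unfolding ratio[OF pos(1)] by (simp add: mult_ac)
  then have Y: "Y p = ?e * ?y" using r d2_nz[OF pos(1)] by simp
  have "?e = 1 \<or> ?e = - 1" using first_derivs(3)[OF p] by (simp add: square_eq_1_iff)
  then show ?thesis using Y pos by auto
qed

end


section \<open>The model spaces\<close>

text \<open>The slope \<open>m1\<close> absorbs the additive constant by which a logarithm changes under scaling.\<close>

lemma model_homothety:
  fixes g :: "real \<Rightarrow> real"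
  assumes l: "l \<noteq> 0" and \<mu>: "\<mu> > 0" and U: "open U"
    and inv: "\<And>p. p \<in> U \<longleftrightarrow> walker_map l x1 \<mu> (\<lambda>_. b) (\<lambda>x. m1 * x + m0) p \<in> U"
    and eq: "\<And>p. p \<in> U \<Longrightarrow> \<mu>\<^sup>2 * g (p $ 2) = l\<^sup>2 * g (\<mu> * p $ 2 + b) - l * m1"
  shows "homothety_between \<mu> U (walker_metric (\<lambda>x y. g y)) U (walker_metric (\<lambda>x y. g y))
    (walker_map l x1 \<mu> (\<lambda>_. b) (\<lambda>x. m1 * x + m0))"
proof -
  have id: "smooth_on UNIV (\<lambda>x::real. x)" by (rule smooth_on_bounded_linear) (rule bounded_linear_ident)
  interpret W: walker_map_data UNIV l x1 \<mu> "\<lambda>_. b" "\<lambda>x. m1 * x + m0"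
    using l \<mu> by unfold_locales (auto intro!: smooth_on_const smooth_on_add smooth_on_mult id)
  have dm: "deriv (\<lambda>x. m1 * x + m0) x = m1" for x
    by (rule DERIV_imp_deriv) (auto intro!: derivative_eq_intros)
  have db: "deriv (\<lambda>_::real. b) = (\<lambda>_. 0)" by (rule ext) simp
  have "homothety_between \<mu> U (walker_metric (\<lambda>x y. g y)) (W.T ` U) (walker_metric (\<lambda>x y. g y)) W.T"
    by (rule W.homothety_T[OF U]) (use eq in \<open>simp_all add: dm db\<close>)
  moreover have "W.T ` U = U"
  proof
    show "W.T ` U \<subseteq> U" using inv by blast
    show "U \<subseteq> W.T ` U"
    proof
      fix q assume "q \<in> U"
      then have "W.T (W.T_inv q) \<in> U" by (simp only: W.T_T_inv)
      then have "W.T_inv q \<in> U" using inv by blast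
      then show "q \<in> W.T ` U" using W.T_T_inv[of q] by force
    qed
  qed
  ultimately show ?thesis by simp
qed

lemma exp_model_homogeneous:
  assumes "a \<noteq> 0"
  shows "homogeneous UNIV (walker_metric (\<lambda>x y. s * exp (a * y)))"
  unfolding homogeneous_def
proof (intro ballI)
  fix P Q :: "real^3"
  define b where "b = Q $ 2 - P $ 2"
  \<comment> \<open>Raising y by b multiplies the exponential by e^(a b), which l^2 undoes.\<close>
  define l where "l = exp (- a * b / 2)"
  let ?T = "walker_map l (Q $ 1 - l * P $ 1) 1 (\<lambda>_. b) (\<lambda>x. 0 * x + (Q $ 3 - P $ 3 / l))"
  have l: "l \<noteq> 0" by (simp add: l_def)
  have "l\<^sup>2 * exp (a * (y + b)) = exp (a * y)" for y
    by (simp add: l_def power2_eq_square exp_add[symmetric] algebra_simps)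
  then have "isometry_between UNIV (walker_metric (\<lambda>x y. s * exp (a * y))) UNIV (walker_metric (\<lambda>x y. s * exp (a * y))) ?T"
    by (intro model_homothety l) (auto simp: mult.left_commute[of _ s])
  moreover have "?T P = Q"
    by (simp add: vec_eq_iff forall_3 b_def)
  ultimately show "\<exists>T. isometry_between UNIV (walker_metric (\<lambda>x y. s * exp (a * y))) UNIV
      (walker_metric (\<lambda>x y. s * exp (a * y))) T \<and> T P = Q" by blast
qed

lemma open_upper_half: "open upper_half"
  unfolding upper_half_def by (intro open_Collect_less continuous_intros)

text \<open>A dilation of y by the quotient of the heights reaches the level of Q, and translations
  in x and in the third coordinate do the rest. The hypothesis says that an x-scale l restores g up
  to a constant.\<close>

lemma half_space_homothety_homogeneous:
  assumes "\<And>\<mu>. \<mu> > 0 \<Longrightarrow> \<exists>l m1. l \<noteq> 0 \<and> (\<forall>y>0. \<mu>\<^sup>2 * g y = l\<^sup>2 * g (\<mu> * y) - l * m1)"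
  shows "homothety_homogeneous upper_half (walker_metric (\<lambda>x y. g y))"
  unfolding homothety_homogeneous_def
proof (intro ballI)
  fix P Q :: "real^3" assume PQ: "P \<in> upper_half" "Q \<in> upper_half"
  define \<mu> where "\<mu> = Q $ 2 / P $ 2"
  have \<mu>: "\<mu> > 0" using PQ by (simp add: \<mu>_def upper_half_def)
  obtain l m1 where l: "l \<noteq> 0" "\<And>y. y > 0 \<Longrightarrow> \<mu>\<^sup>2 * g y = l\<^sup>2 * g (\<mu> * y) - l * m1"
    using assms[OF \<mu>] by blast
  let ?T = "walker_map l (Q $ 1 - l * P $ 1) \<mu> (\<lambda>_. 0) (\<lambda>x. m1 * x + (Q $ 3 - \<mu>\<^sup>2 / l * P $ 3 - m1 * P $ 1))"
  have "homothety_between \<mu> upper_half (walker_metric (\<lambda>x y. g y)) upper_half (walker_metric (\<lambda>x y. g y)) ?T"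
    by (rule model_homothety[OF l(1) \<mu> open_upper_half])
      (use l(2) \<mu> in \<open>auto simp: upper_half_def zero_less_mult_iff\<close>)
  moreover have "?T P = Q"
    using PQ by (auto simp: vec_eq_iff forall_3 \<mu>_def upper_half_def)
  ultimately show "\<exists>c>0. \<exists>T. homothety_between c upper_half (walker_metric (\<lambda>x y. g y)) upper_half (walker_metric (\<lambda>x y. g y)) T \<and> T P = Q"
    using \<mu> by blast
qed

lemma half_space_translation:
  assumes "P $ 2 = Q $ 2"
  shows "\<exists>T. isometry_between upper_half (walker_metric (\<lambda>x y. g y)) upper_half (walker_metric (\<lambda>x y. g y)) T \<and> T P = Q"
proof -
  let ?T = "walker_map 1 (Q $ 1 - P $ 1) 1 (\<lambda>_. 0) (\<lambda>x. 0 * x + (Q $ 3 - P $ 3))"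
  have "isometry_between upper_half (walker_metric (\<lambda>x y. g y)) upper_half (walker_metric (\<lambda>x y. g y)) ?T"
    by (rule model_homothety[OF _ _ open_upper_half]) (auto simp: upper_half_def)
  moreover have "?T P = Q" using assms by (simp add: vec_eq_iff forall_3)
  ultimately show ?thesis by blast
qed

text \<open>The ratio condition makes the coordinate \<open>y\<close> itself a local isometry invariant.\<close>

locale half_space_model =
  fixes g d1 d2 d3 :: "real \<Rightarrow> real" and r :: real
  assumes d1: "\<forall>y>0. (g has_real_derivative d1 y) (at y)"
    and d2: "\<forall>y>0. (d1 has_real_derivative d2 y) (at y)"
    and d3: "\<forall>y>0. (d2 has_real_derivative d3 y) (at y)"
    and d1_nz: "\<And>y. y > 0 \<Longrightarrow> d1 y \<noteq> 0"
    and d2_nz: "\<And>y. y > 0 \<Longrightarrow> d2 y \<noteq> 0"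
    and ratio: "\<And>y. y > 0 \<Longrightarrow> d3 y * y = r * d2 y" and r: "r \<noteq> 0"
begin

abbreviation model_metric :: "3 metric" where "model_metric \<equiv> walker_metric (\<lambda>x y. g y)"

lemma isometry_preserves_y:
  assumes "open U" "U \<subseteq> upper_half" "V \<subseteq> upper_half" "isometry_between U model_metric V model_metric T" "p \<in> U"
  shows "T p $ 2 = p $ 2"
proof -
  have "smooth_on U T" "\<And>p. p \<in> U \<Longrightarrow> T p \<in> upper_half"
    using assms(3,4) unfolding homothety_between_def diffeomorphism_between_def homeomorphism_def by blast+
  then interpret model_isometry g d1 d2 d3 U T r
    using assms d1 d2 d3 d1_nz d2_nz ratio r
    by unfold_locales (auto simp: homothety_between_def)
  show ?thesis by (rule preserves_y[OF assms(5)])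
qed

lemma not_locally_homogeneous: "\<not> locally_homogeneous upper_half model_metric"
proof
  assume "locally_homogeneous upper_half model_metric"
  moreover have "vector [0, 1, 0] \<in> upper_half" "vector [0, 2, 0] \<in> upper_half" by (auto simp: upper_half_def)
  ultimately have "locally_isometric_at upper_half model_metric (vector [0, 1, 0]) upper_half model_metric (vector [0, 2, 0])"
    unfolding locally_homogeneous_def by blast
  then obtain U V T where U: "open U" "vector [0, 1, 0] \<in> U" "U \<subseteq> upper_half" "V \<subseteq> upper_half"
    "isometry_between U model_metric V model_metric T" and T: "T (vector [0, 1, 0]) = vector [0, 2, 0]"
    unfolding locally_isometric_at_def by blast
  have "T (vector [0, 1, 0]) $ 2 = (vector [0, 1, 0] :: real^3) $ 2"
    by (rule isometry_preserves_y[OF U(1,3,4,5,2)])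
  then show False unfolding T by simp
qed

text \<open>Rigidity confines an orbit to one level of y, and translations fill that level.\<close>

lemma orbit: "P \<in> upper_half \<Longrightarrow> isometry_orbit upper_half model_metric P = {q. q $ 2 = P $ 2}"
proof (intro equalityI subsetI)
  fix q assume P: "P \<in> upper_half" and "q \<in> isometry_orbit upper_half model_metric P"
  then show "q \<in> {q. q $ 2 = P $ 2}"
    using isometry_preserves_y[OF open_upper_half subset_refl subset_refl _ P]
    by (auto simp: isometry_orbit_def)
next
  fix q :: "real^3" assume "q \<in> {q. q $ 2 = P $ 2}"
  then show "q \<in> isometry_orbit upper_half model_metric P"
    using half_space_translation[of P q g] by (force simp: isometry_orbit_def)
qed

lemma cohomogeneity_one: "cohomogeneity_one upper_half model_metric"
  unfolding cohomogeneity_one_def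
proof
  fix P :: "real^3" assume P: "P \<in> upper_half"
  let ?F = "\<lambda>q :: real^3. q $ 2 - P $ 2"
  have D: "(?F has_derivative (\<lambda>v. v $ 2 - 0)) (at q)" for q
    by (intro has_derivative_diff has_derivative_const bounded_linear_imp_has_derivative bounded_linear_vec_nth)
  have "frechet_derivative ?F (at q) \<noteq> (\<lambda>v. 0)" for q
    using frechet_derivative_at[OF D, symmetric, of q] fun_cong[of "\<lambda>v :: real^3. v $ 2 - 0" "\<lambda>v. 0" "axis 2 1"]
    by (auto simp: axis_def)
  moreover have "smooth_on UNIV ?F"
    by (intro smooth_on_diff smooth_on_const smooth_on_bounded_linear bounded_linear_vec_nth open_UNIV)
  ultimately show "smooth_hypersurface (isometry_orbit upper_half model_metric P)"
    unfolding smooth_hypersurface_def orbit[OF P]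
    by (intro ballI exI[of _ UNIV] exI[of _ ?F]) auto
qed

end

lemma ln_model:
  assumes "s \<noteq> 0"
  shows "homothety_homogeneous upper_half (walker_metric (\<lambda>x y. s * ln y))"
    "\<not> locally_homogeneous upper_half (walker_metric (\<lambda>x y. s * ln y))"
    "cohomogeneity_one upper_half (walker_metric (\<lambda>x y. s * ln y))"
proof -
  show "homothety_homogeneous upper_half (walker_metric (\<lambda>x y. s * ln y))"
  proof (rule half_space_homothety_homogeneous)
    fix \<mu> :: real assume "\<mu> > 0"
    then show "\<exists>l m1. l \<noteq> 0 \<and> (\<forall>y>0. \<mu>\<^sup>2 * (s * ln y) = l\<^sup>2 * (s * ln (\<mu> * y)) - l * m1)"
      \<comment> \<open>With l = \<mu> the extra term \<mu>^2 s ln \<mu> must equal l m1.\<close>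
      by (intro exI[of _ \<mu>] exI[of _ "\<mu> * s * ln \<mu>"]) (auto simp: ln_mult power2_eq_square algebra_simps)
  qed
  interpret half_space_model "\<lambda>y. s * ln y" "\<lambda>y. s / y" "\<lambda>y. - s / y\<^sup>2" "\<lambda>y. 2 * s / y ^ 3" "- 2"
    using assms
    by unfold_locales
      (auto intro!: derivative_eq_intros simp: power2_eq_square power3_eq_cube divide_simps)
  show "\<not> locally_homogeneous upper_half (walker_metric (\<lambda>x y. s * ln y))" by (rule not_locally_homogeneous)
  show "cohomogeneity_one upper_half (walker_metric (\<lambda>x y. s * ln y))" by (rule cohomogeneity_one)
qed

lemma powr_model:
  assumes s: "s \<noteq> 0" and e: "e \<notin> {0, 1, 2}"
  shows "homothety_homogeneous upper_half (walker_metric (\<lambda>x y. s * y powr e))"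
    "\<not> locally_homogeneous upper_half (walker_metric (\<lambda>x y. s * y powr e))"
    "cohomogeneity_one upper_half (walker_metric (\<lambda>x y. s * y powr e))"
proof -
  show "homothety_homogeneous upper_half (walker_metric (\<lambda>x y. s * y powr e))"
  proof (rule half_space_homothety_homogeneous)
    fix \<mu> :: real assume \<mu>: "\<mu> > 0"
    \<comment> \<open>l is determined by l^2 \<mu>^e = \<mu>^2.\<close>
    have eq: "(\<mu> powr ((2 - e) / 2))\<^sup>2 * (s * (\<mu> * y) powr e) = \<mu>\<^sup>2 * (s * y powr e)" if "y > 0" for y
    proof -
      have "(\<mu> powr ((2 - e) / 2))\<^sup>2 * \<mu> powr e = \<mu> powr ((2 - e) / 2 + (2 - e) / 2 + e)"
        by (simp only: powr_add power2_eq_square)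
      also have "\<dots> = \<mu>\<^sup>2" using \<mu> by (simp add: field_simps flip: powr_numeral)
      finally show ?thesis using \<mu> that by (simp add: powr_mult)
    qed
    show "\<exists>l m1. l \<noteq> 0 \<and> (\<forall>y>0. \<mu>\<^sup>2 * (s * y powr e) = l\<^sup>2 * (s * (\<mu> * y) powr e) - l * m1)"
    proof (rule exI[of _ "\<mu> powr ((2 - e) / 2)"], rule exI[of _ 0], intro conjI allI impI)
      show "\<mu> powr ((2 - e) / 2) \<noteq> 0" using \<mu> by simp
    qed (simp only: eq mult_zero_right diff_zero)
  qed
  have p: "y powr (e - 3) * y = y powr (e - 2)" if "y > 0" for y
    using powr_add[of y "e - 3" 1] that by simp
  interpret half_space_model "\<lambda>y. s * y powr e" "\<lambda>y. s * e * y powr (e - 1)"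
    "\<lambda>y. s * e * (e - 1) * y powr (e - 2)" "\<lambda>y. s * e * (e - 1) * (e - 2) * y powr (e - 3)" "e - 2"
    using s e
    by unfold_locales (auto intro!: derivative_eq_intros simp: p diff_diff_eq)
  show "\<not> locally_homogeneous upper_half (walker_metric (\<lambda>x y. s * y powr e))" by (rule not_locally_homogeneous)
  show "cohomogeneity_one upper_half (walker_metric (\<lambda>x y. s * y powr e))" by (rule cohomogeneity_one)
qed

section \<open>Equivalences for quadratic profiles and the combined statement\<close>

lemma quadratic_form_imp_locally:
  assumes "open M" "quadratic_form_on M f a x0"
  shows "locally_quadratic_form_on M f a x0"
  using assms unfolding locally_quadratic_form_on_def by blast

context walker
begin

lemma quadratic_case:
  assumes M: "connected M" "M \<noteq> {}" and u0: "\<And>q. q \<in> S \<Longrightarrow> u q \<noteq> 0"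
    and \<alpha>: "\<And>x y. (x, y) \<in> S \<Longrightarrow> u (x, y) = \<alpha> x" "\<And>x. x \<in> x_image M \<Longrightarrow> deriv \<alpha> x \<noteq> 0"
  shows "homothety_curvature_homogeneous 1 M (walker_metric f) \<longleftrightarrow>
      (\<exists>a x0. a \<noteq> 0 \<and> locally_quadratic_form_on M f a x0)" (is "?H \<longleftrightarrow> ?L")
    and "connected_y_slices M \<Longrightarrow> homothety_curvature_homogeneous 1 M (walker_metric f) \<longleftrightarrow>
      (\<exists>a x0. a \<noteq> 0 \<and> quadratic_form_on M f a x0)"
proof -
  have LH: ?H if "locally_quadratic_form_on M f a x0" for a x0
    by (rule inverse_square_homothety[OF quadratic_form_u[OF that]])
  have HL: "\<exists>a x0. a \<noteq> 0 \<and> x0 \<notin> x_image M \<and> (\<forall>q\<in>S. u q = 2 * a * inverse ((fst q - x0)\<^sup>2))" if ?H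
    using homothety_inverse_square[OF M \<alpha>(1) u0 \<alpha>(2) that] by metis
  show "?H \<longleftrightarrow> ?L"
    using LH HL locally_quadratic_form_onI by blast
  assume slices: "connected_y_slices M"
  show "?H \<longleftrightarrow> (\<exists>a x0. a \<noteq> 0 \<and> quadratic_form_on M f a x0)"
  proof
    assume ?H
    then obtain a x0 where "a \<noteq> 0" "x0 \<notin> x_image M" "\<forall>q\<in>S. u q = 2 * a * inverse ((fst q - x0)\<^sup>2)"
      using HL by blast
    then show "\<exists>a x0. a \<noteq> 0 \<and> quadratic_form_on M f a x0"
      using quadratic_form_on_slices[OF open_M subset_refl slices] by blast
  qed (use LH quadratic_form_imp_locally[OF open_M] in blast)
qed

end

theorem theorem1p16:
  fixes M :: "(real^3) set" and f :: "real \<Rightarrow> real \<Rightarrow> real"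
  assumes "open M" and "connected M" and "smooth_xy_on M f"
    and fyy_nonzero: "\<forall>(x, y)\<in>xy_image M. (deriv ^^ 2) (f x) y \<noteq> 0"
    and fyy_nonconstant: "\<not> (\<exists>c. \<forall>(x, y)\<in>xy_image M. (deriv ^^ 2) (f x) y = c)"
  shows
    "((\<forall>(x, y)\<in>xy_image M. (deriv ^^ 3) (f x) y \<noteq> 0) \<longrightarrow>
        homothety_curvature_homogeneous 1 M (walker_metric f))
     \<and>
     (\<forall>\<alpha> :: real \<Rightarrow> real.
        (\<forall>(x, y)\<in>xy_image M. (deriv ^^ 2) (f x) y = \<alpha> x) \<and> (\<forall>x\<in>x_image M. deriv \<alpha> x \<noteq> 0) \<longrightarrow>
          (connected_y_slices M \<longrightarrow>
             (homothety_curvature_homogeneous 1 M (walker_metric f) \<longleftrightarrow>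
                (\<exists>a x0. a \<noteq> 0 \<and> quadratic_form_on M f a x0))) \<and>
          (homothety_curvature_homogeneous 1 M (walker_metric f) \<longleftrightarrow>
             (\<exists>a x0. a \<noteq> 0 \<and> locally_quadratic_form_on M f a x0)) \<and>
          ((\<exists>a x0. a \<noteq> 0 \<and> locally_quadratic_form_on M f a x0) \<longrightarrow>
             locally_homogeneous M (walker_metric f)))
     \<and>
     (homothety_curvature_homogeneous 2 M (walker_metric f) \<and>
      (\<forall>(x, y)\<in>xy_image M. (deriv ^^ 3) (f x) y \<noteq> 0) \<longrightarrow>
        (\<exists>s\<in>{1, -1}. \<exists>a. a \<noteq> 0 \<and>
           locally_isometric M (walker_metric f)
             UNIV (walker_metric (\<lambda>x y. s * exp (a * y)))) \<or>
        (\<exists>s\<in>{1, -1}.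
           locally_isometric M (walker_metric f)
             upper_half (walker_metric (\<lambda>x y. s * ln y))) \<or>
        (\<exists>s\<in>{1, -1}. \<exists>\<epsilon>. \<epsilon> \<notin> {0, 1, 2} \<and>
           locally_isometric M (walker_metric f)
             upper_half (walker_metric (\<lambda>x y. s * y powr \<epsilon>))))
     \<and>
     (\<forall>s\<in>{1, -1}.
        (\<forall>a. a \<noteq> 0 \<longrightarrow> homogeneous UNIV (walker_metric (\<lambda>x y. s * exp (a * y)))) \<and>
        (homothety_homogeneous upper_half (walker_metric (\<lambda>x y. s * ln y)) \<and>
         \<not> locally_homogeneous upper_half (walker_metric (\<lambda>x y. s * ln y)) \<and>
         cohomogeneity_one upper_half (walker_metric (\<lambda>x y. s * ln y))) \<and>
        (\<forall>\<epsilon>. \<epsilon> \<notin> {0, 1, 2} \<longrightarrow>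
           homothety_homogeneous upper_half (walker_metric (\<lambda>x y. s * y powr \<epsilon>)) \<and>
           \<not> locally_homogeneous upper_half (walker_metric (\<lambda>x y. s * y powr \<epsilon>)) \<and>
           cohomogeneity_one upper_half (walker_metric (\<lambda>x y. s * y powr \<epsilon>))))"
proof -
  interpret walker M f by unfold_locales fact+
  have d2: "(deriv ^^ 2) (f x) y = u (x, y)" and d3: "(deriv ^^ 3) (f x) y = dy u (x, y)"
    if "(x, y) \<in> S" for x y
    using deriv_funpow_eq_dy[OF open_S smooth_F that, of 2] deriv_funpow_eq_dy[OF open_S smooth_F that, of 3]
    by (simp_all add: numeral_2_eq_2 numeral_3_eq_3)
  have u0: "u q \<noteq> 0" if "q \<in> S" for q
    using fyy_nonzero that d2 by (cases q) auto
  \<comment> \<open>On an empty domain the second derivative would be constant vacuously.\<close>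
  have M: "M \<noteq> {}"
    using fyy_nonconstant by (auto simp: xy_image_def)
  have uy0: "dy u q \<noteq> 0" if "\<forall>(x, y)\<in>S. (deriv ^^ 3) (f x) y \<noteq> 0" "q \<in> S" for q
    using that d3 by (cases q) auto
  show ?thesis
  proof (intro conjI, goal_cases)
    case 1
    show ?case using homothety_1_curvature_homogeneous[OF \<open>connected M\<close> u0 uy0] by blast
  next
    case 2
    show ?case
    proof (intro allI impI, elim conjE, goal_cases)
      case (1 \<alpha>)
      then have "u (x, y) = \<alpha> x" if "(x, y) \<in> S" for x y using that d2 by force
      note quadratic_case[OF \<open>connected M\<close> M u0 this 1(2)[rule_format]]
      moreover have "locally_homogeneous M (walker_metric f)" if "locally_quadratic_form_on M f a x0" for a x0
        by (rule inverse_square_locally_homogeneous[OF \<open>connected M\<close> quadratic_form_u[OF that]])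
      ultimately show ?case by blast
    qed
  next
    case 3
    show ?case
    proof (intro impI, elim conjE, goal_cases)
      case 1
      then interpret homothety_2_walker M f
        by unfold_locales (use \<open>connected M\<close> M u0 uy0 in auto)
      show ?case by (rule classification)
    qed
  next
    case 4
    show ?case
    proof (rule ballI, goal_cases)
      case (1 s)
      then have "s \<noteq> 0" by auto
      then show ?case using exp_model_homogeneous ln_model[of s] powr_model[of s] by blast
    qed
  qed
qed

end
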